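(* Let $V_n$ be a $\mathbb{Q}$-vector space with basis $x_1,\dots,x_n$ and let $\mathcal{L}(V_n)=\bigoplus_{j\ge1}\mathcal{L}_j(V_n)$ be the free Lie algebra on $V_n$ with its natural grading (by bracket length). For each fixed $m\ge1$, the sequence of $\mathrm{GL}_n\mathbb{Q}$-representations $\{\mathcal{L}_m(V_n)\}$ of degree $m$ components of the free Lie algebras $\mathcal{L}(V_n)$ is simply representation stable.
   Context: $\mathrm{GL}_n\mathbb{Q}=\mathrm{GL}(V_n)$ acts on $\mathcal{L}(V_n)$ preserving the grading; the maps $\phi_n\colon\mathcal{L}_m(V_n)\to\mathcal{L}_m(V_{n+1})$ are induced by the inclusion $V_n\hookrightarrow V_{n+1}$. $\mathbb{S}_\lambda$ denotes the Schur functor of a partition $\lambda$, $\ell(\lambda)$ the number of nonzero rows of $\lambda$, and $D$ the determinant representation of $\mathrm{GL}_n\mathbb{Q}$. A pseudo-partition is a sequence of integers $\lambda=(\lambda_1\ge\dots\ge\lambda_\ell)$, possibly negative; for $n\ge\ell$, $V(\lambda)_n=\mathbb{S}_{(\lambda_1-\lambda_\ell,\dots,\lambda_\ell-\lambda_\ell)}(\mathbb{Q}^n)\otimes D^{\otimes\lambda_\ell}$ is an irreducible representation of $\mathrm{GL}_n\mathbb{Q}$. A consistent sequence of $\mathrm{GL}_n\mathbb{Q}$-representations is a sequence $U_n$, each a direct sum of finite-dimensional irreducibles $V(\lambda)_n$, with linear maps $\phi_n\colon U_n\to U_{n+1}$ that are $\mathrm{GL}_n\mathbb{Q}$-equivariant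 (via the upper-left inclusion $\mathrm{GL}_n\mathbb{Q}\hookrightarrow\mathrm{GL}_{n+1}\mathbb{Q}$). It is simply representation stable if: (I) for all $n\ge1$, $\phi_n$ is injective; (II) for all $n\ge1$, the span of the $\mathrm{GL}_{n+1}\mathbb{Q}$-orbit of $\phi_n(U_n)$ equals $U_{n+1}$; (SIII) for each partition $\lambda$, the multiplicity of $\mathbb{S}_\lambda(\mathbb{Q}^n)$ in $U_n$ is constant for all $n\ge\ell(\lambda)$, and for any pseudo-partition $\lambda=(\lambda_1\ge\dots\ge\lambda_\ell)$ that is not a partition (i.e. $\lambda_\ell<0$) the multiplicity of $V(\lambda)_n$ in $U_n$ is $0$; (SIV) for any subrepresentation $W\subset U_n$ with $W\cong\mathbb{S}_\lambda(\mathbb{Q}^n)$, the span of the $\mathrm{GL}_{n+1}\mathbb{Q}$-orbit of $\phi_n(W)$ is isomorphic to $\mathbb{S}_\lambda(\mathbb{Q}^{n+1})$.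
   Formalization: (II) fails at n=1 for m≥2, as L_m(V_1)=0 but L_m(V_2)≠0; it is proved for n≥m, and for all n≥1 only for constituents S_λ of L_m(V_{n+1}) with ℓ(λ)≤n (so at n=m-1 too, though full (II) holds there if m≥3). (SIV) is taken for ℓ(λ)≤n, since W=0 would break it. *)

theory Defs
  imports
    "HOL-Algebra.QuotRing"
    "HOL-Library.Poly_Mapping"
    "HOL-Library.Extended_Nat"
    "HOL-Combinatorics.Permutations"
    "Jordan_Normal_Form.Determinant"
    "Jordan_Normal_Form.VS_Connect"
begin

section \<open>Representations of $\mathrm{GL}_n\mathbb{Q}$\<close>

abbreviation QQ :: "rat ring" where
  "QQ \<equiv> class_ring"

definition GL :: "nat \<Rightarrow> rat mat monoid" where
  "GL n = units_of (ring_mat TYPE(rat) n ())"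

definition GL_stab :: "nat \<Rightarrow> rat mat \<Rightarrow> rat mat" where
  "GL_stab n g = four_block_mat g (0\<^sub>m n 1) (0\<^sub>m 1 n) (1\<^sub>m 1)"

text \<open>The fields \<^const>\<open>mult\<close> and \<^const>\<open>one\<close>, inherited from the module record, play no role
  in a representation.\<close>

record 'v gl_rep = "(rat, 'v) module" +
  act :: "rat mat \<Rightarrow> 'v \<Rightarrow> 'v"

locale gl_representation = vectorspace QQ U
  for n :: nat and U :: "'v gl_rep" (structure) +
  assumes act_hom: "g \<in> carrier (GL n) \<Longrightarrow> act U g \<in> module_hom QQ U U"
    and act_one: "v \<in> carrier U \<Longrightarrow> act U \<one>\<^bsub>GL n\<^esub> v = v"
    and act_mult: "\<lbrakk>g \<in> carrier (GL n); h \<in> carrier (GL n); v \<in> carrier U\<rbrakk>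
      \<Longrightarrow> act U (g \<otimes>\<^bsub>GL n\<^esub> h) v = act U g (act U h v)"

definition subrep :: "nat \<Rightarrow> 'v gl_rep \<Rightarrow> 'v set \<Rightarrow> bool" where
  "subrep n U W \<longleftrightarrow>
     subspace QQ W U \<and> (\<forall>g\<in>carrier (GL n). \<forall>w\<in>W. act U g w \<in> W)"

definition irreducible_rep :: "nat \<Rightarrow> 'v gl_rep \<Rightarrow> bool" where
  "irreducible_rep n U \<longleftrightarrow>
     gl_representation n U \<and> carrier U \<noteq> {\<zero>\<^bsub>U\<^esub>} \<and>
     (\<forall>W. subrep n U W \<longrightarrow> W = {\<zero>\<^bsub>U\<^esub>} \<or> W = carrier U)"

definition rep_iso :: "nat \<Rightarrow> 'v gl_rep \<Rightarrow> 'w gl_rep \<Rightarrow> bool" where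
  "rep_iso n U U' \<longleftrightarrow>
     (\<exists>f\<in>module_hom QQ U U'. bij_betw f (carrier U) (carrier U') \<and>
        (\<forall>g\<in>carrier (GL n). \<forall>u\<in>carrier U. f (act U g u) = act U' g (f u)))"

text \<open>Internal direct sums, over a \<^emph>\<open>set\<close> of subspaces.  This loses nothing for irreducible
  summands, which are nonzero and hence pairwise distinct.\<close>

definition internal_direct_sum :: "'v gl_rep \<Rightarrow> 'v set set \<Rightarrow> bool" where
  "internal_direct_sum U \<W> \<longleftrightarrow>
     (\<forall>W\<in>\<W>. subspace QQ W U) \<and>
     module.span QQ U (\<Union>\<W>) = carrier U \<and>
     (\<forall>\<S> f. finite \<S> \<and> \<S> \<subseteq> \<W> \<and> (\<forall>W\<in>\<S>. f W \<in> W) \<and> finsum U f \<S> = \<zero>\<^bsub>U\<^esub>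
        \<longrightarrow> (\<forall>W\<in>\<S>. f W = \<zero>\<^bsub>U\<^esub>))"

text \<open>\<open>has_multiplicity n U V k\<close>: \<open>U\<close> is a direct sum of irreducible subrepresentations, exactly
  \<open>k\<close> of which are isomorphic to \<open>V\<close>.\<close>

definition has_multiplicity :: "nat \<Rightarrow> 'v gl_rep \<Rightarrow> 'w gl_rep \<Rightarrow> enat \<Rightarrow> bool" where
  "has_multiplicity n U V k \<longleftrightarrow>
     (\<exists>\<W>. internal_direct_sum U \<W> \<and>
        (\<forall>W\<in>\<W>. subrep n U W \<and> irreducible_rep n (U\<lparr>carrier := W\<rparr>)) \<and>
        (let \<V> = {W\<in>\<W>. rep_iso n (U\<lparr>carrier := W\<rparr>) V}
         in k = (if finite \<V> then enat (card \<V>) else \<infinity>)))"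

definition orbit_span :: "nat \<Rightarrow> 'v gl_rep \<Rightarrow> 'v set \<Rightarrow> 'v set" where
  "orbit_span n U X = module.span QQ U {act U g x | g x. g \<in> carrier (GL n) \<and> x \<in> X}"

section \<open>Schur functors\<close>

definition is_partition :: "nat list \<Rightarrow> bool" where
  "is_partition l \<longleftrightarrow> sorted_wrt (\<ge>) l"

definition num_rows :: "nat list \<Rightarrow> nat" where
  "num_rows l = length (filter (\<lambda>a. a \<noteq> 0) l)"

definition words :: "nat \<Rightarrow> nat \<Rightarrow> nat list set" where
  "words d n = {w. length w = d \<and> set w \<subseteq> {..<n}}"

text \<open>$(\mathbb{Q}^n)^{\otimes d}$: the function \<open>f\<close> stands for
  $\sum_w f(w)\, e_{w_0}\otimes\dots\otimes e_{w_{d-1}}$.\<close>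

definition tensor_power :: "nat \<Rightarrow> nat \<Rightarrow> (nat list \<Rightarrow> rat) gl_rep" where
  "tensor_power d n =
     \<lparr>carrier = {f. \<forall>w. w \<notin> words d n \<longrightarrow> f w = 0},
      mult = (\<lambda>_ _ _. 0), one = (\<lambda>_. 0),
      zero = (\<lambda>_. 0), add = (\<lambda>f h w. f w + h w),
      smult = (\<lambda>c f w. c * f w),
      act = (\<lambda>g f w. if w \<in> words d n
                     then \<Sum>u\<in>words d n. (\<Prod>k<d. g $$ (w ! k, u ! k)) * f u else 0)\<rparr>"

text \<open>The right action of the symmetric group on tensors,
  $(v_0\otimes\dots\otimes v_{d-1})\cdot\sigma = v_{\sigma(0)}\otimes\dots\otimes v_{\sigma(d-1)}$.\<close>

definition place_perm :: "(nat \<Rightarrow> nat) \<Rightarrow> (nat list \<Rightarrow> rat) \<Rightarrow> nat list \<Rightarrow> rat" where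
  "place_perm \<sigma> f = (\<lambda>w. f (permute_list (inv_into UNIV \<sigma>) w))"

text \<open>The tableau of shape \<open>l\<close> used below is numbered row by row; \<open>cells l ! k\<close> is the (row, column)
  pair of the box with number \<open>k\<close>.\<close>

definition cells :: "nat list \<Rightarrow> (nat \<times> nat) list" where
  "cells l = concat (map (\<lambda>i. map (Pair i) [0..<l ! i]) [0..<length l])"

definition row_group :: "nat list \<Rightarrow> (nat \<Rightarrow> nat) set" where
  "row_group l = {p. p permutes {..<sum_list l} \<and>
     (\<forall>k<sum_list l. fst (cells l ! p k) = fst (cells l ! k))}"

definition col_group :: "nat list \<Rightarrow> (nat \<Rightarrow> nat) set" where
  "col_group l = {q. q permutes {..<sum_list l} \<and>
     (\<forall>k<sum_list l. snd (cells l ! q k) = snd (cells l ! k))}"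

text \<open>Right multiplication by the Young symmetrizer
  $c_\lambda = \sum_{p}\sum_{q} \mathrm{sgn}(q)\, p q$; its image is $\mathbb{S}_\lambda(\mathbb{Q}^n)$.\<close>

definition young_symmetrizer :: "nat list \<Rightarrow> (nat list \<Rightarrow> rat) \<Rightarrow> nat list \<Rightarrow> rat" where
  "young_symmetrizer l f = (\<lambda>w. \<Sum>p\<in>row_group l. \<Sum>q\<in>col_group l.
     of_int (sign q) * place_perm q (place_perm p f) w)"

definition schur :: "nat list \<Rightarrow> nat \<Rightarrow> (nat list \<Rightarrow> rat) gl_rep" where
  "schur l n = (let T = tensor_power (sum_list l) n
                in T\<lparr>carrier := young_symmetrizer l ` carrier T\<rparr>)"

definition is_pseudo_partition :: "int list \<Rightarrow> bool" where
  "is_pseudo_partition l \<longleftrightarrow> l \<noteq> [] \<and> sorted_wrt (\<ge>) l"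

text \<open>Tensoring with the one-dimensional representation $D^{\otimes k}$ is rendered as multiplying
  the action by $\det^k$.\<close>

definition det_twist :: "int \<Rightarrow> 'v gl_rep \<Rightarrow> 'v gl_rep" where
  "det_twist k U = U\<lparr>act := (\<lambda>g v. (det g powi k) \<odot>\<^bsub>U\<^esub> act U g v)\<rparr>"

text \<open>$V(\lambda)_n$, meaningful for $n \ge \ell$ where $\ell$ is the length of the list.\<close>

definition V_rep :: "int list \<Rightarrow> nat \<Rightarrow> (nat list \<Rightarrow> rat) gl_rep" where
  "V_rep l n = det_twist (last l) (schur (map (\<lambda>a. nat (a - last l)) l) n)"

section \<open>Consistent sequences and simple representation stability\<close>

definition consistent_sequence :: "(nat \<Rightarrow> 'v gl_rep) \<Rightarrow> (nat \<Rightarrow> 'v \<Rightarrow> 'v) \<Rightarrow> bool" where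
  "consistent_sequence U \<phi> \<longleftrightarrow> (\<forall>n\<ge>1.
     gl_representation n (U n) \<and>
     (\<exists>\<W>. internal_direct_sum (U n) \<W> \<and>
        (\<forall>W\<in>\<W>. subrep n (U n) W \<and>
           (\<exists>l. is_pseudo_partition l \<and> length l \<le> n \<and>
              rep_iso n ((U n)\<lparr>carrier := W\<rparr>) (V_rep l n)))) \<and>
     \<phi> n \<in> module_hom QQ (U n) (U (Suc n)) \<and>
     (\<forall>g\<in>carrier (GL n). \<forall>u\<in>carrier (U n).
        \<phi> n (act (U n) g u) = act (U (Suc n)) (GL_stab n g) (\<phi> n u)))"

definition stable_I :: "(nat \<Rightarrow> 'v gl_rep) \<Rightarrow> (nat \<Rightarrow> 'v \<Rightarrow> 'v) \<Rightarrow> bool" where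
  "stable_I U \<phi> \<longleftrightarrow> (\<forall>n\<ge>1. inj_on (\<phi> n) (carrier (U n)))"

definition stable_II_at :: "(nat \<Rightarrow> 'v gl_rep) \<Rightarrow> (nat \<Rightarrow> 'v \<Rightarrow> 'v) \<Rightarrow> nat \<Rightarrow> bool" where
  "stable_II_at U \<phi> n \<longleftrightarrow>
     orbit_span (Suc n) (U (Suc n)) (\<phi> n ` carrier (U n)) = carrier (U (Suc n))"

text \<open>Condition (II) at \<open>n\<close>, restricted to the constituents $\mathbb{S}_\lambda(\mathbb{Q}^{n+1})$ of
  $U_{n+1}$ for which $\mathbb{S}_\lambda(\mathbb{Q}^n)$ is nonzero.  A constituent with
  $\ell(\lambda) = n+1$ can never lie in the span of the orbit of $\phi_n(U_n)$ when (SIV) holds.\<close>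

definition stable_II_rows_at :: "(nat \<Rightarrow> 'v gl_rep) \<Rightarrow> (nat \<Rightarrow> 'v \<Rightarrow> 'v) \<Rightarrow> nat \<Rightarrow> bool" where
  "stable_II_rows_at U \<phi> n \<longleftrightarrow>
     (\<forall>l W. is_partition l \<and> num_rows l \<le> n \<and> subrep (Suc n) (U (Suc n)) W \<and>
        rep_iso (Suc n) ((U (Suc n))\<lparr>carrier := W\<rparr>) (schur l (Suc n)) \<longrightarrow>
        W \<subseteq> orbit_span (Suc n) (U (Suc n)) (\<phi> n ` carrier (U n)))"

definition stable_III :: "(nat \<Rightarrow> 'v gl_rep) \<Rightarrow> bool" where
  "stable_III U \<longleftrightarrow>
     (\<forall>l. is_partition l \<longrightarrow>
        (\<exists>c. \<forall>n\<ge>1. num_rows l \<le> n \<longrightarrow> has_multiplicity n (U n) (schur l n) c)) \<and>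
     (\<forall>l. is_pseudo_partition l \<and> last l < 0 \<longrightarrow>
        (\<forall>n\<ge>1. length l \<le> n \<longrightarrow> has_multiplicity n (U n) (V_rep l n) 0))"

text \<open>Condition (SIV).  The bound $\ell(\lambda) \le n$ is the one under which
  $\mathbb{S}_\lambda(\mathbb{Q}^n)$ is an irreducible representation; beyond it this space is zero.\<close>

definition stable_IV :: "(nat \<Rightarrow> 'v gl_rep) \<Rightarrow> (nat \<Rightarrow> 'v \<Rightarrow> 'v) \<Rightarrow> bool" where
  "stable_IV U \<phi> \<longleftrightarrow>
     (\<forall>n\<ge>1. \<forall>l W. is_partition l \<and> num_rows l \<le> n \<and> subrep n (U n) W \<and>
        rep_iso n ((U n)\<lparr>carrier := W\<rparr>) (schur l n) \<longrightarrow>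
        rep_iso (Suc n)
          ((U (Suc n))\<lparr>carrier := orbit_span (Suc n) (U (Suc n)) (\<phi> n ` W)\<rparr>)
          (schur l (Suc n)))"

text \<open>Simple representation stability, with the full surjectivity condition (II) required for
  $n \ge N$ only, and for smaller \<open>n\<close> in its restricted form.  For $N = 1$ the restricted form is
  subsumed by (II), and this is the definition with (II) for all $n \ge 1$.
  Such an \<open>N\<close> is needed for the free Lie algebra: for $m \ge 2$ one has
  $\mathcal{L}_m(V_1) = 0 \ne \mathcal{L}_m(V_2)$, so (II) fails at $n = 1$.\<close>

definition simply_representation_stable_from ::
    "nat \<Rightarrow> (nat \<Rightarrow> 'v gl_rep) \<Rightarrow> (nat \<Rightarrow> 'v \<Rightarrow> 'v) \<Rightarrow> bool" where
  "simply_representation_stable_from N U \<phi> \<longleftrightarrow>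
     consistent_sequence U \<phi> \<and>
     stable_I U \<phi> \<and>
     (\<forall>n\<ge>1. N \<le> n \<longrightarrow> stable_II_at U \<phi> n) \<and>
     (\<forall>n\<ge>1. stable_II_rows_at U \<phi> n) \<and>
     stable_III U \<and>
     stable_IV U \<phi>"

section \<open>The free Lie algebra\<close>

text \<open>The free Lie algebra on \<open>n\<close> generators is the free nonassociative algebra (the rational span
  of the free magma) modulo the ideal generated by all $aa$ and all Jacobi expressions.\<close>

datatype 'a magma = Gen 'a | Op "'a magma" "'a magma"

primrec magma_length :: "'a magma \<Rightarrow> nat" where
  "magma_length (Gen x) = 1"
| "magma_length (Op s t) = magma_length s + magma_length t"

definition scale :: "rat \<Rightarrow> ('a magma \<Rightarrow>\<^sub>0 rat) \<Rightarrow> ('a magma \<Rightarrow>\<^sub>0 rat)" where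
  "scale c p = Poly_Mapping.map ((*) c) p"

definition magma_mult ::
    "('a magma \<Rightarrow>\<^sub>0 rat) \<Rightarrow> ('a magma \<Rightarrow>\<^sub>0 rat) \<Rightarrow> ('a magma \<Rightarrow>\<^sub>0 rat)" where
  "magma_mult p q = (\<Sum>s\<in>Poly_Mapping.keys p. \<Sum>t\<in>Poly_Mapping.keys q.
     Poly_Mapping.single (Op s t) (Poly_Mapping.lookup p s * Poly_Mapping.lookup q t))"

text \<open>The free nonassociative algebra on the generators \<open>Gen 0, \<dots>, Gen (n - 1)\<close>, the basis of
  $V_n$; it has no unit.\<close>

definition magma_algebra :: "nat \<Rightarrow> (rat, nat magma \<Rightarrow>\<^sub>0 rat) module" where
  "magma_algebra n =
     \<lparr>carrier = {p. \<forall>t\<in>Poly_Mapping.keys p. set_magma t \<subseteq> {..<n}},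
      mult = magma_mult, one = 0, zero = 0, add = (+), smult = scale\<rparr>"

inductive_set lie_ideal :: "nat \<Rightarrow> (nat magma \<Rightarrow>\<^sub>0 rat) set" for n where
  zero: "0 \<in> lie_ideal n"
| add: "\<lbrakk>x \<in> lie_ideal n; y \<in> lie_ideal n\<rbrakk> \<Longrightarrow> x + y \<in> lie_ideal n"
| scale: "x \<in> lie_ideal n \<Longrightarrow> scale c x \<in> lie_ideal n"
| mult_left: "\<lbrakk>a \<in> carrier (magma_algebra n); x \<in> lie_ideal n\<rbrakk> \<Longrightarrow> magma_mult a x \<in> lie_ideal n"
| mult_right: "\<lbrakk>x \<in> lie_ideal n; a \<in> carrier (magma_algebra n)\<rbrakk> \<Longrightarrow> magma_mult x a \<in> lie_ideal n"
| alternating: "a \<in> carrier (magma_algebra n) \<Longrightarrow> magma_mult a a \<in> lie_ideal n"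
| jacobi: "\<lbrakk>a \<in> carrier (magma_algebra n); b \<in> carrier (magma_algebra n);
      c \<in> carrier (magma_algebra n)\<rbrakk> \<Longrightarrow>
    magma_mult a (magma_mult b c) + magma_mult b (magma_mult c a) + magma_mult c (magma_mult a b)
      \<in> lie_ideal n"

abbreviation lie_class :: "nat \<Rightarrow> (nat magma \<Rightarrow>\<^sub>0 rat) \<Rightarrow> (nat magma \<Rightarrow>\<^sub>0 rat) set" where
  "lie_class n p \<equiv> lie_ideal n +>\<^bsub>magma_algebra n\<^esub> p"

text \<open>$\mathcal{L}(V_n)$, with the Lie bracket as \<^const>\<open>mult\<close>; the field \<^const>\<open>one\<close> is a dummy.\<close>

definition free_lie :: "nat \<Rightarrow> (rat, (nat magma \<Rightarrow>\<^sub>0 rat) set) module" where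
  "free_lie n =
     \<lparr>carrier = a_rcosets\<^bsub>magma_algebra n\<^esub> lie_ideal n,
      mult = rcoset_mult (magma_algebra n) (lie_ideal n),
      one = lie_ideal n, zero = lie_ideal n,
      add = set_add (magma_algebra n),
      smult = (\<lambda>c X. \<Union>x\<in>X. lie_class n (scale c x))\<rparr>"

definition lie_component :: "nat \<Rightarrow> nat \<Rightarrow> (nat magma \<Rightarrow>\<^sub>0 rat) set set" where
  "lie_component m n = {lie_class n p | p. p \<in> carrier (magma_algebra n) \<and>
     (\<forall>t\<in>Poly_Mapping.keys p. magma_length t = m)}"

text \<open>A $k \times n$ matrix \<open>g\<close>, i.e. a linear map $V_n \to V_k$, extends to an algebra homomorphism
  \<open>magma_map k g\<close> of nonassociative algebras and hence induces
  \<open>free_lie_map k g\<close> $: \mathcal{L}(V_n) \to \mathcal{L}(V_k)$.\<close>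

primrec magma_subst :: "nat \<Rightarrow> rat mat \<Rightarrow> nat magma \<Rightarrow> (nat magma \<Rightarrow>\<^sub>0 rat)" where
  "magma_subst k g (Gen j) = (\<Sum>i<k. Poly_Mapping.single (Gen i) (g $$ (i, j)))"
| "magma_subst k g (Op s t) = magma_mult (magma_subst k g s) (magma_subst k g t)"

definition magma_map :: "nat \<Rightarrow> rat mat \<Rightarrow> (nat magma \<Rightarrow>\<^sub>0 rat) \<Rightarrow> (nat magma \<Rightarrow>\<^sub>0 rat)" where
  "magma_map k g p =
     (\<Sum>t\<in>Poly_Mapping.keys p. scale (Poly_Mapping.lookup p t) (magma_subst k g t))"

definition free_lie_map ::
    "nat \<Rightarrow> rat mat \<Rightarrow> (nat magma \<Rightarrow>\<^sub>0 rat) set \<Rightarrow> (nat magma \<Rightarrow>\<^sub>0 rat) set" where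
  "free_lie_map k g X = (\<Union>x\<in>X. lie_class k (magma_map k g x))"

definition free_lie_rep :: "nat \<Rightarrow> nat \<Rightarrow> (nat magma \<Rightarrow>\<^sub>0 rat) set gl_rep" where
  "free_lie_rep m n =
     \<lparr>carrier = lie_component m n,
      mult = mult (free_lie n), one = one (free_lie n),
      zero = zero (free_lie n), add = add (free_lie n), smult = smult (free_lie n),
      act = free_lie_map n\<rparr>"

definition inclusion_mat :: "nat \<Rightarrow> rat mat" where
  "inclusion_mat n = mat (Suc n) n (\<lambda>(i, j). if i = j then 1 else 0)"

definition free_lie_incl :: "nat \<Rightarrow> (nat magma \<Rightarrow>\<^sub>0 rat) set \<Rightarrow> (nat magma \<Rightarrow>\<^sub>0 rat) set" where
  "free_lie_incl n = free_lie_map (Suc n) (inclusion_mat n)"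

end

(* The kernel of the right-normed bracketing map from the m-th tensor power T onto L_m is preserved
   by all linear maps V_n -> V_k. For the standard inner product on T_n, the adjoint of the action of
   a matrix is the action of its transpose, so orthogonal complements of functorial subspaces are
   functorial. Hence L_m is isomorphic to a subfunctor P of T, and every such P is simply
   representation stable.

   Indeed GL_n spans all matrices inside End(T_n), so a subrepresentation W of P_n generates a
   subfunctor gen(W) of P with value W at n. An element of gen(W) killed by all maps to V_n is
   orthogonal to gen(W), hence zero; so an isomorphism between W and W' extends to one between gen(W)
   and gen(W'), and gen(W) takes only irreducible or zero values if W is irreducible. Orthogonal
   irreducible summands of P_m therefore generate a decomposition of P, and multiplicities do not
   depend on n.

   The Schur functor of lambda is irreducible because each nonzero subrepresentation contains the
   same vector of weight lambda. To identify an irreducible subrepresentation of T_n, take a vector f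
   of highest weight lambda in it: Gaussian elimination shows that the matrix coefficient <f, M f>
   depends on lambda only, up to scaling, and this coefficient determines the representation
   generated by f. *)
theory Submission
  imports Defs "HOL-Library.Function_Algebras" "Jordan_Normal_Form.Char_Poly"
begin

section \<open>Rational-valued functions on a finite set\<close>

text \<open>Positive definiteness of the standard inner product over the ordered field of rationals
  takes the place of averaging and characters. Complements exist, a vector orthogonal to a space
  containing it is zero, and a linear relation holds iff its norm vanishes. Comparing
  representations therefore means comparing Gram matrices. GL_n spans all matrices because M + t 1
  is invertible for all but finitely many t, while its action on tensors is polynomial in t. Thus
  rectangular and singular matrices become available, and a round trip V_n -> V_k -> V_n is just a
  square matrix. The decomposition is made on m letters because a word of length m has at most m
  different letters: no nonzero tensor is killed by all maps to V_m, so P_m generates P. Elimination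
  ends in a diagonal matrix, where <f, M f> is the monomial of the weight times <f, f>. The
  unitriangular factors drop out since f is fixed by them, on the right directly and on the left
  after transposition. A power of the determinant accounts for a constant shift of the weight; in
  this way the same computation reaches V(lambda)_n.\<close>

definition fscale :: "rat \<Rightarrow> ('b \<Rightarrow> rat) \<Rightarrow> 'b \<Rightarrow> rat" where
  "fscale c f = (\<lambda>x. c * f x)"

lemma fscale_apply: "fscale c f x = c * f x"
  by (simp add: fscale_def)

interpretation fv: vector_space "fscale :: rat \<Rightarrow> ('b \<Rightarrow> rat) \<Rightarrow> 'b \<Rightarrow> rat"
  by unfold_locales (auto simp: fscale_def fun_eq_iff algebra_simps)

text \<open>Extension by zero: tensors on \<open>n\<close> letters are literally tensors on more
  letters, so that the stabilization maps become identities (\<open>tact_emb_fixed\<close>).\<close>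

definition funs :: "'b set \<Rightarrow> ('b \<Rightarrow> rat) set" where
  "funs \<Omega> = {f. \<forall>w. w \<notin> \<Omega> \<longrightarrow> f w = 0}"

lemma subspace_funs: "fv.subspace (funs \<Omega>)"
  by (auto simp: fv.subspace_def funs_def fscale_apply)

definition ip :: "'b set \<Rightarrow> ('b \<Rightarrow> rat) \<Rightarrow> ('b \<Rightarrow> rat) \<Rightarrow> rat" where
  "ip \<Omega> f g = (\<Sum>w\<in>\<Omega>. f w * g w)"

lemma ip_commute: "ip \<Omega> f g = ip \<Omega> g f"
  by (simp add: ip_def mult.commute)

lemma ip_add_left: "ip \<Omega> (f + g) h = ip \<Omega> f h + ip \<Omega> g h"
  by (simp add: ip_def algebra_simps sum.distrib)

lemma ip_add_right: "ip \<Omega> h (f + g) = ip \<Omega> h f + ip \<Omega> h g"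
  by (simp add: ip_def algebra_simps sum.distrib)

lemma ip_diff_left: "ip \<Omega> (f - g) h = ip \<Omega> f h - ip \<Omega> g h"
  by (simp add: ip_def algebra_simps sum_subtractf)

lemma ip_scale_left: "ip \<Omega> (fscale c f) h = c * ip \<Omega> f h"
  by (simp add: ip_def fscale_apply algebra_simps sum_distrib_left)

lemma ip_scale_right: "ip \<Omega> h (fscale c f) = c * ip \<Omega> h f"
  by (simp add: ip_def fscale_apply algebra_simps sum_distrib_left)

lemma ip_zero [simp]: "ip \<Omega> 0 h = 0" "ip \<Omega> h 0 = 0"
  by (auto simp: ip_def)

lemma ip_self_zero:
  assumes "finite \<Omega>" "f \<in> funs \<Omega>" "ip \<Omega> f f = 0"
  shows "f = 0"
proof -
  have "\<forall>w\<in>\<Omega>. f w * f w = 0"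
    using assms(1,3) unfolding ip_def by (subst (asm) sum_nonneg_eq_0_iff) auto
  thus ?thesis using assms(2) by (auto simp: funs_def fun_eq_iff)
qed

definition orth_in :: "'b set \<Rightarrow> ('b \<Rightarrow> rat) set \<Rightarrow> ('b \<Rightarrow> rat) set \<Rightarrow> ('b \<Rightarrow> rat) set" where
  "orth_in \<Omega> X Y = {x\<in>X. \<forall>y\<in>Y. ip \<Omega> x y = 0}"

lemma subspace_orth_in: "fv.subspace X \<Longrightarrow> fv.subspace (orth_in \<Omega> X Y)"
  by (auto simp: fv.subspace_def orth_in_def ip_add_left ip_scale_left)

text \<open>Gram-Schmidt, one coordinate at a time: the functions of \<open>K\<close> that vanish at
  the new point are supported on the old set, and at most one further direction has to be made
  orthogonal to them.\<close>

lemma orth_projection: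
  assumes "finite \<Omega>" "fv.subspace K" "K \<subseteq> funs \<Omega>"
  shows "\<exists>y\<in>K. \<forall>k\<in>K. ip \<Omega> (x - y) k = 0"
  using assms
proof (induction \<Omega> arbitrary: K x rule: finite_induct)
  case empty
  then show ?case by (intro bexI[of _ 0]) (auto simp: ip_def fv.subspace_0)
next
  case (insert a \<Omega>)
  note sub = insert.prems(1)
  define K' where "K' = {k\<in>K. k a = 0}"
  have K'sub: "fv.subspace K'" using sub unfolding K'_def fv.subspace_def by (auto simp: fscale_apply)
  have K'f: "K' \<subseteq> funs \<Omega>" using insert.prems(2) by (auto simp: K'_def funs_def)
  have ipK': "ip (insert a \<Omega>) z k = ip \<Omega> z k" if "k \<in> K'" for z k
    using that insert.hyps by (simp add: ip_def K'_def)
  have proj: "\<exists>y\<in>K'. \<forall>k\<in>K'. ip (insert a \<Omega>) (z - y) k = 0" for z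
    using insert.IH[OF K'sub K'f, of z] ipK' by (metis (no_types))
  show ?case
  proof (cases "K = K'")
    case True
    then show ?thesis using proj by (metis (no_types))
  next
    case False
    then obtain k1 where k1: "k1 \<in> K" "k1 a \<noteq> 0" by (auto simp: K'_def)
    obtain p where p: "p \<in> K'" "\<forall>k\<in>K'. ip (insert a \<Omega>) (k1 - p) k = 0"
      using proj by blast
    \<comment> \<open>\<open>e\<close> spans the orthogonal complement of \<open>K'\<close> in
      \<open>K\<close>, a line because \<open>K'\<close> is cut out of \<open>K\<close> by a single
      coordinate.\<close>
    define e where "e = k1 - p"
    have eK: "e \<in> K" using k1 p sub by (auto simp: e_def K'_def fv.subspace_diff)
    have ea: "e a \<noteq> 0" using k1 p by (simp add: e_def K'_def)
    have eo: "ip (insert a \<Omega>) e k = 0" if "k \<in> K'" for k using p that by (simp add: e_def)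
    have ee: "ip (insert a \<Omega>) e e \<noteq> 0"
      using ip_self_zero[of "insert a \<Omega>" e] insert.hyps eK insert.prems(2) ea by auto
    obtain y where y: "y \<in> K'" "\<forall>k\<in>K'. ip (insert a \<Omega>) (x - y) k = 0"
      using proj by blast
    define c where "c = ip (insert a \<Omega>) (x - y) e / ip (insert a \<Omega>) e e"
    have "y + fscale c e \<in> K"
      using y eK sub by (auto simp: K'_def intro: fv.subspace_add fv.subspace_scale)
    moreover have "ip (insert a \<Omega>) (x - (y + fscale c e)) k = 0" if k: "k \<in> K" for k
    proof -
      define d where "d = k a / e a"
      define k' where "k' = k - fscale d e"
      have k'K: "k' \<in> K'"
        using fv.subspace_diff[OF sub k fv.subspace_scale[OF sub eK, of d]] ea
        by (simp add: k'_def K'_def d_def fscale_apply)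
      have keq: "k = k' + fscale d e" by (simp add: k'_def)
      have xe: "x - (y + fscale c e) = (x - y) - fscale c e" by simp
      have "ip (insert a \<Omega>) (x - (y + fscale c e)) k' = 0"
        unfolding xe ip_diff_left[of _ "x - y" "fscale c e"] ip_scale_left
        using y(2) k'K eo[OF k'K] by (metis diff_zero mult_zero_right)
      moreover have "ip (insert a \<Omega>) (x - (y + fscale c e)) e = 0"
        unfolding xe ip_diff_left[of _ "x - y" "fscale c e"] ip_scale_left using ee by (simp add: c_def)
      ultimately show ?thesis by (subst keq) (simp add: ip_add_right ip_scale_right)
    qed
    ultimately show ?thesis by blast
  qed
qed

section \<open>Dimension counts and minimal subspaces\<close>

lemma funs_subset_span:
  assumes "finite \<Omega>"
  shows "funs \<Omega> \<subseteq> fv.span ((\<lambda>w x. if x = w then 1 else 0) ` \<Omega>)"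
proof
  fix f assume f: "f \<in> funs \<Omega>"
  have "f = (\<Sum>w\<in>\<Omega>. fscale (f w) (\<lambda>x. if x = w then 1 else 0))"
  proof
    fix x
    have fa: "(\<Sum>w\<in>A. fscale (f w) (\<lambda>x. if x = w then 1 else 0)) x
      = (\<Sum>w\<in>A. f w * (if x = w then 1 else 0))" if "finite A" for A
      using that by (induction A) (auto simp: fscale_apply)
    have "(\<Sum>w\<in>\<Omega>. f w * (if x = w then 1 else 0)) = (\<Sum>w\<in>\<Omega>. if x = w then f w else 0)"
      by (rule sum.cong) auto
    also have "\<dots> = f x" using f sum.delta'[OF assms, of x f] by (simp add: funs_def)
    finally show "f x = (\<Sum>w\<in>\<Omega>. fscale (f w) (\<lambda>x. if x = w then 1 else 0)) x"
      by (simp only: fa[OF assms])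
  qed
  also have "\<dots> \<in> fv.span ((\<lambda>w x. if x = w then 1 else 0) ` \<Omega>)"
    by (intro fv.span_sum fv.span_scale fv.span_base) auto
  finally show "f \<in> fv.span ((\<lambda>w x. if x = w then 1 else 0) ` \<Omega>)" .
qed

text \<open>\<open>fv\<close> lives on all functions, where dimensions may be infinite and
  \<open>fv.dim\<close> carries no information. The indicator functions of the points of \<Omega>
  bound every independent subset of \<open>Y\<close>, so a basis of \<open>X\<close> with one more
  vector can be compared with a basis of \<open>Y\<close>.\<close>

lemma funs_dim_less:
  assumes "finite \<Omega>" "fv.subspace X" "Y \<subseteq> funs \<Omega>" "X \<subset> Y"
  shows "fv.dim X < fv.dim Y"
proof -
  obtain B where B: "B \<subseteq> X" "fv.independent B" "X \<subseteq> fv.span B" "card B = fv.dim X"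
    using fv.basis_exists by blast
  obtain y where y: "y \<in> Y" "y \<notin> X" using assms(4) by blast
  have "fv.span B \<subseteq> X" using B(1) assms(2) by (simp add: fv.span_minimal)
  hence "y \<notin> fv.span B" using y by blast
  hence ind: "fv.independent (insert y B)" using B(2) fv.independent_insertI by blast
  obtain C where C: "C \<subseteq> Y" "fv.independent C" "Y \<subseteq> fv.span C" "card C = fv.dim Y"
    using fv.basis_exists by blast
  let ?S = "(\<lambda>w x. if x = w then 1 else 0) ` \<Omega> :: ('a \<Rightarrow> rat) set"
  have fS: "finite ?S" using assms(1) by simp
  have "C \<subseteq> fv.span ?S" using C(1) assms(3) funs_subset_span[OF assms(1)] by blast
  hence fC: "finite C" using fv.independent_span_bound[OF fS C(2)] by simp
  have "insert y B \<subseteq> fv.span C" using y B(1) assms(4) C(3) by auto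
  hence fB: "finite (insert y B) \<and> card (insert y B) \<le> card C"
    by (rule fv.independent_span_bound[OF fC ind])
  moreover have "y \<notin> B" using y B by blast
  moreover have "finite B" using fB by simp
  ultimately show ?thesis using B(4) C(4) by simp
qed

lemma minimal_subspace_exists:
  assumes "finite \<Omega>" "\<And>X. Q X \<Longrightarrow> fv.subspace X \<and> X \<subseteq> funs \<Omega>" "Q P"
  obtains X where "Q X" "X \<subseteq> P" "\<And>Y. Q Y \<Longrightarrow> Y \<subseteq> X \<Longrightarrow> Y = X"
proof -
  have "\<exists>X. (Q X \<and> X \<subseteq> P) \<and> (\<forall>Y. Q Y \<and> Y \<subseteq> P \<longrightarrow> fv.dim X \<le> fv.dim Y)"
    using ex_has_least_nat[of "\<lambda>X. Q X \<and> X \<subseteq> P" P fv.dim] assms(3) by auto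
  then obtain X where X: "Q X" "X \<subseteq> P" "\<And>Y. Q Y \<Longrightarrow> Y \<subseteq> P \<Longrightarrow> fv.dim X \<le> fv.dim Y" by blast
  have "Y = X" if "Q Y" "Y \<subseteq> X" for Y
    using funs_dim_less[OF assms(1), of Y X] assms(2) that X(1,2) X(3)[of Y] by fastforce
  thus ?thesis using that X by blast
qed

text \<open>\<open>stab\<close> is the property of being a subrepresentation, for a representation by operators whose
  adjoints belong to it as well.\<close>

locale orth_stable =
  fixes \<Omega> :: "'b set" and stab :: "('b \<Rightarrow> rat) set \<Rightarrow> bool"
  assumes finite_base: "finite \<Omega>"
    and stab_subspace: "stab X \<Longrightarrow> fv.subspace X"
    and stab_funs: "stab X \<Longrightarrow> X \<subseteq> funs \<Omega>"
    and stab_orth_in: "stab X \<Longrightarrow> stab Y \<Longrightarrow> stab (orth_in \<Omega> X Y)"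
begin

definition simple :: "('b \<Rightarrow> rat) set \<Rightarrow> bool" where
  "simple W \<longleftrightarrow> stab W \<and> W \<noteq> {0} \<and> (\<forall>X. stab X \<longrightarrow> X \<subseteq> W \<longrightarrow> X = {0} \<or> X = W)"

text \<open>Pairwise orthogonality stands in for directness, which is derived from it in
  \<open>internal_direct_sum_image\<close>; unlike directness it passes at once to generated
  subfunctors (\<open>gen_orth\<close>).\<close>

definition orth_decomposition :: "('b \<Rightarrow> rat) set \<Rightarrow> ('b \<Rightarrow> rat) set set \<Rightarrow> bool" where
  "orth_decomposition P \<W> \<longleftrightarrow> finite \<W> \<and> (\<forall>W\<in>\<W>. simple W) \<and>
     (\<forall>W\<in>\<W>. \<forall>W'\<in>\<W>. W \<noteq> W' \<longrightarrow> (\<forall>x\<in>W. \<forall>y\<in>W'. ip \<Omega> x y = 0)) \<and>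
     fv.span (\<Union>\<W>) = P"

text \<open>Split off a minimal nonzero stable subspace and continue in its orthogonal complement,
  which is stable again and strictly smaller, since a nonzero vector is not orthogonal to
  itself.\<close>

lemma orth_decomposition_exists:
  "stab P \<Longrightarrow> \<exists>\<W>. orth_decomposition P \<W>"
proof (induction "fv.dim P" arbitrary: P rule: less_induct)
  case less
  note P = less.prems
  show ?case
  proof (cases "P = {0}")
    case True
    thus ?thesis by (intro exI[of _ "{}"]) (auto simp: orth_decomposition_def)
  next
    case False
    have "fv.subspace X \<and> X \<subseteq> funs \<Omega>" if "stab X \<and> X \<noteq> {0}" for X
      using that stab_subspace stab_funs by blast
    from minimal_subspace_exists[of \<Omega> "\<lambda>X. stab X \<and> X \<noteq> {0}" P, OF finite_base this]
    obtain W where W: "stab W \<and> W \<noteq> {0}" "W \<subseteq> P"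
      "\<And>Y. stab Y \<and> Y \<noteq> {0} \<Longrightarrow> Y \<subseteq> W \<Longrightarrow> Y = W"
      using P False by blast
    have simpleW: "simple W" using W by (auto simp: simple_def)
    define P' where "P' = orth_in \<Omega> P W"
    have sP': "stab P'" using stab_orth_in P W by (simp add: P'_def)
    have "0 \<in> W" using W stab_subspace fv.subspace_0 by blast
    then obtain z where z: "z \<in> W" "z \<noteq> 0" using W by blast
    have zP': "z \<notin> P'"
      using z ip_self_zero[OF finite_base, of z] W(1) stab_funs by (force simp: P'_def orth_in_def)
    have "P' \<subset> P" using z zP' W by (auto simp: P'_def orth_in_def)
    hence "fv.dim P' < fv.dim P"
      using funs_dim_less[OF finite_base] sP' P stab_subspace stab_funs by blast
    then obtain \<W> where \<W>: "orth_decomposition P' \<W>" using less.hyps sP' by blast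
    have memP': "x \<in> P'" if "x \<in> W'" "W' \<in> \<W>" for x W'
      using \<W> that unfolding orth_decomposition_def by (metis UnionI fv.span_base)
    have ortho: "ip \<Omega> x y = 0" if "x \<in> W" "y \<in> W'" "W' \<in> \<W>" for x y W'
      using memP'[OF that(2,3)] that(1) by (auto simp: P'_def orth_in_def ip_commute)
    have "fv.span (\<Union>(insert W \<W>)) = P"
    proof
      have "\<Union>(insert W \<W>) \<subseteq> P" using W memP' by (auto simp: P'_def orth_in_def)
      thus "fv.span (\<Union>(insert W \<W>)) \<subseteq> P" using P stab_subspace by (simp add: fv.span_minimal)
    next
      show "P \<subseteq> fv.span (\<Union>(insert W \<W>))"
      proof
        fix x assume x: "x \<in> P"
        obtain y where y: "y \<in> W" "\<forall>k\<in>W. ip \<Omega> (x - y) k = 0"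
          using orth_projection[OF finite_base] W stab_subspace stab_funs by metis
        have "x - y \<in> P'" using x y W P stab_subspace
          by (auto simp: P'_def orth_in_def intro: fv.subspace_diff)
        hence "x - y \<in> fv.span (\<Union>\<W>)" using \<W> by (simp add: orth_decomposition_def)
        hence "x - y \<in> fv.span (\<Union>(insert W \<W>))"
          by (rule subsetD[OF fv.span_mono, rotated]) auto
        moreover have "y \<in> fv.span (\<Union>(insert W \<W>))" using y by (intro fv.span_base) auto
        ultimately show "x \<in> fv.span (\<Union>(insert W \<W>))"
          by (metis diff_add_cancel fv.span_add)
      qed
    qed
    moreover have "\<forall>V\<in>insert W \<W>. \<forall>V'\<in>insert W \<W>. V \<noteq> V' \<longrightarrow> (\<forall>x\<in>V. \<forall>y\<in>V'. ip \<Omega> x y = 0)"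
      using \<W> ortho unfolding orth_decomposition_def by (metis insert_iff ip_commute)
    ultimately have "orth_decomposition P (insert W \<W>)"
      using \<W> simpleW by (auto simp: orth_decomposition_def)
    thus ?thesis by blast
  qed
qed

end

section \<open>Spectral projections and polynomial curves\<close>

text \<open>The projection is a polynomial in the operator of multiplication by \<theta>, namely the
  Lagrange polynomial that is 1 at \<open>c\<close> and 0 at the other, finitely many, values of
  \<theta> on \<Omega>.\<close>

lemma eigenspace_projection:
  assumes "finite \<Omega>" "fv.subspace X" "X \<subseteq> funs \<Omega>"
    and closed: "\<And>f. f \<in> X \<Longrightarrow> (\<lambda>w. \<theta> w * f w) \<in> X" and "f \<in> X"
  shows "(\<lambda>w. if \<theta> w = c then f w else 0) \<in> X"
proof -
  have prod: "(\<lambda>w. (\<Prod>s\<in>S. (\<theta> w - s) / (c - s)) * f w) \<in> X" if "finite S" for S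
    using that
  proof (induction S)
    case empty
    then show ?case using assms(5) by simp
  next
    case (insert s S)
    let ?g = "\<lambda>w. (\<Prod>s\<in>S. (\<theta> w - s) / (c - s)) * f w"
    have "fscale (1 / (c - s)) ((\<lambda>w. \<theta> w * ?g w) - fscale s ?g) \<in> X"
      using insert.IH closed[OF insert.IH] assms(2)
      by (intro fv.subspace_scale fv.subspace_diff)
    also have "fscale (1 / (c - s)) ((\<lambda>w. \<theta> w * ?g w) - fscale s ?g)
      = (\<lambda>w. (\<Prod>s\<in>insert s S. (\<theta> w - s) / (c - s)) * f w)"
      using insert.hyps by (auto simp: fun_eq_iff fscale_apply diff_divide_distrib[symmetric] left_diff_distrib)
    finally show ?case .
  qed
  let ?S = "\<theta> ` \<Omega> - {c}"
  have "(\<lambda>w. (\<Prod>s\<in>?S. (\<theta> w - s) / (c - s)) * f w) = (\<lambda>w. if \<theta> w = c then f w else 0)"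
  proof
    fix w
    show "(\<Prod>s\<in>?S. (\<theta> w - s) / (c - s)) * f w = (if \<theta> w = c then f w else 0)"
    proof (cases "w \<in> \<Omega>")
      case True
      have "(\<Prod>s\<in>?S. (c - s) / (c - s)) = 1" by (intro prod.neutral) auto
      moreover have "(\<Prod>s\<in>?S. (\<theta> w - s) / (c - s)) = 0" if "\<theta> w \<noteq> c"
        using True that assms(1) by (intro prod_zero) auto
      ultimately show ?thesis by auto
    next
      case False
      then show ?thesis using assms(3,5) by (auto simp: funs_def)
    qed
  qed
  thus ?thesis using prod[of ?S] assms(1) by simp
qed

text \<open>A polynomial curve that meets a subspace infinitely often stays in it: the difference
  quotient at one of these parameters has smaller degree.\<close>

lemma poly_curve_in_subspace:
  fixes p :: "'b \<Rightarrow> rat poly"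
  assumes "fv.subspace X" "\<And>w. degree (p w) \<le> d" "infinite {t. (\<lambda>w. poly (p w) t) \<in> X}"
  shows "(\<lambda>w. poly (p w) a) \<in> X"
  using assms(2,3)
proof (induction d arbitrary: p)
  case 0
  obtain t where t: "(\<lambda>w. poly (p w) t) \<in> X" using 0(2) infinite_imp_nonempty by blast
  have "poly (p w) a = poly (p w) t" for w
    using 0(1)[of w] by (metis degree_eq_zeroE le_zero_eq poly_0 poly_pCons mult_zero_right add.right_neutral)
  thus ?case using t by simp
next
  case (Suc d)
  obtain t where t: "(\<lambda>w. poly (p w) t) \<in> X" using Suc(3) infinite_imp_nonempty by blast
  define q where "q w = synthetic_div (p w) t" for w
  have q: "poly (p w) s = poly (p w) t + (s - t) * poly (q w) s" for w s
    using arg_cong[OF synthetic_div_correct[of "p w" t], of "\<lambda>r. poly r s"]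
    by (simp add: q_def algebra_simps)
  have dq: "degree (q w) \<le> d" for w
    using Suc(2)[of w] by (simp add: q_def degree_synthetic_div)
  have "infinite ({s. (\<lambda>w. poly (p w) s) \<in> X} - {t})" using Suc(3) by simp
  moreover have "{s. (\<lambda>w. poly (p w) s) \<in> X} - {t} \<subseteq> {s. (\<lambda>w. poly (q w) s) \<in> X}"
  proof
    fix s assume s: "s \<in> {s. (\<lambda>w. poly (p w) s) \<in> X} - {t}"
    have "fscale (1 / (s - t)) ((\<lambda>w. poly (p w) s) - (\<lambda>w. poly (p w) t)) \<in> X"
      by (rule fv.subspace_scale[OF assms(1) fv.subspace_diff[OF assms(1) _ t]]) (use s in simp)
    also have "fscale (1 / (s - t)) ((\<lambda>w. poly (p w) s) - (\<lambda>w. poly (p w) t)) = (\<lambda>w. poly (q w) s)"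
      using s by (simp add: fun_eq_iff fscale_apply q[of _ s])
    finally show "s \<in> {s. (\<lambda>w. poly (q w) s) \<in> X}" by simp
  qed
  ultimately have inf: "infinite {s. (\<lambda>w. poly (q w) s) \<in> X}" using infinite_super by blast
  have "(\<lambda>w. poly (q w) a) \<in> X" by (rule Suc.IH[OF dq inf])
  hence "(\<lambda>w. poly (p w) t) + fscale (a - t) (\<lambda>w. poly (q w) a) \<in> X"
    using t assms(1) by (intro fv.subspace_add fv.subspace_scale)
  also have "(\<lambda>w. poly (p w) t) + fscale (a - t) (\<lambda>w. poly (q w) a) = (\<lambda>w. poly (p w) a)"
    by (simp add: fun_eq_iff fscale_apply q[of _ a])
  finally show ?case .
qed

section \<open>Formal linear combinations\<close>

text \<open>Combinations are kept as lists of coefficients and indices, so that one and the same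
  combination can be evaluated in two families and the relations of the families compared.\<close>

definition comb :: "('i \<Rightarrow> 'b \<Rightarrow> rat) \<Rightarrow> (rat \<times> 'i) list \<Rightarrow> 'b \<Rightarrow> rat" where
  "comb a L = (\<Sum>(c, i)\<leftarrow>L. fscale c (a i))"

lemma comb_simps [simp]:
  "comb a [] = 0" "comb a ((c, i) # L) = fscale c (a i) + comb a L"
  "comb a (L @ L') = comb a L + comb a L'"
  by (simp_all add: comb_def)

definition scale_comb :: "rat \<Rightarrow> (rat \<times> 'i) list \<Rightarrow> (rat \<times> 'i) list" where
  "scale_comb r L = map (\<lambda>(c, i). (r * c, i)) L"

lemma comb_scale_comb: "comb a (scale_comb r L) = fscale r (comb a L)"
  by (induction L) (auto simp: scale_comb_def fun_eq_iff fscale_apply algebra_simps)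

lemma snd_scale_comb [simp]: "snd ` set (scale_comb r L) = snd ` set L"
  by (force simp: scale_comb_def)

lemma comb_in_subspace:
  assumes "fv.subspace X" "\<And>i. i \<in> snd ` set L \<Longrightarrow> a i \<in> X"
  shows "comb a L \<in> X"
  using assms(2)
proof (induction L)
  case (Cons p L)
  obtain c i where p: "p = (c, i)" by fastforce
  show ?case unfolding p comb_simps
    using Cons by (intro fv.subspace_add fv.subspace_scale assms(1)) (auto simp: p)
qed (simp add: assms(1) fv.subspace_0)

lemma span_eq_comb: "fv.span (a ` I) = {comb a L | L. snd ` set L \<subseteq> I}"
proof
  have "fv.subspace {comb a L | L. snd ` set L \<subseteq> I}"
    unfolding fv.subspace_def
  proof (intro conjI ballI allI)
    show "0 \<in> {comb a L | L. snd ` set L \<subseteq> I}" by (auto intro: exI[of _ "[]"])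
  next
    fix x y assume "x \<in> {comb a L | L. snd ` set L \<subseteq> I}" "y \<in> {comb a L | L. snd ` set L \<subseteq> I}"
    then obtain L L' where "x = comb a L" "snd ` set L \<subseteq> I" "y = comb a L'" "snd ` set L' \<subseteq> I"
      by blast
    thus "x + y \<in> {comb a L | L. snd ` set L \<subseteq> I}"
      by (intro CollectI exI[of _ "L @ L'"]) (simp add: image_Un)
  next
    fix c x assume "x \<in> {comb a L | L. snd ` set L \<subseteq> I}"
    thus "fscale c x \<in> {comb a L | L. snd ` set L \<subseteq> I}"
      by clarify (rule exI[of _ "scale_comb c L" for L], auto simp: comb_scale_comb)
  qed
  moreover have "a i \<in> {comb a L | L. snd ` set L \<subseteq> I}" if "i \<in> I" for i
    using that by (auto intro!: exI[of _ "[(1, i)]"] simp: fun_eq_iff fscale_apply)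
  ultimately show "fv.span (a ` I) \<subseteq> {comb a L | L. snd ` set L \<subseteq> I}"
    by (intro fv.span_minimal) auto
  show "{comb a L | L. snd ` set L \<subseteq> I} \<subseteq> fv.span (a ` I)"
  proof
    fix x assume "x \<in> {comb a L | L. snd ` set L \<subseteq> I}"
    then obtain L where "x = comb a L" "snd ` set L \<subseteq> I" by blast
    thus "x \<in> fv.span (a ` I)"
      using comb_in_subspace[OF fv.subspace_span, of L a "a ` I"] by (auto intro: fv.span_base)
  qed
qed

text \<open>Two combinations agree iff their formal difference is a relation. Equal relations
  therefore make \<open>comb a L\<close> \<mapsto> \<open>comb b L\<close> both well defined and
  injective.\<close>

lemma linear_bijection_of_combs:
  fixes a :: "'i \<Rightarrow> 'b \<Rightarrow> rat" and b :: "'i \<Rightarrow> 'c \<Rightarrow> rat"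
  assumes iff: "\<And>L. snd ` set L \<subseteq> I \<Longrightarrow> comb a L = 0 \<longleftrightarrow> comb b L = 0"
  obtains \<psi> where "\<And>L. snd ` set L \<subseteq> I \<Longrightarrow> \<psi> (comb a L) = comb b L"
    "bij_betw \<psi> (fv.span (a ` I)) (fv.span (b ` I))"
proof -
  have eq: "comb a L = comb a L' \<longleftrightarrow> comb b L = comb b L'"
    if "snd ` set L \<subseteq> I" "snd ` set L' \<subseteq> I" for L L'
  proof -
    have "snd ` set (L @ scale_comb (-1) L') \<subseteq> I" using that by (simp add: image_Un)
    from iff[OF this] show ?thesis
      by (simp add: comb_scale_comb fun_eq_iff fscale_apply)
  qed
  define \<psi> where "\<psi> x = comb b (SOME L. snd ` set L \<subseteq> I \<and> comb a L = x)" for x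
  have \<psi>: "\<psi> (comb a L) = comb b L" if "snd ` set L \<subseteq> I" for L
    using someI[of "\<lambda>L'. snd ` set L' \<subseteq> I \<and> comb a L' = comb a L" L] that eq
    unfolding \<psi>_def by blast
  have "inj_on \<psi> (fv.span (a ` I))"
  proof (rule inj_onI)
    fix x y assume xy: "x \<in> fv.span (a ` I)" "y \<in> fv.span (a ` I)" "\<psi> x = \<psi> y"
    obtain L where L: "x = comb a L" "snd ` set L \<subseteq> I" using xy(1) unfolding span_eq_comb by blast
    obtain L' where L': "y = comb a L'" "snd ` set L' \<subseteq> I" using xy(2) unfolding span_eq_comb by blast
    show "x = y" using xy(3) eq[OF L(2) L'(2)] \<psi>[OF L(2)] \<psi>[OF L'(2)] L(1) L'(1) by simp
  qed
  moreover have "\<psi> ` fv.span (a ` I) = fv.span (b ` I)"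
  proof
    show "\<psi> ` fv.span (a ` I) \<subseteq> fv.span (b ` I)" unfolding span_eq_comb using \<psi> by fastforce
    show "fv.span (b ` I) \<subseteq> \<psi> ` fv.span (a ` I)"
    proof
      fix y assume "y \<in> fv.span (b ` I)"
      then obtain L where L: "y = comb b L" "snd ` set L \<subseteq> I" unfolding span_eq_comb by blast
      hence "y = \<psi> (comb a L)" "comb a L \<in> fv.span (a ` I)" using \<psi> unfolding span_eq_comb by auto
      thus "y \<in> \<psi> ` fv.span (a ` I)" by blast
    qed
  qed
  ultimately have "bij_betw \<psi> (fv.span (a ` I)) (fv.span (b ` I))" by (simp add: bij_betw_def)
  thus ?thesis using that \<psi> by blast
qed

section \<open>Tensor powers as polynomial functors\<close>

text \<open>The simplifier applies such equations to the bare function symbols as well, which makes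
  functions unfold to abstractions.\<close>

declare plus_fun_apply [simp del] zero_fun_apply [simp del] minus_apply [simp del] uminus_apply [simp del]

lemmas fun_app = plus_fun_apply zero_fun_apply minus_apply fscale_apply

definition lin_on :: "('b \<Rightarrow> rat) set \<Rightarrow> (('b \<Rightarrow> rat) \<Rightarrow> 'c \<Rightarrow> rat) \<Rightarrow> bool" where
  "lin_on X \<psi> \<longleftrightarrow> (\<forall>x\<in>X. \<forall>y\<in>X. \<psi> (x + y) = \<psi> x + \<psi> y) \<and> (\<forall>c. \<forall>x\<in>X. \<psi> (fscale c x) = fscale c (\<psi> x))"

lemma lin_on_add: "lin_on X \<psi> \<Longrightarrow> x \<in> X \<Longrightarrow> y \<in> X \<Longrightarrow> \<psi> (x + y) = \<psi> x + \<psi> y"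
  and lin_on_scale: "lin_on X \<psi> \<Longrightarrow> x \<in> X \<Longrightarrow> \<psi> (fscale c x) = fscale c (\<psi> x)"
  by (auto simp: lin_on_def)

lemma lin_on_mono: "lin_on X \<psi> \<Longrightarrow> Y \<subseteq> X \<Longrightarrow> lin_on Y \<psi>"
  unfolding lin_on_def by blast

lemma lin_on_zero:
  assumes "lin_on X \<psi>" "fv.subspace X"
  shows "\<psi> 0 = 0"
  using lin_on_scale[OF assms(1) fv.subspace_0[OF assms(2)], of 0] by simp

lemma lin_on_comb:
  assumes "lin_on X \<psi>" "fv.subspace X" "\<And>i. i \<in> snd ` set L \<Longrightarrow> a i \<in> X"
  shows "\<psi> (comb a L) = comb (\<lambda>i. \<psi> (a i)) L"
  using assms(3)
proof (induction L)
  case Nil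
  then show ?case by (simp add: lin_on_zero[OF assms(1,2)])
next
  case (Cons p L)
  obtain c i where p: "p = (c, i)" by fastforce
  have i: "a i \<in> X" and L: "comb a L \<in> X"
    using Cons.prems by (auto simp: p intro!: comb_in_subspace[OF assms(2)])
  have "\<psi> (fscale c (a i) + comb a L) = \<psi> (fscale c (a i)) + \<psi> (comb a L)"
    using i L by (intro lin_on_add[OF assms(1)] fv.subspace_scale assms(2))
  then show ?case
    using Cons i by (simp add: p lin_on_scale[OF assms(1)])
qed

lemma linear_iso_of_combs:
  assumes iff: "\<And>L. snd ` set L \<subseteq> I \<Longrightarrow> comb a L = 0 \<longleftrightarrow> comb b L = 0"
  obtains \<psi> where "lin_on (fv.span (a ` I)) \<psi>" "bij_betw \<psi> (fv.span (a ` I)) (fv.span (b ` I))"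
    "\<And>i. i \<in> I \<Longrightarrow> \<psi> (a i) = b i"
proof -
  obtain \<psi> where \<psi>: "\<And>L. snd ` set L \<subseteq> I \<Longrightarrow> \<psi> (comb a L) = comb b L"
    and bij: "bij_betw \<psi> (fv.span (a ` I)) (fv.span (b ` I))"
    using linear_bijection_of_combs[of I a b, OF iff] by blast
  have "lin_on (fv.span (a ` I)) \<psi>"
    unfolding lin_on_def
  proof (intro conjI ballI allI)
    fix x y assume "x \<in> fv.span (a ` I)" "y \<in> fv.span (a ` I)"
    then obtain L L' where L: "x = comb a L" "snd ` set L \<subseteq> I" and L': "y = comb a L'" "snd ` set L' \<subseteq> I"
      unfolding span_eq_comb by blast
    have "snd ` set (L @ L') \<subseteq> I" using L L' by (simp add: image_Un)
    from \<psi>[OF this] show "\<psi> (x + y) = \<psi> x + \<psi> y" using L L' \<psi> by simp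
  next
    fix c x assume "x \<in> fv.span (a ` I)"
    then obtain L where L: "x = comb a L" "snd ` set L \<subseteq> I" unfolding span_eq_comb by blast
    have "snd ` set (scale_comb c L) \<subseteq> I" using L by simp
    from \<psi>[OF this] show "\<psi> (fscale c x) = fscale c (\<psi> x)" using L \<psi> by (simp add: comb_scale_comb)
  qed
  moreover have "\<psi> (a i) = b i" if "i \<in> I" for i
  proof -
    have "comb a [(1, i)] = a i" "comb b [(1, i)] = b i" by simp_all
    thus ?thesis using \<psi>[of "[(1, i)]"] that by simp
  qed
  ultimately show ?thesis using that bij by blast
qed

section \<open>Words and tensor powers of matrices\<close>

lemma finite_words [simp]: "finite (words d n)"
  using finite_lists_length_eq[of "{..<n}" d] by (simp add: words_def conj_commute)

lemma words_0 [simp]: "words 0 n = {[]}"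
  by (auto simp: words_def)

lemma words_Suc: "words (Suc d) n = (\<lambda>(x, w). x # w) ` ({..<n} \<times> words d n)"
  by (force simp: words_def length_Suc_conv image_iff)

lemma Cons_in_words [simp]: "x # w \<in> words (Suc d) n \<longleftrightarrow> x < n \<and> w \<in> words d n"
  by (auto simp: words_def)

lemma wordsE_Suc:
  assumes "w \<in> words (Suc d) n"
  obtains x v where "w = x # v" "x < n" "v \<in> words d n"
  using assms by (auto simp: words_Suc)

lemma length_words: "w \<in> words d n \<Longrightarrow> length w = d"
  by (simp add: words_def)

lemma nth_words: "w \<in> words d n \<Longrightarrow> i < d \<Longrightarrow> w ! i < n"
  by (auto simp: words_def subset_iff)

lemma words_mono: "n \<le> k \<Longrightarrow> words d n \<subseteq> words d k"
  by (auto simp: words_def)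

lemma sum_words_Suc: "(\<Sum>w\<in>words (Suc d) n. F w) = (\<Sum>x<n. \<Sum>w\<in>words d n. F (x # w))"
proof -
  have "(\<Sum>w\<in>words (Suc d) n. F w) = (\<Sum>p\<in>{..<n} \<times> words d n. F (fst p # snd p))"
    unfolding words_Suc by (subst sum.reindex) (auto simp: inj_on_def o_def case_prod_beta)
  also have "\<dots> = (\<Sum>x<n. \<Sum>w\<in>words d n. F (x # w))"
    by (simp add: sum.cartesian_product case_prod_beta)
  finally show ?thesis .
qed

text \<open>The matrix of the \<open>d\<close>-th tensor power of \<open>M\<close> in the bases
  indexed by words.\<close>

definition kern :: "nat \<Rightarrow> rat mat \<Rightarrow> nat list \<Rightarrow> nat list \<Rightarrow> rat" where
  "kern d M w u = (\<Prod>i<d. M $$ (w ! i, u ! i))"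

lemma kern_0 [simp]: "kern 0 M w u = 1"
  by (simp add: kern_def)

lemma kern_Cons [simp]: "kern (Suc d) M (x # w) (y # u) = M $$ (x, y) * kern d M w u"
  by (simp add: kern_def prod.lessThan_Suc_shift del: prod.lessThan_Suc)

lemma kern_mult:
  assumes "M \<in> carrier_mat k n" "N \<in> carrier_mat n l" "w \<in> words d k" "u \<in> words d l"
  shows "kern d (M * N) w u = (\<Sum>v\<in>words d n. kern d M w v * kern d N v u)"
  using assms(3,4)
proof (induction d arbitrary: w u)
  case 0
  then show ?case by simp
next
  case (Suc d)
  obtain x w' where w: "w = x # w'" "x < k" "w' \<in> words d k" using wordsE_Suc[OF Suc.prems(1)] .
  obtain y u' where u: "u = y # u'" "y < l" "u' \<in> words d l" using wordsE_Suc[OF Suc.prems(2)] .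
  have "(M * N) $$ (x, y) = (\<Sum>z<n. M $$ (x, z) * N $$ (z, y))"
    using w u assms(1,2) by (simp add: scalar_prod_def atLeast0LessThan)
  then show ?case using Suc.IH[OF w(3) u(3)] w u
    by (simp add: sum_words_Suc sum_product mult_ac)
qed

lemma kern_one:
  assumes "w \<in> words d n" "u \<in> words d n"
  shows "kern d (1\<^sub>m n) w u = (if w = u then 1 else 0)"
  using assms
proof (induction d arbitrary: w u)
  case (Suc d)
  obtain x w' where w: "w = x # w'" "x < n" "w' \<in> words d n" using wordsE_Suc[OF Suc.prems(1)] .
  obtain y u' where u: "u = y # u'" "y < n" "u' \<in> words d n" using wordsE_Suc[OF Suc.prems(2)] .
  show ?case using Suc.IH[OF w(3) u(3)] w u by simp
qed simp

lemma kern_transpose: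
  assumes "M \<in> carrier_mat k n" "w \<in> words d n" "u \<in> words d k"
  shows "kern d (transpose_mat M) w u = kern d M u w"
  unfolding kern_def
  by (rule prod.cong) (use assms nth_words in auto)

text \<open>The tensor power as a functor on all matrices, rectangular and singular ones included;
  \<open>k\<close> and \<open>n\<close> are the numbers of letters of target and source.\<close>

definition tact :: "nat \<Rightarrow> nat \<Rightarrow> nat \<Rightarrow> rat mat \<Rightarrow> (nat list \<Rightarrow> rat) \<Rightarrow> nat list \<Rightarrow> rat" where
  "tact d k n M f = (\<lambda>w. if w \<in> words d k then \<Sum>u\<in>words d n. kern d M w u * f u else 0)"

lemma act_tensor_power: "act (tensor_power d n) g = tact d n n g"
  by (auto simp: tensor_power_def tact_def kern_def fun_eq_iff)

lemma tact_funs: "tact d k n M f \<in> funs (words d k)"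
  by (simp add: tact_def funs_def)

lemma tact_add: "tact d k n M (f + g) = tact d k n M f + tact d k n M g"
  by (auto simp: tact_def fun_eq_iff fun_app algebra_simps sum.distrib)

lemma tact_scale: "tact d k n M (fscale c f) = fscale c (tact d k n M f)"
  by (auto simp: tact_def fscale_def fun_eq_iff algebra_simps sum_distrib_left)

lemma tact_zero [simp]: "tact d k n M 0 = 0"
  by (auto simp: tact_def fun_eq_iff fun_app)

lemma lin_on_tact: "lin_on X (tact d k n M)"
  by (simp add: lin_on_def tact_add tact_scale)

lemma tact_comb: "tact d k n M (comb a L) = comb (\<lambda>i. tact d k n M (a i)) L"
  by (rule lin_on_comb[OF lin_on_tact fv.subspace_UNIV]) simp

lemma tact_mult:
  assumes "M \<in> carrier_mat k n" "N \<in> carrier_mat n l"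
  shows "tact d k n M (tact d n l N f) = tact d k l (M * N) f"
proof
  fix w
  show "tact d k n M (tact d n l N f) w = tact d k l (M * N) f w"
  proof (cases "w \<in> words d k")
    case True
    have "tact d k n M (tact d n l N f) w
      = (\<Sum>v\<in>words d n. \<Sum>u\<in>words d l. kern d M w v * kern d N v u * f u)"
      using True by (simp add: tact_def sum_distrib_left mult.assoc)
    also have "\<dots> = (\<Sum>u\<in>words d l. kern d (M * N) w u * f u)"
      by (subst sum.swap) (simp add: kern_mult[OF assms True] sum_distrib_right)
    finally show ?thesis using True by (simp add: tact_def)
  qed (simp add: tact_def)
qed

lemma tact_one:
  assumes "f \<in> funs (words d n)"
  shows "tact d n n (1\<^sub>m n) f = f"
proof
  fix w
  show "tact d n n (1\<^sub>m n) f w = f w"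
  proof (cases "w \<in> words d n")
    case True
    have "(\<Sum>u\<in>words d n. kern d (1\<^sub>m n) w u * f u) = (\<Sum>u\<in>words d n. if w = u then f u else 0)"
      by (rule sum.cong) (auto simp: kern_one True)
    then show ?thesis using True by (simp add: tact_def)
  qed (use assms in \<open>simp add: tact_def funs_def\<close>)
qed

lemma ip_tact:
  assumes "M \<in> carrier_mat k n"
  shows "ip (words d k) (tact d k n M f) g = ip (words d n) f (tact d n k (transpose_mat M) g)"
proof -
  have "ip (words d k) (tact d k n M f) g
    = (\<Sum>w\<in>words d k. \<Sum>u\<in>words d n. kern d M w u * f u * g w)"
    by (simp add: ip_def tact_def sum_distrib_right)
  also have "\<dots> = (\<Sum>u\<in>words d n. \<Sum>w\<in>words d k. f u * (kern d (transpose_mat M) u w * g w))"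
    by (subst sum.swap) (simp add: kern_transpose[OF assms] mult_ac)
  also have "\<dots> = ip (words d n) f (tact d n k (transpose_mat M) g)"
    by (simp add: ip_def tact_def sum_distrib_left)
  finally show ?thesis .
qed

section \<open>Invertible matrices span all matrices\<close>

lemma GL_carrier: "carrier (GL n) = {g \<in> carrier_mat n n. det g \<noteq> 0}"
proof -
  have "g \<in> Units (ring_mat TYPE(rat) n ())" if "g \<in> carrier_mat n n" "det g \<noteq> 0" for g
    by (rule det_non_zero_imp_unit[OF that])
  moreover have "g \<in> carrier_mat n n \<and> det g \<noteq> 0" if g: "g \<in> Units (ring_mat TYPE(rat) n ())" for g
  proof -
    obtain h where h: "g \<in> carrier_mat n n" "h \<in> carrier_mat n n" "g * h = 1\<^sub>m n"
      using g by (auto simp: Units_def ring_mat_simps)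
    have "det g * det h = 1" using det_mult[OF h(1,2)] h(3) by simp
    thus ?thesis using h by auto
  qed
  ultimately show ?thesis by (auto simp: GL_def units_of_def)
qed

lemma GL_mult: "g \<otimes>\<^bsub>GL n\<^esub> h = g * h" and GL_one: "\<one>\<^bsub>GL n\<^esub> = 1\<^sub>m n"
  by (simp_all add: GL_def units_of_def ring_mat_simps)

lemma GL_mat: "g \<in> carrier (GL n) \<Longrightarrow> g \<in> carrier_mat n n"
  by (simp add: GL_carrier)

text \<open>The determinant of M + t 1 vanishes only if -t is a root of the characteristic
  polynomial.\<close>

lemma infinite_GL_translates:
  assumes "M \<in> carrier_mat n n"
  shows "infinite {t. M + t \<cdot>\<^sub>m 1\<^sub>m n \<in> carrier (GL n)}"
proof -
  have "char_poly M \<noteq> 0" using degree_monic_char_poly[OF assms] by auto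
  hence "finite {t. poly (char_poly M) t = 0}" by (rule poly_roots_finite)
  hence "finite (uminus ` {t. poly (char_poly M) t = 0})" by simp
  moreover have "{t. det (M + t \<cdot>\<^sub>m 1\<^sub>m n) = 0} \<subseteq> uminus ` {t. poly (char_poly M) t = 0}"
  proof
    fix t assume "t \<in> {t. det (M + t \<cdot>\<^sub>m 1\<^sub>m n) = 0}"
    hence "det (char_matrix M (- t)) = 0" using assms by (simp add: char_matrix_def)
    hence "poly (char_poly M) (- t) = 0"
      using eigenvalue_det[OF assms] eigenvalue_root_char_poly[OF assms] by blast
    thus "t \<in> uminus ` {t. poly (char_poly M) t = 0}" by (auto intro: image_eqI[of _ _ "- t"])
  qed
  ultimately have "finite {t. det (M + t \<cdot>\<^sub>m 1\<^sub>m n) = 0}" by (rule rev_finite_subset)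
  moreover have "UNIV - {t. det (M + t \<cdot>\<^sub>m 1\<^sub>m n) = 0} \<subseteq> {t. M + t \<cdot>\<^sub>m 1\<^sub>m n \<in> carrier (GL n)}"
    using assms by (auto simp: GL_carrier)
  ultimately show ?thesis
    by (metis Diff_infinite_finite infinite_UNIV_char_0 infinite_super)
qed

text \<open>Along the line M + t 1 the entries of the tensor power are polynomials in t of degree at
  most \<open>d\<close>. The span of the invertible matrices meets this curve infinitely often, so
  it contains the point t = 0. A single \<open>L\<close> works for all \<open>f\<close>, which
  \<open>equivariant_of_GL\<close> relies on.\<close>

lemma kern_in_GL_span:
  assumes M: "M \<in> carrier_mat n n"
  obtains L where "snd ` set L \<subseteq> carrier (GL n)"
    "\<And>f. tact d n n M f = comb (\<lambda>g. tact d n n g f) L"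
proof -
  \<comment> \<open>The tensor power of a matrix is read as one function on pairs of words, so that
    \<open>poly_curve_in_subspace\<close> applies to it.\<close>
  define K where "K g = (\<lambda>(w, u). if w \<in> words d n \<and> u \<in> words d n then kern d g w u else 0)" for g
  define p where "p = (\<lambda>(w, u). if w \<in> words d n \<and> u \<in> words d n
      then \<Prod>i<d. [:M $$ (w ! i, u ! i), (1\<^sub>m n :: rat mat) $$ (w ! i, u ! i):] else 0)"
  let ?X = "fv.span (K ` carrier (GL n))"
  have poly_p: "(\<lambda>z. poly (p z) t) = K (M + t \<cdot>\<^sub>m 1\<^sub>m n)" for t
  proof
    fix z :: "nat list \<times> nat list"
    obtain w u where z: "z = (w, u)" by fastforce
    show "poly (p z) t = K (M + t \<cdot>\<^sub>m 1\<^sub>m n) z"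
      using M nth_words by (auto simp: z p_def K_def kern_def poly_prod intro!: prod.cong)
  qed
  have deg: "degree (p z) \<le> d" for z
  proof -
    have "degree (\<Prod>i<d. [:M $$ (w ! i, u ! i), (1\<^sub>m n :: rat mat) $$ (w ! i, u ! i):]) \<le> d" for w u
    proof -
      have "degree (\<Prod>i<d. [:M $$ (w ! i, u ! i), (1\<^sub>m n :: rat mat) $$ (w ! i, u ! i):])
        \<le> (\<Sum>i<d. degree [:M $$ (w ! i, u ! i), (1\<^sub>m n :: rat mat) $$ (w ! i, u ! i):])"
        using degree_prod_sum_le[of "{..<d}" "\<lambda>i. [:M $$ (w ! i, u ! i), (1\<^sub>m n :: rat mat) $$ (w ! i, u ! i):]"]
        unfolding o_def by blast
      also have "\<dots> \<le> (\<Sum>i<d. 1)" by (rule sum_mono) simp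
      finally show ?thesis by simp
    qed
    thus ?thesis by (auto simp: p_def split: prod.split)
  qed
  have "{t. M + t \<cdot>\<^sub>m 1\<^sub>m n \<in> carrier (GL n)} \<subseteq> {t. (\<lambda>z. poly (p z) t) \<in> ?X}"
    unfolding poly_p by (auto intro: fv.span_base)
  hence "infinite {t. (\<lambda>z. poly (p z) t) \<in> ?X}"
    using infinite_GL_translates[OF M] infinite_super by blast
  from poly_curve_in_subspace[OF fv.subspace_span deg this, of 0]
  moreover have "M + 0 \<cdot>\<^sub>m 1\<^sub>m n = M" using M by (intro eq_matI) auto
  ultimately have "K M \<in> ?X" unfolding poly_p by simp
  then obtain L where L: "K M = comb K L" "snd ` set L \<subseteq> carrier (GL n)"
    unfolding span_eq_comb by blast
  have combK: "comb K L' (w, u) = (\<Sum>(c, g)\<leftarrow>L'. c * K g (w, u))" for L' w u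
    by (induction L') (auto simp: fun_app)
  have "tact d n n M f = comb (\<lambda>g. tact d n n g f) L" for f
  proof
    fix w
    show "tact d n n M f w = comb (\<lambda>g. tact d n n g f) L w"
    proof (cases "w \<in> words d n")
      case True
      have c: "comb (\<lambda>g. tact d n n g f) L' w = (\<Sum>u\<in>words d n. comb K L' (w, u) * f u)" for L'
      proof (induction L')
        case (Cons q L')
        obtain c g where q: "q = (c, g)" by fastforce
        show ?case using Cons True
          by (simp add: q fun_app tact_def K_def sum.distrib sum_distrib_left algebra_simps)
      qed (simp add: fun_app)
      have "tact d n n M f w = (\<Sum>u\<in>words d n. K M (w, u) * f u)"
        using True by (simp add: tact_def K_def)
      thus ?thesis by (simp add: c L(1))
    next
      case False
      have "comb (\<lambda>g. tact d n n g f) L' w = 0" for L'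
        using False by (induction L') (auto simp: fun_app tact_def)
      thus ?thesis using False by (simp add: tact_def)
    qed
  qed
  thus ?thesis using that L(2) by blast
qed

section \<open>Subrepresentations of a tensor power\<close>

text \<open>Closure under all square matrices, not only invertible ones: products of two rectangular
  matrices can then be applied inside \<open>X\<close>. By \<open>stableI_GL\<close> this is no
  restriction.\<close>

definition stable :: "nat \<Rightarrow> nat \<Rightarrow> (nat list \<Rightarrow> rat) set \<Rightarrow> bool" where
  "stable d n X \<longleftrightarrow> fv.subspace X \<and> X \<subseteq> funs (words d n) \<and>
     (\<forall>M\<in>carrier_mat n n. \<forall>x\<in>X. tact d n n M x \<in> X)"

lemma stableD:
  assumes "stable d n X"
  shows "fv.subspace X" "X \<subseteq> funs (words d n)"
    "\<And>M x. M \<in> carrier_mat n n \<Longrightarrow> x \<in> X \<Longrightarrow> tact d n n M x \<in> X" "0 \<in> X"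
  using assms by (auto simp: stable_def fv.subspace_0)

lemma stableI_GL:
  assumes "fv.subspace X" "X \<subseteq> funs (words d n)"
    "\<And>g x. g \<in> carrier (GL n) \<Longrightarrow> x \<in> X \<Longrightarrow> tact d n n g x \<in> X"
  shows "stable d n X"
  unfolding stable_def
proof (intro conjI ballI)
  fix M :: "rat mat" and x assume M: "M \<in> carrier_mat n n" and x: "x \<in> X"
  obtain L where L: "snd ` set L \<subseteq> carrier (GL n)" "tact d n n M x = comb (\<lambda>g. tact d n n g x) L"
    using kern_in_GL_span[OF M] by metis
  show "tact d n n M x \<in> X"
    unfolding L(2) using L(1) assms x by (intro comb_in_subspace) auto
qed (use assms in auto)

lemma stable_orth_in:
  assumes "stable d n X" "stable d n Y"
  shows "stable d n (orth_in (words d n) X Y)"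
  unfolding stable_def
proof (intro conjI ballI)
  show "fv.subspace (orth_in (words d n) X Y)" using assms by (simp add: stableD subspace_orth_in)
  show "orth_in (words d n) X Y \<subseteq> funs (words d n)"
    using stableD(2)[OF assms(1)] by (auto simp: orth_in_def)
  fix M :: "rat mat" and x assume M: "M \<in> carrier_mat n n" and x: "x \<in> orth_in (words d n) X Y"
  have "tact d n n (transpose_mat M) y \<in> Y" if "y \<in> Y" for y
    using M that by (intro stableD(3)[OF assms(2)]) auto
  thus "tact d n n M x \<in> orth_in (words d n) X Y"
    using x M stableD(3)[OF assms(1) M] by (auto simp: orth_in_def ip_tact[OF M])
qed

interpretation tens: orth_stable "words d n" "stable d n" for d n
  by unfold_locales (auto dest: stableD stable_orth_in)

text \<open>One and the same list \<open>L\<close> expresses the action of \<open>M\<close> on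
  \<open>x\<close> and on its image through invertible matrices.\<close>

lemma equivariant_of_GL:
  assumes X: "stable d n X" and "lin_on X \<psi>"
    and eq: "\<And>g x. g \<in> carrier (GL n) \<Longrightarrow> x \<in> X \<Longrightarrow> \<psi> (tact d n n g x) = tact d n n g (\<psi> x)"
    and M: "M \<in> carrier_mat n n" and x: "x \<in> X"
  shows "\<psi> (tact d n n M x) = tact d n n M (\<psi> x)"
proof -
  obtain L where L: "snd ` set L \<subseteq> carrier (GL n)" "\<And>f. tact d n n M f = comb (\<lambda>g. tact d n n g f) L"
    using kern_in_GL_span[OF M] by metis
  have "\<psi> (comb (\<lambda>g. tact d n n g x) L) = comb (\<lambda>g. \<psi> (tact d n n g x)) L"
    by (rule lin_on_comb[OF assms(2)]) (use X L x GL_mat stableD in auto)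
  also have "\<dots> = comb (\<lambda>g. tact d n n g (\<psi> x)) L"
    using L(1) by (induction L) (auto simp: eq x)
  finally show ?thesis by (simp add: L(2))
qed

section \<open>Generated subfunctors\<close>

text \<open>The value on \<open>k\<close> letters of the subfunctor of the tensor power generated by
  the tensors \<open>W\<close> on \<open>n\<close> letters.\<close>

definition gen :: "nat \<Rightarrow> nat \<Rightarrow> nat \<Rightarrow> (nat list \<Rightarrow> rat) set \<Rightarrow> (nat list \<Rightarrow> rat) set" where
  "gen d n k W = fv.span ((\<lambda>(M, f). tact d k n M f) ` (carrier_mat k n \<times> W))"

lemma tact_in_gen: "M \<in> carrier_mat k n \<Longrightarrow> f \<in> W \<Longrightarrow> tact d k n M f \<in> gen d n k W"
  unfolding gen_def by (intro fv.span_base) auto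

lemma gen_minimal:
  assumes "fv.subspace X" "\<And>M f. M \<in> carrier_mat k n \<Longrightarrow> f \<in> W \<Longrightarrow> tact d k n M f \<in> X"
  shows "gen d n k W \<subseteq> X"
  unfolding gen_def using assms by (intro fv.span_minimal) auto

lemma subspace_gen: "fv.subspace (gen d n k W)"
  unfolding gen_def by (rule fv.subspace_span)

lemma gen_funs: "gen d n k W \<subseteq> funs (words d k)"
  by (rule gen_minimal[OF subspace_funs tact_funs])

lemma subspace_vimage_tact: "fv.subspace X \<Longrightarrow> fv.subspace {x. tact d k n M x \<in> X}"
  unfolding fv.subspace_def by (auto simp: tact_add tact_scale)

lemma tact_gen:
  assumes "N \<in> carrier_mat l k" "x \<in> gen d n k W"
  shows "tact d l k N x \<in> gen d n l W"
proof -
  have "gen d n k W \<subseteq> {x. tact d l k N x \<in> gen d n l W}"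
    using assms(1) by (intro gen_minimal subspace_vimage_tact subspace_gen)
      (auto simp: tact_mult intro!: tact_in_gen)
  thus ?thesis using assms(2) by blast
qed

lemma stable_gen: "stable d k (gen d n k W)"
  by (auto simp: stable_def subspace_gen gen_funs[THEN subsetD] intro: tact_gen)

lemma gen_self: "stable d n W \<Longrightarrow> gen d n n W = W"
proof
  assume W: "stable d n W"
  show "gen d n n W \<subseteq> W" using W by (intro gen_minimal) (auto dest: stableD)
  show "W \<subseteq> gen d n n W"
  proof
    fix x assume x: "x \<in> W"
    hence "tact d n n (1\<^sub>m n) x \<in> gen d n n W" by (intro tact_in_gen) auto
    thus "x \<in> gen d n n W" using tact_one x stableD(2)[OF W] by (metis subsetD)
  qed
qed

lemma gen_gen: "gen d k l (gen d n k W) \<subseteq> gen d n l W"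
  by (intro gen_minimal subspace_gen tact_gen)

lemma gen_mono: "W \<subseteq> W' \<Longrightarrow> gen d n k W \<subseteq> gen d n k W'"
  by (intro gen_minimal subspace_gen tact_in_gen) auto

text \<open>Moving \<open>N\<close> to the other side of the product of \<open>M f\<close> and
  \<open>N h\<close> leaves the square matrix N^T M, which maps \<open>W\<close> into
  itself.\<close>

lemma gen_orth:
  assumes "stable d n W" "\<And>x y. x \<in> W \<Longrightarrow> y \<in> W' \<Longrightarrow> ip (words d n) x y = 0"
    and "x \<in> gen d n k W" "y \<in> gen d n k W'"
  shows "ip (words d k) x y = 0"
proof -
  have sub: "fv.subspace {y. ip (words d k) x y = 0}" for x
    by (auto simp: fv.subspace_def ip_add_right ip_scale_right)
  have 1: "gen d n k W' \<subseteq> {y. ip (words d k) (tact d k n M f) y = 0}"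
    if M: "M \<in> carrier_mat k n" and f: "f \<in> W" for M f
  proof (rule gen_minimal[OF sub], rule CollectI)
    fix N :: "rat mat" and h assume N: "N \<in> carrier_mat k n" and h: "h \<in> W'"
    have "ip (words d k) (tact d k n M f) (tact d k n N h)
      = ip (words d k) (tact d k n N h) (tact d k n M f)" by (rule ip_commute)
    also have "\<dots> = ip (words d n) h (tact d n n (transpose_mat N * M) f)"
      by (simp add: ip_tact[OF N] tact_mult[OF _ M] N)
    also have "\<dots> = ip (words d n) (tact d n n (transpose_mat N * M) f) h" by (rule ip_commute)
    also have "\<dots> = 0"
      using M N f h stableD(3)[OF assms(1)] by (intro assms(2)) auto
    finally show "ip (words d k) (tact d k n M f) (tact d k n N h) = 0" .
  qed
  have "gen d n k W \<subseteq> {x. ip (words d k) y x = 0}"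
    using 1 assms(4) by (intro gen_minimal sub) (auto simp: ip_commute)
  thus ?thesis using assms(3) by (auto simp: ip_commute)
qed

text \<open>Such a \<open>y\<close> is orthogonal to each generator \<open>tact d k n M f\<close>, as the adjoint of \<open>M\<close> kills it.\<close>

lemma gen_detect:
  assumes "y \<in> gen d n k W" "\<And>N. N \<in> carrier_mat n k \<Longrightarrow> tact d n k N y = 0"
  shows "y = 0"
proof -
  have "fv.subspace {x. ip (words d k) y x = 0}"
    by (auto simp: fv.subspace_def ip_add_right ip_scale_right)
  moreover have "ip (words d k) y (tact d k n M f) = 0" if M: "M \<in> carrier_mat k n" for M f
  proof -
    have "ip (words d k) y (tact d k n M f) = ip (words d n) f (tact d n k (transpose_mat M) y)"
      by (subst ip_commute) (simp add: ip_tact[OF M])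
    thus ?thesis using assms(2) M by simp
  qed
  ultimately have "gen d n k W \<subseteq> {x. ip (words d k) y x = 0}" by (intro gen_minimal) auto
  thus ?thesis
    using assms(1) ip_self_zero[OF finite_words, of y d k] gen_funs by blast
qed

text \<open>A word of length \<open>d\<close> has at most \<open>d\<close> different letters. These
  can be relabelled injectively by \<open>n\<close> letters, and the coefficient of the word
  survives as the coefficient of the relabelled word.\<close>

lemma detect_by_letters:
  assumes y: "y \<in> funs (words d k)" and "d \<le> n"
    and 0: "\<And>N. N \<in> carrier_mat n k \<Longrightarrow> tact d n k N y = 0"
  shows "y = 0"
proof
  fix w
  show "y w = 0 w"
  proof (cases "w \<in> words d k")
    case True
    have "card (set w) \<le> card {..<n}"
      using card_length[of w] length_words[OF True] assms(2) by simp
    then obtain \<iota> where \<iota>: "\<iota> ` set w \<subseteq> {..<n}" "inj_on \<iota> (set w)"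
      using card_le_inj[of "set w" "{..<n}"] by auto
    \<comment> \<open>\<open>N\<close> renames the letters of \<open>w\<close> by \<iota> and kills
      all others, so that \<open>w\<close> is the only word it sends to
      \<open>map \<iota> w\<close>.\<close>
    define N where "N = mat n k (\<lambda>(i, j). if j \<in> set w \<and> \<iota> j = i then 1 else 0 :: rat)"
    have w': "map \<iota> w \<in> words d n" using \<iota>(1) True by (auto simp: words_def)
    have k: "kern d N (map \<iota> w) u = (if u = w then 1 else 0)" if u: "u \<in> words d k" for u
    proof -
      have e: "N $$ (map \<iota> w ! i, u ! i) = (if u ! i = w ! i then 1 else 0)" if i: "i < d" for i
      proof -
        have wi: "w ! i \<in> set w" using i True by (simp add: words_def)
        have "\<iota> (w ! i) < n" "u ! i < k" using wi \<iota>(1) nth_words[OF u i] by auto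
        thus ?thesis using wi \<iota>(2) i length_words[OF True] by (auto simp: N_def inj_on_def)
      qed
      have "kern d N (map \<iota> w) u = (\<Prod>i<d. if u ! i = w ! i then 1 else 0)"
        unfolding kern_def by (rule prod.cong) (auto simp: e)
      moreover have "(\<Prod>i<d. if u ! i = w ! i then 1 else 0 :: rat) = (if u = w then 1 else 0)"
      proof (cases "u = w")
        case False
        then obtain i where "i < d" "u ! i \<noteq> w ! i"
          using u True by (metis length_words nth_equalityI)
        thus ?thesis using False by (auto intro!: prod_zero)
      qed simp
      ultimately show ?thesis by simp
    qed
    have "tact d n k N y (map \<iota> w) = (\<Sum>u\<in>words d k. if u = w then y u else 0)"
      using w' by (simp add: tact_def k if_distrib[of "\<lambda>c. c * y _"] cong: if_cong sum.cong)
    also have "\<dots> = y w" using True by simp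
    finally show ?thesis using 0[of N] by (simp add: N_def fun_app)
  next
    case False
    then show ?thesis using y by (simp add: funs_def fun_app)
  qed
qed

lemma tens_simple_iff: "tens.simple d n W \<longleftrightarrow> stable d n W \<and> W \<noteq> {0} \<and>
    (\<forall>X. stable d n X \<longrightarrow> X \<subseteq> W \<longrightarrow> X = {0} \<or> X = W)"
  by (rule tens.simple_def)

text \<open>By \<open>gen_detect\<close> some map back to \<open>n\<close> letters does not kill
  \<open>X\<close>, so \<open>X\<close> generates a nonzero subrepresentation of the simple
  \<open>W\<close>.\<close>

lemma gen_reflect:
  assumes "tens.simple d n W" "stable d k X" "X \<subseteq> gen d n k W" "X \<noteq> {0}"
  shows "gen d k n X = W"
proof -
  have W: "stable d n W" using assms(1) by (simp add: tens_simple_iff)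
  obtain x where x: "x \<in> X" "x \<noteq> 0" using assms(4) stableD(4)[OF assms(2)] by blast
  obtain N where N: "N \<in> carrier_mat n k" "tact d n k N x \<noteq> 0"
    using gen_detect[of x d n k W] x assms(3) by blast
  have "gen d k n X \<subseteq> W"
    using gen_mono[OF assms(3), of d k n] gen_gen[of d k n n W] gen_self[OF W] by blast
  moreover have "gen d k n X \<noteq> {0}" using tact_in_gen[OF N(1) x(1), of d] N(2) by auto
  ultimately show ?thesis using assms(1) stable_gen[of d n k X] by (auto simp: tens_simple_iff)
qed

text \<open>A nonzero \<open>X\<close> inside gives back all of \<open>W\<close> on \<open>n\<close>
  letters, hence all of \<open>gen d n k W\<close> on returning to \<open>k\<close> letters.\<close>

lemma simple_gen:
  assumes "tens.simple d n W" "gen d n k W \<noteq> {0}"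
  shows "tens.simple d k (gen d n k W)"
  unfolding tens_simple_iff
proof (intro conjI allI impI)
  fix X assume X: "stable d k X" "X \<subseteq> gen d n k W"
  show "X = {0} \<or> X = gen d n k W"
  proof (cases "X = {0}")
    case False
    have "gen d n k W \<subseteq> X"
      using gen_reflect[OF assms(1) X False] gen_gen[of d n k k X] gen_self[OF X(1)] by auto
    thus ?thesis using X by blast
  qed simp
qed (use assms stable_gen in auto)

section \<open>Isomorphisms of subrepresentations\<close>

definition tiso :: "nat \<Rightarrow> nat \<Rightarrow> (nat list \<Rightarrow> rat) set \<Rightarrow> (nat list \<Rightarrow> rat) set \<Rightarrow> bool" where
  "tiso d n X Y \<longleftrightarrow> (\<exists>\<psi>. lin_on X \<psi> \<and> bij_betw \<psi> X Y \<and>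
     (\<forall>M\<in>carrier_mat n n. \<forall>x\<in>X. \<psi> (tact d n n M x) = tact d n n M (\<psi> x)))"

text \<open>By \<open>gen_detect\<close>, a combination of tensors \<open>M f\<close> vanishes iff
  every map \<open>N\<close> back to \<open>n\<close> letters kills it. After \<open>N\<close> only
  square matrices \<open>N * M\<close> act on \<open>W\<close>, and \<psi> commutes with them. So
  the \<open>M f\<close> and the \<open>M (\<psi> f)\<close> satisfy the same linear
  relations.\<close>

lemma tiso_gen:
  assumes W: "stable d n W" and W': "stable d n W'" and "tiso d n W W'"
  shows "tiso d k (gen d n k W) (gen d n k W')"
proof -
  obtain \<psi> where \<psi>: "lin_on W \<psi>" "bij_betw \<psi> W W'"
    "\<And>M x. M \<in> carrier_mat n n \<Longrightarrow> x \<in> W \<Longrightarrow> \<psi> (tact d n n M x) = tact d n n M (\<psi> x)"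
    using assms(3) by (auto simp: tiso_def)
  let ?I = "carrier_mat k n \<times> W"
  define a where "a = (\<lambda>(M, f). tact d k n M f)"
  define b where "b = (\<lambda>(M, f). tact d k n M (\<psi> f))"
  have \<psi>im: "\<psi> ` W = W'" using \<psi>(2) by (simp add: bij_betw_def)
  have "b ` ?I = (\<lambda>(M, f). tact d k n M f) ` (carrier_mat k n \<times> W')"
    unfolding \<psi>im[symmetric] by (force simp: b_def image_iff)
  hence spans: "fv.span (a ` ?I) = gen d n k W" "fv.span (b ` ?I) = gen d n k W'"
    by (simp_all add: gen_def a_def)
  have NL: "tact d n k N (comb b L) = \<psi> (tact d n k N (comb a L))"
    if L: "snd ` set L \<subseteq> ?I" and N: "N \<in> carrier_mat n k" for L N
  proof -
    have mem: "tact d n k N (a i) \<in> W \<and> tact d n k N (b i) = \<psi> (tact d n k N (a i))" if "i \<in> ?I" for i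
    proof -
      obtain M f where i: "i = (M, f)" "M \<in> carrier_mat k n" "f \<in> W" using \<open>i \<in> ?I\<close> by auto
      show ?thesis
        using i N \<psi>(3)[of "N * M" f] stableD(3)[OF W, of "N * M" f] by (auto simp: a_def b_def tact_mult)
    qed
    have "tact d n k N (comb b L) = comb (\<lambda>i. tact d n k N (b i)) L" by (rule tact_comb)
    also have "\<dots> = comb (\<lambda>i. \<psi> (tact d n k N (a i))) L"
      using L by (induction L) (auto simp: mem)
    also have "\<dots> = \<psi> (comb (\<lambda>i. tact d n k N (a i)) L)"
      using L mem by (intro lin_on_comb[OF \<psi>(1) stableD(1)[OF W], symmetric]) auto
    finally show ?thesis by (simp add: tact_comb)
  qed
  have "comb a L = 0 \<longleftrightarrow> comb b L = 0" if L: "snd ` set L \<subseteq> ?I" for L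
  proof
    assume "comb a L = 0"
    hence "tact d n k N (comb b L) = 0" if "N \<in> carrier_mat n k" for N
      using NL[OF L that] lin_on_zero[OF \<psi>(1) stableD(1)[OF W]] by simp
    moreover have "comb b L \<in> gen d n k W'"
      using L unfolding spans(2)[symmetric] span_eq_comb by blast
    ultimately show "comb b L = 0" using gen_detect by blast
  next
    assume b0: "comb b L = 0"
    have aL: "comb a L \<in> gen d n k W"
      using L unfolding spans(1)[symmetric] span_eq_comb by blast
    have "tact d n k N (comb a L) = 0" if N: "N \<in> carrier_mat n k" for N
    proof -
      have "tact d n k N (comb a L) \<in> W" using tact_gen[OF N aL] gen_self[OF W] by simp
      moreover have "\<psi> (tact d n k N (comb a L)) = \<psi> 0"
        using NL[OF L N] b0 lin_on_zero[OF \<psi>(1) stableD(1)[OF W]] by simp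
      ultimately show ?thesis using \<psi>(2) stableD(4)[OF W] by (meson bij_betw_def inj_onD)
    qed
    thus "comb a L = 0" using gen_detect[OF aL] by blast
  qed
  from linear_iso_of_combs[of ?I a b, OF this] obtain \<Psi> where \<Psi>: "lin_on (gen d n k W) \<Psi>"
    "bij_betw \<Psi> (gen d n k W) (gen d n k W')" "\<And>i. i \<in> ?I \<Longrightarrow> \<Psi> (a i) = b i"
    unfolding spans by blast
  have "\<Psi> (tact d k k N x) = tact d k k N (\<Psi> x)" if N: "N \<in> carrier_mat k k" and x: "x \<in> gen d n k W" for N x
  proof -
    obtain L where L: "x = comb a L" "snd ` set L \<subseteq> ?I"
      using x unfolding spans(1)[symmetric] span_eq_comb by blast
    have mem: "a i \<in> gen d n k W \<and> tact d k k N (a i) \<in> gen d n k W \<and>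
        \<Psi> (tact d k k N (a i)) = tact d k k N (\<Psi> (a i))" if "i \<in> ?I" for i
    proof -
      obtain M f where i: "i = (M, f)" "M \<in> carrier_mat k n" "f \<in> W" using \<open>i \<in> ?I\<close> by auto
      have "tact d k k N (a i) = a (N * M, f)" "tact d k k N (b i) = b (N * M, f)" "(N * M, f) \<in> ?I"
        using i N by (auto simp: a_def b_def tact_mult)
      moreover have "a j \<in> gen d n k W" if "j \<in> ?I" for j
        using that by (auto simp: a_def intro: tact_in_gen)
      ultimately show ?thesis using \<Psi>(3) \<open>i \<in> ?I\<close> by metis
    qed
    have "\<Psi> (tact d k k N x) = comb (\<lambda>i. \<Psi> (tact d k k N (a i))) L"
      unfolding L(1) tact_comb using L(2) mem by (intro lin_on_comb[OF \<Psi>(1) subspace_gen]) auto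
    also have "\<dots> = comb (\<lambda>i. tact d k k N (\<Psi> (a i))) L"
      using L(2) by (induction L arbitrary: ) (auto simp: mem)
    also have "\<dots> = tact d k k N (\<Psi> x)"
      unfolding L(1) tact_comb[symmetric]
      using L(2) mem by (subst lin_on_comb[OF \<Psi>(1) subspace_gen, of L a]) auto
    finally show ?thesis .
  qed
  thus ?thesis using \<Psi>(1,2) unfolding tiso_def by blast
qed

lemma simple_tiso:
  assumes W: "stable d n W" and "tiso d n W W'" and W': "tens.simple d n W'"
  shows "tens.simple d n W"
proof -
  obtain \<psi> where \<psi>: "lin_on W \<psi>" "bij_betw \<psi> W W'"
    "\<And>M x. M \<in> carrier_mat n n \<Longrightarrow> x \<in> W \<Longrightarrow> \<psi> (tact d n n M x) = tact d n n M (\<psi> x)"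
    using assms(2) by (auto simp: tiso_def)
  have sW': "stable d n W'" using W' by (simp add: tens_simple_iff)
  have \<psi>0: "\<psi> 0 = 0" using lin_on_zero[OF \<psi>(1) stableD(1)[OF W]] .
  show ?thesis
    unfolding tens_simple_iff
  proof (intro conjI allI impI)
    show "stable d n W" by fact
    show "W \<noteq> {0}"
      using W' \<psi>(2) \<psi>0 by (auto simp: tens_simple_iff bij_betw_def)
    fix X assume X: "stable d n X" "X \<subseteq> W"
    have lX: "lin_on X \<psi>" using \<psi>(1) X(2) by (rule lin_on_mono)
    have "stable d n (\<psi> ` X)"
      unfolding stable_def
    proof (intro conjI ballI)
      show "fv.subspace (\<psi> ` X)"
        unfolding fv.subspace_def
      proof (intro conjI ballI allI)
        show "0 \<in> \<psi> ` X" using \<psi>0 stableD(4)[OF X(1)] by (metis image_eqI)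
        fix x y assume "x \<in> \<psi> ` X" "y \<in> \<psi> ` X"
        thus "x + y \<in> \<psi> ` X"
          using lin_on_add[OF lX] fv.subspace_add[OF stableD(1)[OF X(1)]] by (metis (no_types, lifting) imageE image_eqI)
      next
        fix c x assume "x \<in> \<psi> ` X"
        thus "fscale c x \<in> \<psi> ` X"
          using lin_on_scale[OF lX] fv.subspace_scale[OF stableD(1)[OF X(1)]] by (metis (no_types, lifting) imageE image_eqI)
      qed
      show "\<psi> ` X \<subseteq> funs (words d n)"
        using X(2) \<psi>(2) stableD(2)[OF sW'] by (auto simp: bij_betw_def)
      fix M :: "rat mat" and y assume M: "M \<in> carrier_mat n n" and "y \<in> \<psi> ` X"
      then obtain x where x: "x \<in> X" "y = \<psi> x" by blast
      have "tact d n n M y = \<psi> (tact d n n M x)" using x X(2) \<psi>(3)[OF M] by auto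
      thus "tact d n n M y \<in> \<psi> ` X" using stableD(3)[OF X(1) M x(1)] by simp
    qed
    moreover have "\<psi> ` X \<subseteq> W'" using X(2) \<psi>(2) by (auto simp: bij_betw_def)
    ultimately consider "\<psi> ` X = {0}" | "\<psi> ` X = \<psi> ` W"
      using W' \<psi>(2) by (auto simp: tens_simple_iff bij_betw_def)
    thus "X = {0} \<or> X = W"
    proof cases
      case 1
      have "x = 0" if "x \<in> X" for x
      proof -
        have "\<psi> x = \<psi> 0" using 1 that \<psi>0 by auto
        thus ?thesis using \<psi>(2) that X(2) stableD(4)[OF W] by (meson bij_betw_def inj_onD subsetD)
      qed
      thus ?thesis using stableD(4)[OF X(1)] by blast
    next
      case 2
      thus ?thesis using inj_on_image_eq_iff[of \<psi> W X W] \<psi>(2) X(2) by (simp add: bij_betw_def)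
    qed
  qed
qed

section \<open>Place permutations\<close>

text \<open>\<open>inv\<close> is taken by HOL-Algebra.\<close>

abbreviation pinv :: "(nat \<Rightarrow> nat) \<Rightarrow> nat \<Rightarrow> nat" where
  "pinv \<equiv> inv_into UNIV"

text \<open>In contrast to \<open>place_perm\<close> the inverse is left out; sums over a group do
  not see the difference (\<open>sum_colour_group_inv\<close>).\<close>

definition pp :: "(nat \<Rightarrow> nat) \<Rightarrow> (nat list \<Rightarrow> rat) \<Rightarrow> nat list \<Rightarrow> rat" where
  "pp p f = (\<lambda>w. f (permute_list p w))"

lemma permute_list_in_words:
  assumes "p permutes {..<d}"
  shows "permute_list p w \<in> words d n \<longleftrightarrow> w \<in> words d n"
proof (cases "length w = d")
  case True
  then show ?thesis using assms by (simp add: words_def)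
qed (simp add: words_def)

lemma permute_list_inv:
  assumes "p permutes {..<length w}"
  shows "permute_list (pinv p) (permute_list p w) = w" "permute_list p (permute_list (pinv p) w) = w"
  using permute_list_compose[of "pinv p" w p] permute_list_compose[of p w "pinv p"]
    permutes_inv[OF assms] permutes_inv_o[OF assms] assms by auto

lemma bij_betw_permute_list:
  assumes "p permutes {..<d}"
  shows "bij_betw (permute_list p) (words d n) (words d n)"
proof (rule bij_betw_byWitness[where f' = "permute_list (pinv p)"])
  show "\<forall>w\<in>words d n. permute_list (pinv p) (permute_list p w) = w"
    "\<forall>w\<in>words d n. permute_list p (permute_list (pinv p) w) = w"
    using permute_list_inv assms length_words by blast+
  show "permute_list p ` words d n \<subseteq> words d n" "permute_list (pinv p) ` words d n \<subseteq> words d n"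
    using permute_list_in_words[OF assms] permute_list_in_words[OF permutes_inv[OF assms]] by auto
qed

lemma pp_funs: "p permutes {..<d} \<Longrightarrow> f \<in> funs (words d n) \<Longrightarrow> pp p f \<in> funs (words d n)"
  by (auto simp: funs_def pp_def permute_list_in_words)

lemma kern_permute_list:
  assumes p: "p permutes {..<d}" and "length w = d" "length u = d"
  shows "kern d M (permute_list p w) (permute_list p u) = kern d M w u"
proof -
  have "kern d M (permute_list p w) (permute_list p u) = (\<Prod>i<d. M $$ (w ! p i, u ! p i))"
    unfolding kern_def by (rule prod.cong) (use assms in \<open>auto simp: permute_list_nth\<close>)
  also have "\<dots> = kern d M w u"
    unfolding kern_def by (rule prod.permute[OF p, of "\<lambda>i. M $$ (w ! i, u ! i)", unfolded o_def, symmetric])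
  finally show ?thesis .
qed

lemma tact_pp:
  assumes p: "p permutes {..<d}"
  shows "tact d k n M (pp p f) = pp p (tact d k n M f)"
proof
  fix w
  show "tact d k n M (pp p f) w = pp p (tact d k n M f) w"
  proof (cases "w \<in> words d k")
    case True
    have "(\<Sum>u\<in>words d n. kern d M w u * f (permute_list p u))
      = (\<Sum>u\<in>words d n. kern d M (permute_list p w) (permute_list p u) * f (permute_list p u))"
      by (rule sum.cong) (use kern_permute_list[OF p] True length_words in auto)
    also have "\<dots> = (\<Sum>u\<in>words d n. kern d M (permute_list p w) u * f u)"
      by (rule sum.reindex_bij_betw[OF bij_betw_permute_list[OF p]])
    finally show ?thesis using True by (simp add: tact_def pp_def permute_list_in_words[OF p])
  qed (simp add: tact_def pp_def permute_list_in_words[OF p])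
qed

lemma ip_pp:
  assumes p: "p permutes {..<d}"
  shows "ip (words d n) (pp p f) g = ip (words d n) f (pp (pinv p) g)"
proof -
  have "ip (words d n) f (pp (pinv p) g)
      = (\<Sum>w\<in>words d n. f (permute_list p w) * g (permute_list (pinv p) (permute_list p w)))"
    unfolding ip_def pp_def
    by (rule sum.reindex_bij_betw[OF bij_betw_permute_list[OF p], symmetric])
  also have "\<dots> = ip (words d n) (pp p f) g"
    unfolding ip_def pp_def
  proof (intro sum.cong refl)
    fix w assume "w \<in> words d n"
    hence "p permutes {..<length w}" using p length_words by simp
    thus "f (permute_list p w) * g (permute_list (pinv p) (permute_list p w)) = f (permute_list p w) * g w"
      by (simp add: permute_list_inv)
  qed
  finally show ?thesis ..
qed

text \<open>One notion for row and column groups: the colour of a place is the row or the column of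
  its box.\<close>

definition colour_group :: "nat \<Rightarrow> (nat \<Rightarrow> nat) \<Rightarrow> (nat \<Rightarrow> nat) set" where
  "colour_group d \<kappa> = {p. p permutes {..<d} \<and> (\<forall>k<d. \<kappa> (p k) = \<kappa> k)}"

lemma row_group_eq: "row_group l = colour_group (sum_list l) (\<lambda>k. fst (cells l ! k))"
  and col_group_eq: "col_group l = colour_group (sum_list l) (\<lambda>k. snd (cells l ! k))"
  by (auto simp: row_group_def col_group_def colour_group_def)

context
  fixes d :: nat and \<kappa> :: "nat \<Rightarrow> nat" and G
  defines "G \<equiv> colour_group d \<kappa>"
begin

lemma colour_group_permutes: "p \<in> G \<Longrightarrow> p permutes {..<d}"
  by (simp add: G_def colour_group_def)

lemma finite_colour_group: "finite G"
  by (rule finite_subset[OF _ finite_permutations[of "{..<d}"]]) (auto simp: G_def colour_group_def)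

lemma id_colour_group: "id \<in> G"
  by (simp add: G_def colour_group_def permutes_id)

lemma inv_colour_group: "p \<in> G \<Longrightarrow> pinv p \<in> G"
  unfolding G_def colour_group_def
  by (auto simp: permutes_inv) (metis lessThan_iff permutes_inv permutes_inverses(1) permutes_in_image)

lemma comp_colour_group: "p \<in> G \<Longrightarrow> q \<in> G \<Longrightarrow> p \<circ> q \<in> G"
  unfolding G_def colour_group_def
  by (auto simp: permutes_compose) (metis lessThan_iff permutes_in_image)

lemma sum_colour_group_inv: "(\<Sum>p\<in>G. F (pinv p)) = (\<Sum>p\<in>G. F p)"
  by (rule sum.reindex_bij_witness[of _ pinv pinv])
    (auto simp: inv_colour_group permutes_inv_inv[OF colour_group_permutes])

lemma sum_colour_group_comp:
  assumes "p \<in> G"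
  shows "(\<Sum>q\<in>G. F (p \<circ> q)) = (\<Sum>q\<in>G. F q)"
proof (rule sum.reindex_bij_witness[of _ "\<lambda>q. pinv p \<circ> q" "\<lambda>q. p \<circ> q"])
  note per = colour_group_permutes[OF assms]
  fix q assume q: "q \<in> G"
  show "pinv p \<circ> (p \<circ> q) = q" "p \<circ> (pinv p \<circ> q) = q"
    using permutes_inv_o[OF per] by (simp_all add: o_assoc)
  show "p \<circ> q \<in> G" "pinv p \<circ> q \<in> G" using q assms by (auto intro: comp_colour_group inv_colour_group)
qed auto

end

lemma sign_inv_permutes: "p permutes {..<d::nat} \<Longrightarrow> sign (pinv p) = sign p"
  by (rule sign_inverse) (auto simp: permutation_permutes)

lemma sign_comp_permutes:
  "p permutes {..<d::nat} \<Longrightarrow> q permutes {..<d} \<Longrightarrow> sign (p \<circ> q) = sign p * sign q"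
  by (rule sign_compose) (auto simp: permutation_permutes)

definition alternator :: "nat \<Rightarrow> (nat \<Rightarrow> nat) \<Rightarrow> ((nat \<Rightarrow> nat) \<Rightarrow> rat) \<Rightarrow> (nat list \<Rightarrow> rat) \<Rightarrow> nat list \<Rightarrow> rat" where
  "alternator d \<kappa> \<chi> f = (\<lambda>w. \<Sum>p\<in>colour_group d \<kappa>. \<chi> p * f (permute_list p w))"

text \<open>The two characters of the symmetric group give the row symmetrizer and the column
  antisymmetrizer.\<close>

definition is_character :: "nat \<Rightarrow> ((nat \<Rightarrow> nat) \<Rightarrow> rat) \<Rightarrow> bool" where
  "is_character d \<chi> \<longleftrightarrow> \<chi> id = 1 \<and> (\<forall>p q. p permutes {..<d} \<longrightarrow> q permutes {..<d} \<longrightarrow>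
     \<chi> (p \<circ> q) = \<chi> p * \<chi> q) \<and> (\<forall>p. p permutes {..<d} \<longrightarrow> \<chi> (pinv p) = \<chi> p \<and> \<chi> p * \<chi> p = 1)"

lemma is_character_trivial: "is_character d (\<lambda>_. 1)"
  by (simp add: is_character_def)

lemma is_character_sign: "is_character d (\<lambda>p. of_int (sign p))"
  unfolding is_character_def
  by (intro conjI allI impI; simp add: sign_id sign_inv_permutes sign_comp_permutes flip: of_int_mult)

context
  fixes d :: nat and \<kappa> :: "nat \<Rightarrow> nat" and \<chi> :: "(nat \<Rightarrow> nat) \<Rightarrow> rat"
  assumes \<chi>: "is_character d \<chi>"
begin

lemma alternator_alt: "alternator d \<kappa> \<chi> f = (\<lambda>w. \<Sum>p\<in>colour_group d \<kappa>. \<chi> p * pp p f w)"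
  by (simp add: alternator_def pp_def)

lemma alternator_funs:
  assumes "f \<in> funs (words d n)"
  shows "alternator d \<kappa> \<chi> f \<in> funs (words d n)"
  using pp_funs[OF colour_group_permutes assms] unfolding alternator_alt
  by (auto simp: funs_def)

lemma alternator_add: "alternator d \<kappa> \<chi> (f + g) = alternator d \<kappa> \<chi> f + alternator d \<kappa> \<chi> g"
  by (simp add: alternator_def fun_eq_iff fun_app algebra_simps sum.distrib)

lemma alternator_scale: "alternator d \<kappa> \<chi> (fscale c f) = fscale c (alternator d \<kappa> \<chi> f)"
  by (simp add: alternator_def fun_eq_iff fun_app algebra_simps sum_distrib_left)

lemma tact_alternator: "tact d k n M (alternator d \<kappa> \<chi> f) = alternator d \<kappa> \<chi> (tact d k n M f)"
proof -
  have s: "tact d k n M (\<lambda>w. \<Sum>p\<in>P. \<chi> p * pp p f w) = (\<lambda>w. \<Sum>p\<in>P. \<chi> p * tact d k n M (pp p f) w)"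
    if "finite P" for P
    using that
  proof (induction P)
    case empty
    then show ?case using tact_zero by (simp add: zero_fun_def)
  next
    case (insert q P)
    have "tact d k n M (fscale (\<chi> q) (pp q f) + (\<lambda>w. \<Sum>p\<in>P. \<chi> p * pp p f w))
      = fscale (\<chi> q) (tact d k n M (pp q f)) + (\<lambda>w. \<Sum>p\<in>P. \<chi> p * tact d k n M (pp p f) w)"
      by (simp only: tact_add tact_scale insert.IH)
    then show ?case using insert.hyps by (simp add: plus_fun_def fscale_def)
  qed
  show ?thesis
    unfolding alternator_alt s[OF finite_colour_group]
    by (intro ext sum.cong refl) (simp add: tact_pp[OF colour_group_permutes])
qed

text \<open>Self-adjointness: the adjoint of a place permutation is its inverse, and \<chi> takes
  the same value on both.\<close>

lemma ip_alternator:
  "ip (words d n) (alternator d \<kappa> \<chi> f) g = ip (words d n) f (alternator d \<kappa> \<chi> g)"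
proof -
  have "ip (words d n) (alternator d \<kappa> \<chi> f) g = (\<Sum>p\<in>colour_group d \<kappa>. \<chi> p * ip (words d n) (pp p f) g)"
    unfolding ip_def alternator_alt sum_distrib_right sum_distrib_left mult.assoc by (rule sum.swap)
  also have "\<dots> = (\<Sum>p\<in>colour_group d \<kappa>. \<chi> (pinv p) * ip (words d n) f (pp (pinv p) g))"
    by (intro sum.cong refl) (use \<chi> colour_group_permutes in \<open>auto simp: ip_pp is_character_def\<close>)
  also have "\<dots> = (\<Sum>p\<in>colour_group d \<kappa>. \<chi> p * ip (words d n) f (pp p g))"
    by (rule sum_colour_group_inv)
  also have "\<dots> = ip (words d n) f (alternator d \<kappa> \<chi> g)"
    unfolding ip_def alternator_alt sum_distrib_right sum_distrib_left
    by (subst sum.swap) (simp add: mult_ac)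
  finally show ?thesis .
qed

definition equivariant :: "(nat list \<Rightarrow> rat) \<Rightarrow> bool" where
  "equivariant f \<longleftrightarrow> (\<forall>p\<in>colour_group d \<kappa>. \<forall>w. length w = d \<longrightarrow> f (permute_list p w) = \<chi> p * f w)"

lemma alternator_equivariant: "equivariant (alternator d \<kappa> \<chi> f)"
  unfolding equivariant_def
proof (intro ballI allI impI)
  fix p and w :: "nat list" assume p: "p \<in> colour_group d \<kappa>" and w: "length w = d"
  note pp = colour_group_permutes[OF p]
  have "alternator d \<kappa> \<chi> f (permute_list p w)
      = (\<Sum>q\<in>colour_group d \<kappa>. \<chi> q * f (permute_list (p \<circ> q) w))"
    unfolding alternator_def
  proof (intro sum.cong refl)
    fix q assume "q \<in> colour_group d \<kappa>"
    hence "q permutes {..<length w}" using w colour_group_permutes by blast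
    thus "\<chi> q * f (permute_list q (permute_list p w)) = \<chi> q * f (permute_list (p \<circ> q) w)"
      by (simp only: permute_list_compose)
  qed
  also have "\<dots> = (\<Sum>q\<in>colour_group d \<kappa>. \<chi> p * (\<chi> (p \<circ> q) * f (permute_list (p \<circ> q) w)))"
    using \<chi> pp colour_group_permutes unfolding is_character_def
    by (intro sum.cong refl) (simp add: mult.assoc[symmetric])
  also have "\<dots> = (\<Sum>q\<in>colour_group d \<kappa>. \<chi> p * (\<chi> q * f (permute_list q w)))"
    by (rule sum_colour_group_comp[OF p])
  also have "\<dots> = \<chi> p * alternator d \<kappa> \<chi> f w" by (simp add: alternator_def sum_distrib_left)
  finally show "alternator d \<kappa> \<chi> f (permute_list p w) = \<chi> p * alternator d \<kappa> \<chi> f w" .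
qed

lemma alternator_of_equivariant:
  assumes "equivariant f" "length w = d"
  shows "alternator d \<kappa> \<chi> f w = of_nat (card (colour_group d \<kappa>)) * f w"
proof -
  have "alternator d \<kappa> \<chi> f w = (\<Sum>p\<in>colour_group d \<kappa>. f w)"
    unfolding alternator_def
  proof (intro sum.cong refl)
    fix p assume "p \<in> colour_group d \<kappa>"
    thus "\<chi> p * f (permute_list p w) = f w"
      using assms \<chi> colour_group_permutes[of p d \<kappa>]
      by (simp add: equivariant_def is_character_def mult.assoc[symmetric])
  qed
  thus ?thesis by simp
qed

end

lemma card_colour_group_pos: "card (colour_group d \<kappa>) > 0"
  using id_colour_group finite_colour_group by (metis card_gt_0_iff empty_iff)

section \<open>Schur functors\<close>

abbreviation row_sym where
  "row_sym l \<equiv> alternator (sum_list l) (\<lambda>k. fst (cells l ! k)) (\<lambda>_. 1)"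

abbreviation col_alt where
  "col_alt l \<equiv> alternator (sum_list l) (\<lambda>k. snd (cells l ! k)) (\<lambda>p. of_int (sign p))"

text \<open>With two self-adjoint factors, each can be moved across an inner product by itself;
  \<open>hw_vector_in_subrep\<close> depends on this.\<close>

lemma young_symmetrizer_eq: "young_symmetrizer l f = col_alt l (row_sym l f)"
proof
  fix w
  have "young_symmetrizer l f w = (\<Sum>q\<in>col_group l. \<Sum>p\<in>row_group l.
      of_int (sign q) * f (permute_list (pinv p) (permute_list (pinv q) w)))"
    unfolding young_symmetrizer_def place_perm_def by (rule sum.swap)
  also have "\<dots> = (\<Sum>q\<in>col_group l. of_int (sign (pinv q)) * row_sym l f (permute_list (pinv q) w))"
  proof (intro sum.cong refl)
    fix q assume q: "q \<in> col_group l"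
    have "(\<Sum>p\<in>row_group l. f (permute_list (pinv p) (permute_list (pinv q) w)))
      = (\<Sum>p\<in>row_group l. f (permute_list p (permute_list (pinv q) w)))"
      unfolding row_group_eq by (rule sum_colour_group_inv)
    moreover have "sign (pinv q) = sign q"
      using q colour_group_permutes sign_inv_permutes unfolding col_group_eq by blast
    ultimately show "(\<Sum>p\<in>row_group l. of_int (sign q) * f (permute_list (pinv p) (permute_list (pinv q) w)))
      = of_int (sign (pinv q)) * row_sym l f (permute_list (pinv q) w)"
      by (simp add: sum_distrib_left[symmetric] alternator_def row_group_eq)
  qed
  also have "\<dots> = col_alt l (row_sym l f) w"
    unfolding col_group_eq alternator_def[of _ _ "\<lambda>p. of_int (sign p)"] by (rule sum_colour_group_inv)
  finally show "young_symmetrizer l f w = col_alt l (row_sym l f) w" .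
qed

lemma young_symmetrizer_funs:
  "f \<in> funs (words (sum_list l) n) \<Longrightarrow> young_symmetrizer l f \<in> funs (words (sum_list l) n)"
  by (simp add: young_symmetrizer_eq alternator_funs is_character_trivial is_character_sign)

lemma tact_young_symmetrizer:
  "tact (sum_list l) k n M (young_symmetrizer l f) = young_symmetrizer l (tact (sum_list l) k n M f)"
  by (simp add: young_symmetrizer_eq tact_alternator is_character_trivial is_character_sign)

definition schur_set :: "nat list \<Rightarrow> nat \<Rightarrow> (nat list \<Rightarrow> rat) set" where
  "schur_set l n = young_symmetrizer l ` funs (words (sum_list l) n)"

lemma carrier_schur: "carrier (schur l n) = schur_set l n"
  by (simp add: schur_def schur_set_def tensor_power_def funs_def Let_def)

lemma tact_schur_set: "x \<in> schur_set l n \<Longrightarrow> tact (sum_list l) k n M x \<in> schur_set l k"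
  by (auto simp: schur_set_def tact_young_symmetrizer tact_funs)

lemma schur_set_funs: "schur_set l n \<subseteq> funs (words (sum_list l) n)"
  by (auto simp: schur_set_def young_symmetrizer_funs)

lemma subspace_schur_set: "fv.subspace (schur_set l n)"
  unfolding fv.subspace_def
proof (intro conjI ballI allI)
  have add: "young_symmetrizer l (f + g) = young_symmetrizer l f + young_symmetrizer l g" for f g
    by (simp add: young_symmetrizer_eq alternator_add is_character_trivial is_character_sign)
  have scale: "young_symmetrizer l (fscale c f) = fscale c (young_symmetrizer l f)" for c f
    by (simp add: young_symmetrizer_eq alternator_scale is_character_trivial is_character_sign)
  have "young_symmetrizer l 0 = 0" using scale[of 0 0] by simp
  thus "0 \<in> schur_set l n"
    unfolding schur_set_def by (intro image_eqI[OF _ fv.subspace_0[OF subspace_funs]]) simp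
  fix x y assume "x \<in> schur_set l n" "y \<in> schur_set l n"
  then obtain f g where "f \<in> funs (words (sum_list l) n)" "g \<in> funs (words (sum_list l) n)"
    "x = young_symmetrizer l f" "y = young_symmetrizer l g" by (auto simp: schur_set_def)
  thus "x + y \<in> schur_set l n"
    unfolding schur_set_def using fv.subspace_add[OF subspace_funs]
    by (intro image_eqI[of _ _ "f + g"]) (auto simp: add)
next
  have scale: "young_symmetrizer l (fscale c f) = fscale c (young_symmetrizer l f)" for c f
    by (simp add: young_symmetrizer_eq alternator_scale is_character_trivial is_character_sign)
  fix c x assume "x \<in> schur_set l n"
  then obtain f where "f \<in> funs (words (sum_list l) n)" "x = young_symmetrizer l f"
    by (auto simp: schur_set_def)
  thus "fscale c x \<in> schur_set l n"
    unfolding schur_set_def using fv.subspace_scale[OF subspace_funs]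
    by (intro image_eqI[of _ _ "fscale c f"]) (auto simp: scale)
qed

lemma stable_schur_set: "stable (sum_list l) n (schur_set l n)"
  by (simp add: stable_def subspace_schur_set schur_set_funs tact_schur_set)

section \<open>Young diagrams and column-alternating tensors\<close>

lemma length_cells: "length (cells l) = sum_list l"
proof -
  have "length (cells l) = sum_list (map (\<lambda>i. l ! i) [0..<length l])"
    by (simp add: cells_def length_concat o_def)
  thus ?thesis by (simp add: map_nth)
qed

lemma set_cells: "set (cells l) = {(i, j). i < length l \<and> j < l ! i}"
  by (auto simp: cells_def)

lemma distinct_cells: "distinct (cells l)"
proof (rule card_distinct)
  have "set (cells l) = (SIGMA i:{..<length l}. {..<l ! i})" by (auto simp: set_cells)
  thus "card (set (cells l)) = length (cells l)"
    by (simp add: length_cells sum_list_sum_nth atLeast0LessThan)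
qed

text \<open>Each place carries the number of its row as letter, counted from 0. This is the basis
  tensor of weight \<open>l\<close> on which the tableau is superstandard.\<close>

definition row_word :: "nat list \<Rightarrow> nat list" where
  "row_word l = map fst (cells l)"

lemma length_row_word [simp]: "length (row_word l) = sum_list l"
  by (simp add: row_word_def length_cells)

lemma is_partition_nth_mono: "is_partition l \<Longrightarrow> i \<le> j \<Longrightarrow> j < length l \<Longrightarrow> l ! j \<le> l ! i"
  unfolding is_partition_def by (cases "i = j") (auto simp: sorted_wrt_iff_nth_less)

lemma less_num_rows:
  assumes "is_partition l" "i < length l" "l ! i \<noteq> 0"
  shows "i < num_rows l"
proof -
  have "l ! k \<noteq> 0" if "k \<le> i" for k
    using is_partition_nth_mono[OF assms(1) that assms(2)] assms(3) by linarith
  hence "{..i} \<subseteq> {k. k < length l \<and> l ! k \<noteq> 0}" using assms(2) by auto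
  hence "card {..i} \<le> num_rows l"
    unfolding num_rows_def length_filter_conv_card by (intro card_mono) auto
  thus ?thesis by simp
qed

lemma row_word_in_words:
  assumes "is_partition l" "num_rows l \<le> n"
  shows "row_word l \<in> words (sum_list l) n"
proof -
  have "i < n" if "(i, j) \<in> set (cells l)" for i j
  proof -
    have "i < length l" "l ! i \<noteq> 0" using that by (auto simp: set_cells)
    thus ?thesis using less_num_rows[OF assms(1)] assms(2) by (meson less_le_trans)
  qed
  thus ?thesis using length_row_word[of l] by (auto simp: words_def row_word_def)
qed

lemma permute_row_word:
  assumes "p permutes {..<sum_list l}"
  shows "permute_list p (row_word l) = row_word l \<longleftrightarrow> p \<in> row_group l"
proof
  assume "permute_list p (row_word l) = row_word l"
  hence "row_word l ! p k = row_word l ! k" if "k < sum_list l" for k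
    using permute_list_nth[of p "row_word l" k] assms that by simp
  moreover have "p k < sum_list l" if "k < sum_list l" for k
    using permutes_in_image[OF assms] that by auto
  ultimately show "p \<in> row_group l"
    using assms by (auto simp: row_group_def row_word_def length_cells)
next
  assume p: "p \<in> row_group l"
  show "permute_list p (row_word l) = row_word l"
  proof (rule nth_equalityI)
    fix k assume "k < length (permute_list p (row_word l))"
    hence k: "k < sum_list l" by simp
    moreover have "p k < sum_list l" using permutes_in_image[OF assms] k by auto
    ultimately show "permute_list p (row_word l) ! k = row_word l ! k"
      using permute_list_nth[of p "row_word l" k] p assms
      by (auto simp: row_group_def row_word_def length_cells)
  qed simp
qed

lemma row_col_group_trivial:
  assumes "p \<in> row_group l" "p \<in> col_group l"
  shows "p = id"
proof
  fix k
  show "p k = id k"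
  proof (cases "k < sum_list l")
    case True
    have p: "p permutes {..<sum_list l}" using assms(1) by (simp add: row_group_def)
    have "p k < sum_list l" using permutes_in_image[OF p] True by auto
    moreover have "cells l ! p k = cells l ! k"
      using assms True by (auto simp: row_group_def col_group_def prod_eq_iff)
    ultimately show ?thesis
      using True nth_eq_iff_index_eq[OF distinct_cells] by (simp add: length_cells)
  next
    case False
    then show ?thesis using assms(1) by (auto simp: row_group_def permutes_def)
  qed
qed

abbreviation col_alternating where
  "col_alternating l \<equiv> equivariant (sum_list l) (\<lambda>k. snd (cells l ! k)) (\<lambda>p. of_int (sign p))"

lemma schur_set_col_alternating: "x \<in> schur_set l n \<Longrightarrow> col_alternating l x"
  by (auto simp: schur_set_def young_symmetrizer_eq alternator_equivariant is_character_sign)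

text \<open>If two places of one column carried the same letter, their transposition would fix
  \<open>w\<close> and yet change the sign of \<open>f w\<close>.\<close>

lemma col_alternating_distinct:
  assumes "col_alternating l f" "length w = sum_list l" "f w \<noteq> 0"
    and ij: "i < sum_list l" "j < sum_list l" "snd (cells l ! i) = snd (cells l ! j)" "w ! i = w ! j"
  shows "i = j"
proof (rule ccontr)
  assume "i \<noteq> j"
  define t where "t = transpose i j"
  have per: "t permutes {..<sum_list l}" using ij by (simp add: t_def permutes_swap_id)
  have "permute_list t w = w"
    by (rule nth_equalityI) (use ij assms(2) per in \<open>auto simp: permute_list_nth t_def transpose_def\<close>)
  moreover have "t \<in> colour_group (sum_list l) (\<lambda>k. snd (cells l ! k))"
    using per ij by (auto simp: colour_group_def t_def transpose_def)
  ultimately have "f w = of_int (sign t) * f w"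
    using assms(1,2) unfolding equivariant_def[OF is_character_sign] by metis
  moreover have "sign t = -1" using \<open>i \<noteq> j\<close> by (simp add: t_def sign_swap_id)
  ultimately show False using assms(3) by simp
qed

text \<open>The largest of c + 1 distinct numbers is at least c; remove it and induct. Applied to
  the letters in a column, it singles out the column of the row word as the one of least
  sum.\<close>

lemma sum_initial_segment_le:
  fixes A :: "nat set"
  assumes "finite A"
  shows "\<Sum>{..<card A} \<le> \<Sum>A \<and> (\<Sum>{..<card A} = \<Sum>A \<longrightarrow> A = {..<card A})"
  using assms
proof (induction "card A" arbitrary: A)
  case 0
  then show ?case by simp
next
  case (Suc c)
  define m where "m = Max A"
  have ne: "A \<noteq> {}" using Suc.hyps(2) by auto
  have m: "m \<in> A" using Suc.prems ne by (simp add: m_def)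
  have cA: "card (A - {m}) = c" using Suc m by simp
  have IH: "\<Sum>{..<c} \<le> \<Sum>(A - {m}) \<and> (\<Sum>{..<c} = \<Sum>(A - {m}) \<longrightarrow> A - {m} = {..<c})"
    using Suc.hyps(1)[of "A - {m}"] Suc.prems cA by simp
  have "A \<subseteq> {..m}" using Suc.prems by (auto simp: m_def)
  hence "card A \<le> card {..m}" by (intro card_mono) auto
  hence cm: "c \<le> m" using Suc.hyps(2) by simp
  have sA: "\<Sum>A = m + \<Sum>(A - {m})" using sum.remove[OF Suc.prems m] by auto
  have sc: "\<Sum>{..<card A} = \<Sum>{..<c} + c" using Suc.hyps(2) by (metis lessThan_Suc sum.lessThan_Suc)
  have "A = {..<card A}" if "\<Sum>{..<card A} = \<Sum>A"
  proof -
    have "\<Sum>{..<c} = \<Sum>(A - {m})" "m = c" using that sA sc IH cm by linarith+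
    hence "A - {m} = {..<c}" "m = c" using IH by auto
    hence "A = insert c {..<c}" using m by blast
    thus ?thesis using Suc.hyps(2) by (metis lessThan_Suc)
  qed
  thus ?case using sA sc IH cm by linarith
qed

text \<open>For a partition, a box in some row of column \<open>j\<close> has boxes above it in all
  earlier rows, so the rows that meet the column form an initial segment.\<close>

lemma column_rows:
  assumes "is_partition l"
  defines "K j \<equiv> {k. k < sum_list l \<and> snd (cells l ! k) = j}"
  shows "(!) (row_word l) ` K j = {..<card (K j)}" "inj_on ((!) (row_word l)) (K j)"
proof -
  show inj: "inj_on ((!) (row_word l)) (K j)"
  proof (rule inj_onI)
    fix x y assume xy: "x \<in> K j" "y \<in> K j" "row_word l ! x = row_word l ! y"
    hence "cells l ! x = cells l ! y" by (simp add: K_def row_word_def length_cells prod_eq_iff)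
    thus "x = y" using xy nth_eq_iff_index_eq[OF distinct_cells] by (simp add: K_def length_cells)
  qed
  have im: "(!) (row_word l) ` K j = {i. (i, j) \<in> set (cells l)}"
    by (force simp: K_def row_word_def length_cells in_set_conv_nth image_iff)
  have "finite (K j)" by (simp add: K_def)
  hence fin: "finite ((!) (row_word l) ` K j)" by simp
  have down: "i' \<in> (!) (row_word l) ` K j" if "i \<in> (!) (row_word l) ` K j" "i' \<le> i" for i i'
    using that is_partition_nth_mono[OF assms(1), of i' i] unfolding im by (auto simp: set_cells)
  have "(!) (row_word l) ` K j = {..<card ((!) (row_word l) ` K j)}"
  proof -
    obtain h where h: "\<And>i. i \<in> (!) (row_word l) ` K j \<longleftrightarrow> i < h"
    proof -
      define h where "h = (LEAST h. h \<notin> (!) (row_word l) ` K j)"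
      have "\<exists>h. h \<notin> (!) (row_word l) ` K j" using fin by (metis ex_new_if_finite infinite_UNIV_nat)
      hence "h \<notin> (!) (row_word l) ` K j" unfolding h_def by (rule LeastI_ex)
      hence "i \<in> (!) (row_word l) ` K j \<longleftrightarrow> i < h" for i
        using down not_less_Least[of i "\<lambda>h. h \<notin> (!) (row_word l) ` K j"] unfolding h_def
        by (meson not_le_imp_less)
      thus ?thesis using that by blast
    qed
    hence "(!) (row_word l) ` K j = {..<h}" by blast
    thus ?thesis by simp
  qed
  thus "(!) (row_word l) ` K j = {..<card (K j)}" using card_image[OF inj] by simp
qed

text \<open>The letters in a column are distinct, so each column sum is at least that of the row
  word, whose letters there are 0, 1, 2 and so on. Equal totals force equality in every column, and
  then each column of \<open>w\<close> rearranges that of the row word.\<close>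

lemma column_distinct_sum_list:
  assumes l: "is_partition l" and w: "length w = sum_list l"
    and dist: "\<And>i j. i < sum_list l \<Longrightarrow> j < sum_list l \<Longrightarrow> snd (cells l ! i) = snd (cells l ! j) \<Longrightarrow>
      w ! i = w ! j \<Longrightarrow> i = j"
  shows "sum_list (row_word l) \<le> sum_list w"
    and "sum_list (row_word l) = sum_list w \<Longrightarrow> \<exists>q\<in>col_group l. w = permute_list q (row_word l)"
proof -
  let ?d = "sum_list l"
  define K where "K j = {k. k < ?d \<and> snd (cells l ! k) = j}" for j
  define J where "J = snd ` set (cells l)"
  have finK: "finite (K j)" for j by (simp add: K_def)
  have group: "sum_list u = (\<Sum>j\<in>J. \<Sum>k\<in>K j. u ! k)" if "length u = ?d" for u :: "nat list"
  proof -
    have "(\<lambda>k. snd (cells l ! k)) ` {..<?d} \<subseteq> J"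
      unfolding J_def by (auto simp: length_cells)
    from sum.group[OF _ _ this, of "(!) u"] have "(\<Sum>j\<in>J. \<Sum>k\<in>K j. u ! k) = (\<Sum>k<?d. u ! k)"
      by (simp add: K_def J_def)
    thus ?thesis using that by (simp add: sum_list_sum_nth atLeast0LessThan)
  qed
  have inj: "inj_on ((!) w) (K j)" for j using dist by (auto simp: inj_on_def K_def)
  have sw: "(\<Sum>k\<in>K j. w ! k) = \<Sum>((!) w ` K j)" for j
    using sum.reindex[OF inj, of "\<lambda>x. x" j] by simp
  have sr: "(\<Sum>k\<in>K j. row_word l ! k) = \<Sum>{..<card (K j)}" for j
    using sum.reindex[OF column_rows(2)[OF l], of "\<lambda>x. x" j] column_rows(1)[OF l, of j] by (simp add: K_def)
  have le: "(\<Sum>k\<in>K j. row_word l ! k) \<le> (\<Sum>k\<in>K j. w ! k)" for j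
    using sum_initial_segment_le[of "(!) w ` K j"] finK card_image[OF inj] unfolding sw sr by simp
  show "sum_list (row_word l) \<le> sum_list w"
    unfolding group[OF w] group[OF length_row_word] by (intro sum_mono le)
  assume eq: "sum_list (row_word l) = sum_list w"
  have "finite J" by (simp add: J_def)
  hence "(\<Sum>k\<in>K j. row_word l ! k) = (\<Sum>k\<in>K j. w ! k)" if "j \<in> J" for j
    using eq le that unfolding group[OF w] group[OF length_row_word]
    by (metis (no_types, lifting) order_le_imp_less_or_eq order_less_irrefl sum_strict_mono_ex1)
  hence im: "(!) w ` K j = (!) (row_word l) ` K j" if "j \<in> J" for j
    using that sum_initial_segment_le[of "(!) w ` K j"] finK card_image[OF inj]
      column_rows(1)[OF l, of j] unfolding sw sr by (simp add: K_def)
  \<comment> \<open>Letters paired with columns: once \<open>ps\<close> is known to list the same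
    boxes as \<open>cells l\<close>, the permutation between the two lists preserves columns by
    construction.\<close>
  define ps where "ps = zip w (map snd (cells l))"
  have lps: "length ps = ?d" using w by (simp add: ps_def length_cells)
  have nps: "ps ! k = (w ! k, snd (cells l ! k))" if "k < ?d" for k
    using that w by (simp add: ps_def length_cells)
  have "distinct ps"
    unfolding distinct_conv_nth using dist nps lps by auto
  moreover have "set ps = set (cells l)"
  proof -
    have "set ps = (\<Union>j\<in>J. (\<lambda>a. (a, j)) ` ((!) w ` K j))"
    proof (intro equalityI subsetI)
      fix z assume "z \<in> set ps"
      then obtain k where k: "k < ?d" "z = (w ! k, snd (cells l ! k))"
        using lps nps by (auto simp: in_set_conv_nth)
      hence "k \<in> K (snd z)" "snd z \<in> J" by (auto simp: K_def J_def length_cells)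
      thus "z \<in> (\<Union>j\<in>J. (\<lambda>a. (a, j)) ` ((!) w ` K j))" using k(2) by force
    next
      fix z assume "z \<in> (\<Union>j\<in>J. (\<lambda>a. (a, j)) ` ((!) w ` K j))"
      then obtain j k where "k \<in> K j" "z = (w ! k, j)" by blast
      hence "k < length ps" "z = ps ! k" using lps nps by (auto simp: K_def)
      thus "z \<in> set ps" by simp
    qed
    also have "\<dots> = (\<Union>j\<in>J. (\<lambda>a. (a, j)) ` ((!) (row_word l) ` K j))"
      using im by simp
    also have "\<dots> = set (cells l)"
    proof (intro equalityI subsetI)
      fix z assume "z \<in> (\<Union>j\<in>J. (\<lambda>a. (a, j)) ` ((!) (row_word l) ` K j))"
      then obtain j k where "k \<in> K j" "z = (row_word l ! k, j)" by blast
      hence "k < length (cells l)" "z = cells l ! k"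
        by (auto simp: K_def row_word_def length_cells prod_eq_iff)
      thus "z \<in> set (cells l)" by simp
    next
      fix z assume z: "z \<in> set (cells l)"
      then obtain k where k: "k < ?d" "z = cells l ! k" by (auto simp: in_set_conv_nth length_cells)
      hence "k \<in> K (snd z)" "snd z \<in> J" "z = (row_word l ! k, snd z)"
        using z by (auto simp: K_def J_def row_word_def length_cells)
      thus "z \<in> (\<Union>j\<in>J. (\<lambda>a. (a, j)) ` ((!) (row_word l) ` K j))" by blast
    qed
    finally show ?thesis .
  qed
  ultimately have "mset ps = mset (cells l)" using distinct_cells by (simp add: set_eq_iff_mset_eq_distinct)
  then obtain q where q: "q permutes {..<length (cells l)}" "permute_list q (cells l) = ps"
    by (metis mset_eq_permutation)
  have q': "q permutes {..<?d}" using q(1) by (simp add: length_cells)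
  have "cells l ! q k = (w ! k, snd (cells l ! k))" if "k < ?d" for k
    using permute_list_nth[of q "cells l" k] q that nps[OF that] by (simp add: length_cells)
  hence "q \<in> col_group l" using q' by (simp add: col_group_def)
  moreover have "w = permute_list q (row_word l)"
    unfolding row_word_def using q permute_list_map[OF q(1), of fst] w by (simp add: ps_def length_cells)
  ultimately show "\<exists>q\<in>col_group l. w = permute_list q (row_word l)" by blast
qed

section \<open>The highest weight vector of a Schur functor\<close>

text \<open>No number of letters occurs: the same function serves for every \<open>n\<close> with
  \<open>num_rows l \<le> n\<close>, which ties the values of the Schur functor together.\<close>

definition hw_vector :: "nat list \<Rightarrow> nat list \<Rightarrow> rat" where
  "hw_vector l = young_symmetrizer l (\<lambda>w. if w = row_word l then 1 else 0)"

lemma hw_vector_in_schur_set: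
  assumes "is_partition l" "num_rows l \<le> n"
  shows "hw_vector l \<in> schur_set l n"
  unfolding hw_vector_def schur_set_def
  using row_word_in_words[OF assms] by (intro imageI) (auto simp: funs_def)

lemma hw_vector_apply:
  assumes "length w = sum_list l"
  shows "hw_vector l w = of_nat (card (row_group l)) *
    (\<Sum>q\<in>col_group l. of_int (sign q) * (if permute_list q w = row_word l then 1 else 0))"
proof -
  let ?e = "\<lambda>w. if w = row_word l then 1 else 0 :: rat"
  have r: "row_sym l ?e u = of_nat (card (row_group l)) * ?e u" if u: "length u = sum_list l" for u
  proof -
    have "?e (permute_list p u) = ?e u" if p: "p \<in> row_group l" for p
    proof -
      have per: "p permutes {..<sum_list l}" using p by (simp add: row_group_def)
      have "permute_list p u = row_word l \<longleftrightarrow> u = row_word l"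
        using permute_row_word[OF per] p permute_list_inv(1)[of p u] permute_list_inv(1)[of p "row_word l"] per u
        by (metis length_row_word)
      thus ?thesis by simp
    qed
    hence "row_sym l ?e u = (\<Sum>p\<in>row_group l. ?e u)"
      unfolding alternator_def row_group_eq[symmetric] by (intro sum.cong refl) (simp only: mult_1)
    thus ?thesis by simp
  qed
  show ?thesis
    unfolding hw_vector_def young_symmetrizer_eq
    unfolding alternator_def[of _ _ "\<lambda>p. of_int (sign p)"] col_group_eq[symmetric] sum_distrib_left
    by (intro sum.cong refl) (simp add: r assms)
qed

text \<open>A column permutation fixing the row word is also a row permutation, hence the identity;
  only one term of the alternating sum survives.\<close>

lemma hw_vector_row_word: "hw_vector l (row_word l) = of_nat (card (row_group l))"
proof -
  have "(\<Sum>q\<in>col_group l. of_int (sign q) * (if permute_list q (row_word l) = row_word l then 1 else 0 :: rat))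
    = (\<Sum>q\<in>col_group l. if q = id then 1 else 0)"
  proof (intro sum.cong refl)
    fix q assume q: "q \<in> col_group l"
    have "permute_list q (row_word l) = row_word l \<longleftrightarrow> q = id"
      using permute_row_word[of q l] row_col_group_trivial[of q l] q by (auto simp: col_group_def)
    thus "of_int (sign q) * (if permute_list q (row_word l) = row_word l then 1 else 0 :: rat)
      = (if q = id then 1 else 0)" by (simp add: sign_id)
  qed
  also have "\<dots> = 1"
    using finite_colour_group id_colour_group unfolding col_group_eq by simp
  finally show ?thesis by (simp add: hw_vector_apply)
qed

lemma hw_vector_row_word_nonzero: "hw_vector l (row_word l) \<noteq> 0"
  unfolding hw_vector_row_word row_group_eq using card_colour_group_pos by simp

lemma hw_vector_nonzero: "hw_vector l \<noteq> 0"
  using hw_vector_row_word_nonzero by (metis zero_fun_apply)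

lemma hw_vector_col_alternating: "col_alternating l (hw_vector l)"
  unfolding hw_vector_def young_symmetrizer_eq by (rule alternator_equivariant[OF is_character_sign])

lemma hw_vector_support:
  assumes "hw_vector l w \<noteq> 0" "length w = sum_list l"
  shows "mset w = mset (row_word l)"
proof -
  have "(\<Sum>q\<in>col_group l. of_int (sign q) * (if permute_list q w = row_word l then 1 else 0 :: rat)) \<noteq> 0"
    using assms hw_vector_apply by auto
  then obtain q where "q \<in> col_group l"
    "of_int (sign q) * (if permute_list q w = row_word l then 1 else 0 :: rat) \<noteq> 0"
    by (rule sum.not_neutral_contains_not_neutral)
  hence "q \<in> col_group l" "permute_list q w = row_word l" by (auto split: if_splits)
  thus ?thesis using assms(2) mset_permute_list[of q w] by (simp add: col_group_def)
qed

lemma hw_vector_funs: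
  assumes "is_partition l" "num_rows l \<le> n"
  shows "hw_vector l \<in> funs (words (sum_list l) n)"
  using hw_vector_in_schur_set[OF assms] schur_set_funs by blast

section \<open>Weight projections and simplicity of Schur functors\<close>

definition diagm :: "nat \<Rightarrow> (nat \<Rightarrow> rat) \<Rightarrow> rat mat" where
  "diagm n x = mat n n (\<lambda>(i, j). if i = j then x i else 0)"

lemma diagm_carrier [simp]: "diagm n x \<in> carrier_mat n n"
  by (simp add: diagm_def)

lemma tact_diagm:
  assumes "f \<in> funs (words d n)"
  shows "tact d n n (diagm n x) f = (\<lambda>w. (\<Prod>k<d. x (w ! k)) * f w)"
proof
  fix w
  show "tact d n n (diagm n x) f w = (\<Prod>k<d. x (w ! k)) * f w"
  proof (cases "w \<in> words d n")
    case True
    have "kern d (diagm n x) w u = (if w = u then \<Prod>k<d. x (w ! k) else 0)" if u: "u \<in> words d n" for u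
    proof (cases "w = u")
      case True
      then show ?thesis using u nth_words[OF u] by (auto simp: kern_def diagm_def intro!: prod.cong)
    next
      case False
      then obtain i where i: "i < d" "w ! i \<noteq> u ! i" using u True by (metis length_words nth_equalityI)
      have "diagm n x $$ (w ! i, u ! i) = 0"
        using i nth_words[OF u i(1)] nth_words[OF True i(1)] by (simp add: diagm_def)
      then show ?thesis using False i(1) unfolding kern_def by (auto intro!: prod_zero bexI[of _ i])
    qed
    hence "tact d n n (diagm n x) f w = (\<Sum>u\<in>words d n. if w = u then (\<Prod>k<d. x (w ! k)) * f u else 0)"
      using True by (simp add: tact_def if_distrib[of "\<lambda>c. c * f _"] cong: if_cong sum.cong)
    also have "\<dots> = (\<Prod>k<d. x (w ! k)) * f w" using True by simp
    finally show ?thesis .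
  qed (use assms in \<open>auto simp: tact_def funs_def\<close>)
qed

lemma stable_weight_projection:
  fixes x :: "nat \<Rightarrow> rat"
  assumes "stable d n X" "f \<in> X"
  shows "(\<lambda>w. if (\<Prod>k<d. x (w ! k)) = c then f w else 0) \<in> X"
proof (rule eigenspace_projection[where \<theta> = "\<lambda>w. \<Prod>k<d. x (w ! k)",
      OF finite_words stableD(1,2)[OF assms(1)] _ assms(2)])
  fix f assume f: "f \<in> X"
  have "(\<lambda>w. (\<Prod>k<d. x (w ! k)) * f w) = tact d n n (diagm n x) f"
    using tact_diagm stableD(2)[OF assms(1)] f by (metis subsetD)
  thus "(\<lambda>w. (\<Prod>k<d. x (w ! k)) * f w) \<in> X" using stableD(3)[OF assms(1) _ f] by simp
qed

lemma prod_power_nth: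
  fixes g :: "nat \<Rightarrow> nat"
  shows "length w = d \<Longrightarrow> (\<Prod>k<d. (2::rat) ^ g (w ! k)) = 2 ^ sum_list (map g w)"
  by (simp add: power_sum[symmetric] sum_list_sum_nth atLeast0LessThan)

text \<open>With the diagonal entries \<open>2 ^ g i\<close> the eigenvalue on a word is 2 to the
  sum of its \<open>g\<close>-values, from which that sum can be read off.\<close>

lemma stable_sum_projection:
  fixes g :: "nat \<Rightarrow> nat"
  assumes "stable d n X" "f \<in> X"
  shows "(\<lambda>w. if sum_list (map g w) = s then f w else 0) \<in> X"
proof -
  have "(\<lambda>w. if (\<Prod>k<d. (2::rat) ^ g (w ! k)) = 2 ^ s then f w else 0)
    = (\<lambda>w. if sum_list (map g w) = s then f w else 0)"
  proof
    fix w
    show "(if (\<Prod>k<d. (2::rat) ^ g (w ! k)) = 2 ^ s then f w else 0)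
      = (if sum_list (map g w) = s then f w else 0)"
    proof (cases "w \<in> words d n")
      case True
      then show ?thesis by (simp add: prod_power_nth length_words)
    next
      case False
      then show ?thesis using stableD(2)[OF assms(1)] assms(2) by (auto simp: funs_def)
    qed
  qed
  thus ?thesis using stable_weight_projection[OF assms, of "\<lambda>i. 2 ^ g i" "2 ^ s"] by simp
qed

text \<open>The functionals \<open>y \<mapsto> tact _ n n M y (row_word l)\<close> span all row orbit sums: rescaling the entries
  of \<open>M\<close> one at a time separates the orbits.\<close>

lemma row_symmetric_detect:
  assumes y: "y \<in> funs (words (sum_list l) n)" "y \<noteq> 0"
    and rw: "row_word l \<in> words (sum_list l) n"
    and sym: "\<And>p w. p \<in> row_group l \<Longrightarrow> length w = sum_list l \<Longrightarrow> y (permute_list p w) = y w"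
  shows "\<exists>M\<in>carrier_mat n n. tact (sum_list l) n n M y (row_word l) \<noteq> 0"
proof (rule ccontr)
  let ?d = "sum_list l" and ?r = "row_word l"
  assume "\<not> ?thesis"
  hence neg: "tact ?d n n M y ?r = 0" if "M \<in> carrier_mat n n" for M using that by blast
  define K where "K M = (\<lambda>u. if u \<in> words ?d n then kern ?d M ?r u else 0)" for M
  define X where "X = fv.span (K ` carrier_mat n n)"
  have subX: "fv.subspace X" by (simp add: X_def)
  have Xf: "X \<subseteq> funs (words ?d n)"
    unfolding X_def by (rule fv.span_minimal[OF _ subspace_funs]) (auto simp: K_def funs_def)
  have ipX: "ip (words ?d n) x y = 0" if "x \<in> X" for x
  proof -
    have "fv.subspace {x. ip (words ?d n) x y = 0}"
      by (auto simp: fv.subspace_def ip_add_left ip_scale_left)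
    moreover have "ip (words ?d n) (K M) y = 0" if "M \<in> carrier_mat n n" for M
      using neg[OF that] rw by (simp add: ip_def K_def tact_def)
    ultimately have "X \<subseteq> {x. ip (words ?d n) x y = 0}"
      unfolding X_def by (intro fv.span_minimal) auto
    thus ?thesis using that by blast
  qed
  \<comment> \<open>The numbers of places where the row word has \<open>i\<close> and
    \<open>u\<close> has \<open>j\<close>. Taken together they determine the orbit of
    \<open>u\<close> under the row group.\<close>
  define N where "N = (\<lambda>(i, j) (u :: nat list). card {k. k < ?d \<and> ?r ! k = i \<and> u ! k = j})"
  have closed: "(\<lambda>u. 2 ^ N z u * x u) \<in> X" if x: "x \<in> X" for z x
  proof -
    obtain i j where z: "z = (i, j)" by fastforce
    have "fv.subspace {x. (\<lambda>u. 2 ^ N z u * x u) \<in> X}"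
      unfolding fv.subspace_def
    proof (intro conjI ballI allI; clarify)
      show "(\<lambda>u. 2 ^ N z u * (0 :: nat list \<Rightarrow> rat) u) \<in> X"
        using fv.subspace_0[OF subX] by (simp add: zero_fun_def)
    next
      fix a b :: "nat list \<Rightarrow> rat"
      assume "(\<lambda>u. 2 ^ N z u * a u) \<in> X" "(\<lambda>u. 2 ^ N z u * b u) \<in> X"
      from fv.subspace_add[OF subX this] show "(\<lambda>u. 2 ^ N z u * (a + b) u) \<in> X"
        by (simp add: plus_fun_def algebra_simps)
    next
      fix c and a :: "nat list \<Rightarrow> rat"
      assume "(\<lambda>u. 2 ^ N z u * a u) \<in> X"
      from fv.subspace_scale[OF subX this, of c] show "(\<lambda>u. 2 ^ N z u * fscale c a u) \<in> X"
        by (simp add: fscale_def algebra_simps)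
    qed
    moreover have "(\<lambda>u. 2 ^ N z u * K M u) \<in> X" if M: "M \<in> carrier_mat n n" for M
    proof -
      \<comment> \<open>Doubling the entry at (i, j) multiplies the functional at \<open>u\<close>
        by 2 to the number of its factors equal to this entry.\<close>
      define M' where "M' = mat n n (\<lambda>(a, b). if a = i \<and> b = j then 2 * M $$ (a, b) else M $$ (a, b))"
      have "(\<lambda>u. 2 ^ N z u * K M u) = K M'"
      proof
        fix u
        show "2 ^ N z u * K M u = K M' u"
        proof (cases "u \<in> words ?d n")
          case True
          have "kern ?d M' ?r u = (\<Prod>k<?d. (if ?r ! k = i \<and> u ! k = j then 2 else 1) * M $$ (?r ! k, u ! k))"
            unfolding kern_def by (rule prod.cong) (use nth_words rw True in \<open>auto simp: M'_def\<close>)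
          also have "\<dots> = (\<Prod>k<?d. if ?r ! k = i \<and> u ! k = j then 2 else 1) * kern ?d M ?r u"
            by (simp add: prod.distrib kern_def)
          also have "(\<Prod>k<?d. if ?r ! k = i \<and> u ! k = j then 2 else 1 :: rat) = 2 ^ N z u"
            unfolding z N_def by (simp add: prod.If_cases Int_def conj_ac)
          finally show ?thesis using True by (simp add: K_def)
        qed (simp add: K_def)
      qed
      moreover have "M' \<in> carrier_mat n n" by (simp add: M'_def)
      ultimately show ?thesis unfolding X_def by (auto intro: fv.span_base)
    qed
    ultimately have "X \<subseteq> {x. (\<lambda>u. 2 ^ N z u * x u) \<in> X}"
      unfolding X_def by (intro fv.span_minimal) (auto simp: X_def[symmetric])
    thus ?thesis using x by blast
  qed
  obtain u0 where u0: "y u0 \<noteq> 0" using y(2) by (auto simp: fun_eq_iff fun_app)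
  have u0w: "u0 \<in> words ?d n" using u0 y(1) by (auto simp: funs_def)
  \<comment> \<open>The matrix of ones gives the indicator of all words; spectral projections then
    impose the counts of \<open>u0\<close> for one pair of letters after another.\<close>
  have ind: "(\<lambda>u. if u \<in> words ?d n \<and> (\<forall>z\<in>S. N z u = N z u0) then 1 else 0) \<in> X" if "finite S" for S
    using that
  proof (induction S)
    case empty
    have "K (mat n n (\<lambda>_. 1)) = (\<lambda>u. if u \<in> words ?d n \<and> (\<forall>z\<in>{}. N z u = N z u0) then 1 else 0)"
      using nth_words rw by (auto simp: K_def kern_def fun_eq_iff intro!: prod.neutral)
    moreover have "K (mat n n (\<lambda>_. 1)) \<in> X" unfolding X_def by (intro fv.span_base) auto
    ultimately show ?case by (simp only:)
  next
    case (insert z S)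
    from eigenspace_projection[OF finite_words subX Xf closed insert.IH, of z "2 ^ N z u0"]
    show ?case by (rule back_subst[of "\<lambda>f. f \<in> X"]) (auto simp: fun_eq_iff)
  qed
  define S where "S = {..<n} \<times> {..<n}"
  define A where "A = {u \<in> words ?d n. \<forall>z\<in>S. N z u = N z u0}"
  \<comment> \<open>Equal counts mean equal multisets of pairs of letters. A permutation matching
    the pairs fixes the row word, so it lies in the row group.\<close>
  have yA: "y u = y u0" if u: "u \<in> A" for u
  proof -
    have uw: "u \<in> words ?d n" using u by (simp add: A_def)
    have cnt: "count (mset (zip ?r v)) (i, j) = N (i, j) v" if "v \<in> words ?d n" for i j v
    proof -
      have "count (mset (zip ?r v)) (i, j) = card {k. k < length (zip ?r v) \<and> (i, j) = zip ?r v ! k}"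
        by (simp add: count_mset count_list_eq_length_filter length_filter_conv_card del: length_zip)
      also have "{k. k < length (zip ?r v) \<and> (i, j) = zip ?r v ! k} = {k. k < ?d \<and> ?r ! k = i \<and> v ! k = j}"
        using length_words[OF that] by auto
      finally show ?thesis by (simp add: N_def)
    qed
    have "N z u = N z u0" for z
    proof (cases "z \<in> S")
      case True
      then show ?thesis using u by (simp add: A_def)
    next
      case False
      obtain i j where z: "z = (i, j)" by fastforce
      have "N z v = 0" if v: "v \<in> words ?d n" for v
      proof -
        have "\<not> (k < ?d \<and> ?r ! k = i \<and> v ! k = j)" for k
          using False nth_words[OF rw] nth_words[OF v] by (auto simp: z S_def)
        thus ?thesis by (simp add: z N_def)
      qed
      thus ?thesis using uw u0w by simp
    qed
    hence "mset (zip ?r u) = mset (zip ?r u0)"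
      by (intro multiset_eqI) (auto simp: cnt uw u0w)
    then obtain p where p: "p permutes {..<length (zip ?r u0)}" "permute_list p (zip ?r u0) = zip ?r u"
      by (metis mset_eq_permutation)
    have len: "length u = ?d" "length u0 = ?d" using uw u0w by (auto simp: length_words)
    have p': "p permutes {..<?d}" using p(1) len by simp
    have "permute_list p (zip ?r u0) = zip (permute_list p ?r) (permute_list p u0)"
      by (rule permute_list_zip[OF p']) (use len in auto)
    hence "zip (permute_list p ?r) (permute_list p u0) = zip ?r u" using p(2) by (simp only:)
    note zeq = arg_cong[OF this, of "map fst"] arg_cong[OF this, of "map snd"]
    have "permute_list p ?r = ?r" "permute_list p u0 = u" using zeq len by simp_all
    hence "p \<in> row_group l" using permute_row_word[OF p'] by simp
    from sym[OF this len(2)] show ?thesis using \<open>permute_list p u0 = u\<close> by simp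
  qed
  have "0 = ip (words ?d n) (\<lambda>u. if u \<in> words ?d n \<and> (\<forall>z\<in>S. N z u = N z u0) then 1 else 0) y"
    using ipX[OF ind[of S]] by (simp add: S_def)
  also have "\<dots> = (\<Sum>u\<in>A. y u)"
    unfolding ip_def A_def by (simp add: sum.If_cases if_distrib[of "\<lambda>c. c * y _"] Int_def conj_ac cong: if_cong)
  also have "\<dots> = of_nat (card A) * y u0" using yA by simp
  finally have "card A = 0" using u0 by simp
  moreover have "finite A" by (simp add: A_def)
  moreover have "u0 \<in> A" using u0w by (simp add: A_def)
  ultimately show False by auto
qed

text \<open>Row symmetrization does not kill a nonzero \<open>x\<close>, so some translate of
  \<open>x\<close> has a nonzero coefficient at the row word. The part of that translate with the
  letter sum of the row word is a multiple of \<open>hw_vector l\<close>.\<close>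

lemma hw_vector_in_subrep:
  assumes l: "is_partition l" "num_rows l \<le> n"
    and X: "stable (sum_list l) n X" "X \<subseteq> schur_set l n" "X \<noteq> {0}"
  shows "hw_vector l \<in> X"
proof -
  let ?d = "sum_list l" and ?r = "row_word l"
  note rw = row_word_in_words[OF l]
  obtain x where x: "x \<in> X" "x \<noteq> 0" using X(3) stableD(4)[OF X(1)] by blast
  obtain h where h: "h \<in> funs (words ?d n)" "x = col_alt l (row_sym l h)"
    using x(1) X(2) by (auto simp: schur_set_def young_symmetrizer_eq)
  have xf: "x \<in> funs (words ?d n)" using x X(2) schur_set_funs by blast
  have calt: "col_alternating l x" if "x \<in> X" for x using schur_set_col_alternating X(2) that by blast
  let ?c = "of_nat (card (colour_group ?d (\<lambda>k. snd (cells l ! k)))) :: rat"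
  have cx: "col_alt l x = fscale ?c x"
  proof
    fix w
    show "col_alt l x w = fscale ?c x w"
    proof (cases "w \<in> words ?d n")
      case True
      then show ?thesis
        using alternator_of_equivariant[OF is_character_sign calt[OF x(1)], of w]
        by (simp add: length_words fun_app)
    next
      case False
      then show ?thesis using xf alternator_funs[OF is_character_sign xf] by (simp add: funs_def fun_app)
    qed
  qed
  \<comment> \<open>Here \<open>x\<close> is the column antisymmetrizer applied to
    \<open>row_sym l h\<close>. Moved to the other argument, the antisymmetrizer acts on
    \<open>x\<close> as the scalar \<open>?c\<close>; the row symmetrizer is moved next.\<close>
  have "ip (words ?d n) x x = ?c * ip (words ?d n) (row_sym l x) h"
    using h(2) by (metis cx ip_alternator[OF is_character_sign] ip_alternator[OF is_character_trivial] ip_scale_left)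
  moreover have "ip (words ?d n) x x \<noteq> 0" using ip_self_zero[OF finite_words xf] x(2) by blast
  ultimately have rx: "row_sym l x \<noteq> 0" by auto
  have rsym: "row_sym l g (permute_list p w) = row_sym l g w" if "p \<in> row_group l" "length w = ?d" for p w g
    using alternator_equivariant[OF is_character_trivial, of ?d "\<lambda>k. fst (cells l ! k)" g] that
    unfolding equivariant_def[OF is_character_trivial] row_group_eq by simp
  obtain M where M: "M \<in> carrier_mat n n" "tact ?d n n M (row_sym l x) ?r \<noteq> 0"
    using row_symmetric_detect[OF alternator_funs[OF is_character_trivial xf] rx rw rsym] by blast
  define f where "f = tact ?d n n M x"
  have fX: "f \<in> X" using stableD(3)[OF X(1) M(1) x(1)] by (simp add: f_def)
  \<comment> \<open>The row group fixes \<open>?r\<close>, so symmetrizing only multiplies this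
    coefficient, and \<open>f\<close> itself is nonzero there.\<close>
  have "row_sym l f ?r = (\<Sum>p\<in>row_group l. f ?r)"
    unfolding alternator_def row_group_eq[symmetric]
  proof (intro sum.cong refl)
    fix p assume p: "p \<in> row_group l"
    hence "p permutes {..<?d}" by (simp add: row_group_def)
    hence "permute_list p ?r = ?r" using permute_row_word p by blast
    thus "1 * f (permute_list p ?r) = f ?r" by simp
  qed
  moreover have "row_sym l f ?r \<noteq> 0"
    using M(2) by (simp add: f_def tact_alternator[OF is_character_trivial])
  ultimately have fr: "f ?r \<noteq> 0" by auto
  \<comment> \<open>At this letter sum a column-alternating function lives on the words obtained
    from \<open>?r\<close> by column permutations, so its value at \<open>?r\<close> determines
    it.\<close>
  define g where "g = (\<lambda>w. if sum_list (map (\<lambda>i. i) w) = sum_list ?r then f w else 0)"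
  have gX: "g \<in> X" unfolding g_def by (rule stable_sum_projection[OF X(1) fX])
  have gs: "g w = f w" if "sum_list w = sum_list ?r" for w using that by (simp add: g_def)
  have "hw_vector l = fscale (hw_vector l ?r / f ?r) g"
  proof
    fix w
    show "hw_vector l w = fscale (hw_vector l ?r / f ?r) g w"
    proof (cases "w \<in> words ?d n")
      case True
      have lw: "length w = ?d" using True by (simp add: length_words)
      show ?thesis
      proof (cases "\<exists>q\<in>col_group l. w = permute_list q ?r")
        case True
        then obtain q where q: "q \<in> col_group l" "w = permute_list q ?r" by blast
        have "sum_list w = sum_list ?r"
          using q by (simp add: col_group_def mset_permute_list flip: sum_mset_sum_list)
        moreover have alt: "u w = of_int (sign q) * u ?r" if "col_alternating l u" for u
          using that q unfolding equivariant_def[OF is_character_sign] col_group_eq by simp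
        ultimately show ?thesis
          using alt[OF calt[OF fX]] alt[OF hw_vector_col_alternating[of l]] fr by (simp add: gs fun_app)
      next
        case False
        have zero: "u w = 0" if u: "col_alternating l u" "sum_list w = sum_list ?r \<or> u w = 0" for u
        proof (rule ccontr)
          assume uw: "u w \<noteq> 0"
          have "sum_list ?r = sum_list w" using u(2) uw by simp
          from column_distinct_sum_list(2)[OF l(1) lw col_alternating_distinct[OF u(1) lw uw] this]
          show False using False by blast
        qed
        moreover have "sum_list w = sum_list ?r \<or> hw_vector l w = 0"
          using hw_vector_support[OF _ lw] sum_mset_sum_list[of w] sum_mset_sum_list[of ?r] by auto
        moreover have "sum_list w = sum_list ?r \<or> g w = 0" by (simp add: g_def)
        ultimately show ?thesis
          using zero[OF calt[OF gX]] zero[OF hw_vector_col_alternating[of l]] by (simp add: fun_app)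
      qed
    next
      case False
      then show ?thesis
        using hw_vector_funs[OF l] gX stableD(2)[OF X(1)] by (auto simp: funs_def fun_app)
    qed
  qed
  thus ?thesis by (rule ssubst) (rule fv.subspace_scale[OF stableD(1)[OF X(1)] gX])
qed

text \<open>A proper nonzero subrepresentation and its orthogonal complement would both contain the
  highest weight vector.\<close>

lemma simple_schur_set:
  assumes l: "is_partition l" "num_rows l \<le> n"
  shows "tens.simple (sum_list l) n (schur_set l n)"
  unfolding tens_simple_iff
proof (intro conjI allI impI)
  let ?\<Omega> = "words (sum_list l) n"
  show "stable (sum_list l) n (schur_set l n)" by (rule stable_schur_set)
  show "schur_set l n \<noteq> {0}" using hw_vector_in_schur_set[OF l] hw_vector_nonzero by blast
  fix X assume X: "stable (sum_list l) n X" "X \<subseteq> schur_set l n"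
  show "X = {0} \<or> X = schur_set l n"
  proof (rule ccontr)
    assume "\<not> ?thesis"
    then obtain s where s: "s \<in> schur_set l n" "s \<notin> X" and X0: "X \<noteq> {0}" using X(2) by blast
    obtain y where y: "y \<in> X" "\<forall>k\<in>X. ip ?\<Omega> (s - y) k = 0"
      using orth_projection[OF finite_words stableD(1,2)[OF X(1)]] by blast
    let ?Y = "orth_in ?\<Omega> (schur_set l n) X"
    have "s - y \<in> ?Y"
      using s y X(2) fv.subspace_diff[OF subspace_schur_set] by (auto simp: orth_in_def)
    moreover have "s - y \<noteq> 0" using s y by auto
    ultimately have "?Y \<noteq> {0}" by blast
    moreover have "stable (sum_list l) n ?Y" by (rule stable_orth_in[OF stable_schur_set X(1)])
    moreover have "?Y \<subseteq> schur_set l n" by (auto simp: orth_in_def)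
    ultimately have "hw_vector l \<in> ?Y" "hw_vector l \<in> X"
      using hw_vector_in_subrep[OF l] X X0 by blast+
    hence "ip ?\<Omega> (hw_vector l) (hw_vector l) = 0" by (simp add: orth_in_def)
    thus False using ip_self_zero[OF finite_words hw_vector_funs[OF l]] hw_vector_nonzero by blast
  qed
qed

section \<open>Embeddings and coordinate projections\<close>

text \<open>The inclusion for \<open>n \<le> k\<close> and a coordinate projection otherwise; either
  way it fixes tensors in the common letters.\<close>

definition emb :: "nat \<Rightarrow> nat \<Rightarrow> rat mat" where
  "emb k n = mat k n (\<lambda>(i, j). if i = j then 1 else 0)"

lemma emb_carrier [simp]: "emb k n \<in> carrier_mat k n"
  by (simp add: emb_def)

lemma inclusion_mat_eq: "inclusion_mat n = emb (Suc n) n"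
  by (simp add: inclusion_mat_def emb_def)

lemma tact_emb:
  assumes "f \<in> funs (words d n)"
  shows "tact d k n (emb k n) f = (\<lambda>w. if w \<in> words d k then f w else 0)"
proof
  fix w
  show "tact d k n (emb k n) f w = (if w \<in> words d k then f w else 0)"
  proof (cases "w \<in> words d k")
    case True
    have "kern d (emb k n) w u = (if w = u then 1 else 0)" if u: "u \<in> words d n" for u
    proof (cases "w = u")
      case True
      then show ?thesis using u nth_words[OF u] nth_words[OF \<open>w \<in> words d k\<close>]
        by (auto simp: kern_def emb_def intro!: prod.neutral)
    next
      case False
      then obtain i where i: "i < d" "w ! i \<noteq> u ! i" using u True by (metis length_words nth_equalityI)
      have "emb k n $$ (w ! i, u ! i) = 0"
        using i nth_words[OF u i(1)] nth_words[OF True i(1)] by (simp add: emb_def)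
      then show ?thesis using False i(1) unfolding kern_def by (auto intro!: prod_zero bexI[of _ i])
    qed
    hence "tact d k n (emb k n) f w = (\<Sum>u\<in>words d n. if w = u then f u else 0)"
      using True by (simp add: tact_def if_distrib[of "\<lambda>c. c * f _"] cong: if_cong sum.cong)
    also have "\<dots> = f w" using assms by (auto simp: funs_def)
    finally show ?thesis using True by simp
  qed (simp add: tact_def)
qed

lemma funs_words_mono: "n \<le> k \<Longrightarrow> funs (words d n) \<subseteq> funs (words d k)"
  using words_mono[of n k d] by (auto simp: funs_def)

lemma tact_emb_fixed:
  assumes "f \<in> funs (words d n)" "f \<in> funs (words d k)"
  shows "tact d k n (emb k n) f = f"
  using assms by (auto simp: tact_emb funs_def fun_eq_iff)

text \<open>The left side is a subrepresentation of the simple right side, and it contains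
  \<open>hw_vector l\<close>, which belongs to both values of the Schur functor.\<close>

lemma gen_schur_set:
  assumes l: "is_partition l" "num_rows l \<le> n" "num_rows l \<le> k"
  shows "gen (sum_list l) n k (schur_set l n) = schur_set l k"
proof -
  have "gen (sum_list l) n k (schur_set l n) \<subseteq> schur_set l k"
    by (intro gen_minimal subspace_schur_set tact_schur_set)
  moreover have "hw_vector l \<in> gen (sum_list l) n k (schur_set l n)"
    using tact_in_gen[OF emb_carrier hw_vector_in_schur_set[OF l(1,2)]] hw_vector_funs l
    by (metis tact_emb_fixed)
  ultimately show ?thesis
    using simple_schur_set[OF l(1,3)] hw_vector_nonzero stable_gen
    unfolding tens_simple_iff by (metis singletonD)
qed

section \<open>Highest weight vectors\<close>

definition upper :: "nat \<Rightarrow> rat mat \<Rightarrow> bool" where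
  "upper n U \<longleftrightarrow> U \<in> carrier_mat n n \<and> (\<forall>i<n. U $$ (i, i) = 1) \<and> (\<forall>i<n. \<forall>j<i. U $$ (i, j) = 0)"

definition hwv :: "nat \<Rightarrow> nat \<Rightarrow> (nat \<Rightarrow> nat) \<Rightarrow> (nat list \<Rightarrow> rat) \<Rightarrow> bool" where
  "hwv d n \<mu> f \<longleftrightarrow> f \<in> funs (words d n) \<and> f \<noteq> 0 \<and>
     (\<forall>w. f w \<noteq> 0 \<longrightarrow> (\<forall>i<n. count_list w i = \<mu> i)) \<and>
     (\<forall>U. upper n U \<longrightarrow> tact d n n U f = f)"

text \<open>Entries below the diagonal vanish, so every letter of \<open>w\<close> is at most the
  letter of \<open>u\<close> at the same place.\<close>

lemma upper_kern_sum_list: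
  assumes U: "upper n U" and w: "w \<in> words d n" "u \<in> words d n" and ne: "w \<noteq> u" "kern d U w u \<noteq> 0"
  shows "sum_list w < sum_list u"
proof -
  have le: "w ! k \<le> u ! k" if k: "k < d" for k
  proof (rule ccontr)
    assume "\<not> ?thesis"
    hence "U $$ (w ! k, u ! k) = 0" using U nth_words[OF w(1) k] by (auto simp: upper_def)
    hence "kern d U w u = 0" unfolding kern_def using k by (auto intro!: prod_zero)
    thus False using ne by simp
  qed
  obtain k where "k < d" "w ! k \<noteq> u ! k" using ne w by (metis length_words nth_equalityI)
  hence "\<exists>k\<in>{..<d}. w ! k < u ! k" using le le_neq_implies_less by blast
  hence "(\<Sum>k<d. w ! k) < (\<Sum>k<d. u ! k)" using le by (intro sum_strict_mono_ex1) auto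
  thus ?thesis using length_words[OF w(1)] length_words[OF w(2)] by (simp add: sum_list_sum_nth atLeast0LessThan)
qed

text \<open>A unitriangular matrix acts as the identity plus terms of strictly smaller letter
  sum.\<close>

lemma upper_tact_lowers:
  assumes U: "upper n U" and f: "f \<in> funs (words d n)" "\<And>u. f u \<noteq> 0 \<Longrightarrow> sum_list u = s"
    and w: "tact d n n U f w \<noteq> f w"
  shows "sum_list w < s"
proof (rule ccontr)
  assume s: "\<not> sum_list w < s"
  have ww: "w \<in> words d n"
  proof (rule ccontr)
    assume "w \<notin> words d n"
    thus False using w f(1) by (simp add: tact_def funs_def)
  qed
  have "(\<Sum>u\<in>words d n. kern d U w u * f u) = (\<Sum>u\<in>words d n. if w = u then f u else 0)"
  proof (rule sum.cong[OF refl])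
    fix u assume u: "u \<in> words d n"
    show "kern d U w u * f u = (if w = u then f u else 0)"
    proof (cases "w = u")
      case True
      have "kern d U w w = 1"
        using U nth_words[OF ww] by (auto simp: kern_def upper_def intro!: prod.neutral)
      then show ?thesis using True by simp
    next
      case False
      then show ?thesis using upper_kern_sum_list[OF U ww u] f(2)[of u] s by auto
    qed
  qed
  also have "\<dots> = f w" using ww by simp
  finally show False using w ww by (simp add: tact_def)
qed

lemma sum_list_indicator: "sum_list (map (\<lambda>j. if j = i then 1 else 0) w) = count_list w i"
  by (induction w) auto

lemma tact_relabel:
  assumes \<tau>: "\<And>a. a < n \<Longrightarrow> \<tau> a < n" and w: "w \<in> words d n"
  shows "tact d n n (mat n n (\<lambda>(a, b). if b = \<tau> a then 1 else 0)) f w = f (map \<tau> w)"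
proof -
  let ?M = "mat n n (\<lambda>(a, b). if b = \<tau> a then 1 else 0) :: rat mat"
  have mw: "map \<tau> w \<in> words d n" using w \<tau> by (auto simp: words_def)
  have "kern d ?M w u = (if map \<tau> w = u then 1 else 0)" if u: "u \<in> words d n" for u
  proof (cases "map \<tau> w = u")
    case True
    have "?M $$ (w ! k, u ! k) = 1" if k: "k < d" for k
      using nth_words[OF w k] nth_words[OF u k] True k length_words[OF w] by auto
    then show ?thesis using True by (simp add: kern_def)
  next
    case False
    then obtain k where k: "k < d" "map \<tau> w ! k \<noteq> u ! k" using u mw by (metis length_words nth_equalityI)
    hence "?M $$ (w ! k, u ! k) = 0"
      using nth_words[OF w k(1)] nth_words[OF u k(1)] length_words[OF w] by auto
    then show ?thesis using False k(1) unfolding kern_def by (auto intro!: prod_zero bexI[of _ k])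
  qed
  hence "tact d n n ?M f w = (\<Sum>u\<in>words d n. if map \<tau> w = u then f u else 0)"
    using w by (simp add: tact_def if_distrib[of "\<lambda>c. c * f _"] cong: if_cong sum.cong)
  thus ?thesis using mw by simp
qed

lemma sum_list_map_transpose_Suc:
  "sum_list (map (transpose i (Suc i)) w) + count_list w (Suc i) = sum_list w + count_list w i"
  by (induction w) (auto simp: transpose_def)

text \<open>Take the least letter sum \<open>s\<close> of a word \<open>w0\<close> at which some
  element of \<open>W\<close> is nonzero, and project that element to the weight of
  \<open>w0\<close>. A unitriangular matrix can change the result only at letter sums below
  \<open>s\<close>, where all of \<open>W\<close> vanishes.\<close>

lemma hwv_exists:
  assumes W: "stable d n W" "W \<noteq> {0}"
  obtains f \<mu> where "f \<in> W" "hwv d n (nth \<mu>) f" "is_partition \<mu>" "length \<mu> = n" "sum_list \<mu> = d"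
proof -
  define Q where "Q s \<longleftrightarrow> (\<exists>x\<in>W. \<exists>w. x w \<noteq> 0 \<and> sum_list w = s)" for s
  obtain x0 where "x0 \<in> W" "x0 \<noteq> 0" using W stableD(4) by blast
  then obtain w1 where "x0 w1 \<noteq> 0" by (auto simp: fun_eq_iff zero_fun_apply)
  hence ex: "\<exists>s. Q s" unfolding Q_def using \<open>x0 \<in> W\<close> by blast
  define s where "s = (LEAST s. Q s)"
  have Qs: "Q s" unfolding s_def using ex by (rule LeastI_ex)
  have min: "x w = 0" if "x \<in> W" "sum_list w < s" for x w
  proof (rule ccontr)
    assume "x w \<noteq> 0"
    hence "Q (sum_list w)" unfolding Q_def using that(1) by blast
    moreover have "\<not> Q (sum_list w)"
      by (rule not_less_Least) (use that(2) in \<open>simp only: s_def\<close>)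
    ultimately show False by contradiction
  qed
  obtain x w0 where x: "x \<in> W" "x w0 \<noteq> 0" "sum_list w0 = s" using Qs by (auto simp: Q_def)
  have w0: "w0 \<in> words d n" using x(1,2) stableD(2)[OF W(1)] by (auto simp: funs_def)
  \<comment> \<open>The weight is fixed one letter count at a time, the sum projection being applied
    to the indicator of the letter \<open>m\<close>.\<close>
  have "\<exists>f\<in>W. f w0 \<noteq> 0 \<and> (\<forall>w. f w \<noteq> 0 \<longrightarrow> sum_list w = s \<and> (\<forall>i<m. count_list w i = count_list w0 i))" for m
  proof (induction m)
    case 0
    have "(\<lambda>w. if sum_list (map (\<lambda>i. i) w) = s then x w else 0) \<in> W"
      by (rule stable_sum_projection[OF W(1) x(1)])
    then show ?case using x by (intro bexI) auto
  next
    case (Suc m)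
    then obtain f where f: "f \<in> W" "f w0 \<noteq> 0"
      "\<And>w. f w \<noteq> 0 \<Longrightarrow> sum_list w = s \<and> (\<forall>i<m. count_list w i = count_list w0 i)" by blast
    define f' where "f' = (\<lambda>w. if count_list w m = count_list w0 m then f w else 0)"
    have "f' \<in> W"
      unfolding f'_def sum_list_indicator[symmetric] by (rule stable_sum_projection[OF W(1) f(1)])
    moreover have "f' w0 \<noteq> 0" using f(2) by (simp add: f'_def)
    moreover have "sum_list w = s \<and> (\<forall>i<Suc m. count_list w i = count_list w0 i)" if "f' w \<noteq> 0" for w
    proof -
      have "count_list w m = count_list w0 m" "f w \<noteq> 0" using that by (auto simp: f'_def split: if_splits)
      thus ?thesis using f(3)[of w] less_Suc_eq by auto
    qed
    ultimately show ?case by blast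
  qed
  then obtain f where f: "f \<in> W" "f w0 \<noteq> 0"
    "\<And>w. f w \<noteq> 0 \<Longrightarrow> sum_list w = s" "\<And>w i. f w \<noteq> 0 \<Longrightarrow> i < n \<Longrightarrow> count_list w i = count_list w0 i" by blast
  have ff: "f \<in> funs (words d n)" using f(1) stableD(2)[OF W(1)] by blast
  define \<mu> where "\<mu> = map (count_list w0) [0..<n]"
  have "tact d n n U f = f" if U: "upper n U" for U
  proof
    fix w
    have tW: "tact d n n U f \<in> W" using stableD(3)[OF W(1) _ f(1)] U by (simp add: upper_def)
    show "tact d n n U f w = f w"
    proof (rule ccontr)
      assume ne: "tact d n n U f w \<noteq> f w"
      have "sum_list w < s" by (rule upper_tact_lowers[OF U ff f(3) ne])
      thus False using min tW f(1) ne by metis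
    qed
  qed
  hence "hwv d n (nth \<mu>) f"
    unfolding hwv_def
  proof (intro conjI allI impI)
    show "f \<noteq> 0" using f(2) by (auto simp: zero_fun_apply)
    fix w i assume "f w \<noteq> 0" "i < n"
    moreover from this have "count_list w i = count_list w0 i" by (rule f(4))
    ultimately show "count_list w i = \<mu> ! i" by (simp add: \<mu>_def)
  qed (use ff in auto)
  moreover have "sum_list \<mu> = d"
    using sum_count_set[of w0 "{..<n}"] w0
    by (simp add: \<mu>_def words_def interv_sum_list_conv_sum_set_nat atLeast0LessThan)
  moreover have "is_partition \<mu>"
    unfolding is_partition_def
  proof (subst sorted_wrt_iff_nth_Suc_transp)
    show "transp ((\<ge>) :: nat \<Rightarrow> nat \<Rightarrow> bool)" by (auto intro: transpI)
    show "\<forall>i. Suc i < length \<mu> \<longrightarrow> \<mu> ! i \<ge> \<mu> ! Suc i"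
    proof (intro allI impI)
      fix i assume i: "Suc i < length \<mu>"
      hence i': "Suc i < n" by (simp add: \<mu>_def)
      let ?\<tau> = "transpose i (Suc i)"
      have \<tau>n: "?\<tau> a < n" if "a < n" for a using that i' by (auto simp: transpose_def)
      let ?M = "mat n n (\<lambda>(a, b). if b = ?\<tau> a then 1 else 0) :: rat mat"
      have mw: "map ?\<tau> w0 \<in> words d n" using w0 \<tau>n by (auto simp: words_def)
      \<comment> \<open>Exchanging the letters \<open>i\<close> and \<open>Suc i\<close> moves the
        coefficient of \<open>w0\<close> to a word whose letter sum exceeds \<open>s\<close> by the
        count of \<open>i\<close> minus the count of \<open>Suc i\<close>. Minimality of
        \<open>s\<close> makes this difference nonnegative.\<close>
      have "tact d n n ?M f (map ?\<tau> w0) = f (map ?\<tau> (map ?\<tau> w0))" by (rule tact_relabel[OF \<tau>n mw])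
      also have "map ?\<tau> (map ?\<tau> w0) = w0" by (simp add: o_def)
      finally have "tact d n n ?M f (map ?\<tau> w0) \<noteq> 0" using f(2) by simp
      moreover have "tact d n n ?M f \<in> W" by (rule stableD(3)[OF W(1) _ f(1)]) simp
      ultimately have "\<not> sum_list (map ?\<tau> w0) < s" using min by blast
      hence "count_list w0 (Suc i) \<le> count_list w0 i"
        using sum_list_map_transpose_Suc[of i w0] x(3) by linarith
      thus "\<mu> ! i \<ge> \<mu> ! Suc i" using i' by (simp add: \<mu>_def)
    qed
  qed
  ultimately show ?thesis using that f(1) by (simp add: \<mu>_def)
qed

lemma count_list_concat: "count_list (concat xss) i = sum_list (map (\<lambda>xs. count_list xs i) xss)"
  by (induction xss) auto

lemma count_list_replicate: "count_list (replicate k a) i = (if a = i then k else 0)"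
  by (induction k) auto

lemma count_list_row_word: "i < length l \<Longrightarrow> count_list (row_word l) i = l ! i"
proof -
  assume i: "i < length l"
  have "count_list (row_word l) i = sum_list (map (\<lambda>k. if k = i then l ! k else 0) [0..<length l])"
    by (simp add: row_word_def cells_def map_concat o_def count_list_concat map_replicate_const
        count_list_replicate cong: map_cong if_cong)
  also have "\<dots> = l ! i"
    using i by (simp add: interv_sum_list_conv_sum_set_nat)
  finally show ?thesis .
qed

lemma mset_count_list: "mset w = mset u \<Longrightarrow> count_list w i = count_list u i"
  by (metis count_mset)

text \<open>The change caused by a unitriangular matrix lies in the Schur set and lives at letter
  sums below that of the row word. Column-alternating tensors vanish there by
  \<open>column_distinct_sum_list\<close>.\<close>

lemma hwv_hw_vector:
  assumes l: "is_partition l" "length l = n"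
  shows "hwv (sum_list l) n (nth l) (hw_vector l)"
proof -
  have nr: "num_rows l \<le> n" using l(2) by (auto simp: num_rows_def)
  note vf = hw_vector_funs[OF l(1) nr]
  have supp: "mset w = mset (row_word l)" if "hw_vector l w \<noteq> 0" for w
    using hw_vector_support[OF that] vf that length_words[of w] by (auto simp: funs_def)
  have "tact (sum_list l) n n U (hw_vector l) = hw_vector l" if U: "upper n U" for U
  proof
    fix w
    let ?t = "tact (sum_list l) n n U (hw_vector l)"
    show "?t w = hw_vector l w"
    proof (rule ccontr)
      assume ne: "?t w \<noteq> hw_vector l w"
      have "sum_list u = sum_list (row_word l)" if "hw_vector l u \<noteq> 0" for u
        using supp[OF that] by (metis sum_mset_sum_list)
      from upper_tact_lowers[OF U vf this ne] have less: "sum_list w < sum_list (row_word l)" .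
      have tS: "?t - hw_vector l \<in> schur_set l n"
        using fv.subspace_diff[OF subspace_schur_set] tact_schur_set hw_vector_in_schur_set[OF l(1) nr] by blast
      have "w \<in> words (sum_list l) n"
      proof (rule ccontr)
        assume "w \<notin> words (sum_list l) n"
        thus False using ne vf by (simp add: tact_def funs_def)
      qed
      hence lw: "length w = sum_list l" by (rule length_words)
      have "(?t - hw_vector l) w \<noteq> 0" using ne by (simp add: fun_app)
      note dist = col_alternating_distinct[OF schur_set_col_alternating[OF tS] lw this]
      have "sum_list (row_word l) \<le> sum_list w"
        by (rule column_distinct_sum_list(1)[OF l(1) lw]) (rule dist)
      thus False using less by linarith
    qed
  qed
  moreover have "count_list w i = l ! i" if "hw_vector l w \<noteq> 0" "i < n" for w i
  proof -
    have "count_list w i = count_list (row_word l) i" by (rule mset_count_list[OF supp[OF that(1)]])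
    also have "\<dots> = l ! i" by (rule count_list_row_word) (use that(2) l(2) in simp)
    finally show ?thesis .
  qed
  ultimately show ?thesis unfolding hwv_def by (intro conjI allI impI vf hw_vector_nonzero)
qed

lemma prod_nth_eq_prod_count:
  fixes w :: "nat list"
  assumes "set w \<subseteq> {..<n}"
  shows "(\<Prod>k<length w. x (w ! k)) = (\<Prod>i<n. (x i :: rat) ^ count_list w i)"
  using assms
proof (induction w)
  case (Cons a w)
  have "(\<Prod>i<n. x i ^ count_list (a # w) i) = (\<Prod>i<n. (if a = i then x i else 1) * x i ^ count_list w i)"
    by (rule prod.cong) auto
  also have "\<dots> = x a * (\<Prod>i<n. x i ^ count_list w i)"
  proof -
    have "(\<Prod>i<n. if a = i then x i else 1) = x a"
      by (subst prod.delta') (use Cons.prems in auto)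
    thus ?thesis by (simp only: prod.distrib)
  qed
  finally show ?case using Cons by (simp add: prod.lessThan_Suc_shift del: prod.lessThan_Suc)
qed simp

lemma hwv_diagm:
  assumes f: "hwv d n \<mu> f"
  shows "tact d n n (diagm n x) f = fscale (\<Prod>i<n. x i ^ \<mu> i) f"
proof
  fix w
  have ff: "f \<in> funs (words d n)" using f by (simp add: hwv_def)
  show "tact d n n (diagm n x) f w = fscale (\<Prod>i<n. x i ^ \<mu> i) f w"
  proof (cases "f w = 0")
    case False
    hence w: "w \<in> words d n" using ff by (auto simp: funs_def)
    hence "(\<Prod>k<d. x (w ! k)) = (\<Prod>i<n. x i ^ count_list w i)"
      using prod_nth_eq_prod_count[of w n x] by (simp add: words_def)
    also have "\<dots> = (\<Prod>i<n. x i ^ \<mu> i)" using f False by (simp add: hwv_def)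
    finally show ?thesis by (simp add: tact_diagm[OF ff] fun_app)
  qed (simp add: tact_diagm[OF ff] fun_app)
qed

section \<open>Matrix coefficients and Gaussian elimination\<close>

text \<open>The diagonal matrix coefficient of \<open>f\<close>. The power of the determinant raises
  every part of the weight by \<open>k\<close>, as the twist in \<open>V_rep\<close> does.\<close>

definition mcoeff :: "nat \<Rightarrow> nat \<Rightarrow> nat \<Rightarrow> (nat list \<Rightarrow> rat) \<Rightarrow> rat mat \<Rightarrow> rat" where
  "mcoeff k d n f M = det M ^ k * ip (words d n) f (tact d n n M f)"

lemma det_upper: "upper n U \<Longrightarrow> det U = 1"
proof -
  assume U: "upper n U"
  hence "det U = prod_list (diag_mat U)"
    by (intro det_upper_triangular[of _ n]) (auto simp: upper_def upper_triangular_def)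
  also have "diag_mat U = map (\<lambda>_. 1) [0..<n]"
    using U by (auto simp: diag_mat_def upper_def)
  also have "prod_list \<dots> = 1" by (induction n) auto
  finally show ?thesis .
qed

lemma mcoeff_upper_right:
  assumes "hwv d n \<mu> f" "upper n U" "M \<in> carrier_mat n n"
  shows "mcoeff k d n f (M * U) = mcoeff k d n f M"
proof -
  have U: "U \<in> carrier_mat n n" "tact d n n U f = f" using assms by (auto simp: hwv_def upper_def)
  have "tact d n n (M * U) f = tact d n n M f" using tact_mult[OF assms(3) U(1), of d f] U(2) by simp
  moreover have "det (M * U) = det M" using det_mult[OF assms(3) U(1)] det_upper[OF assms(2)] by simp
  ultimately show ?thesis by (simp add: mcoeff_def)
qed

lemma mcoeff_upper_left:
  assumes "hwv d n \<mu> f" "upper n U" "M \<in> carrier_mat n n"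
  shows "mcoeff k d n f (transpose_mat U * M) = mcoeff k d n f M"
proof -
  have U: "U \<in> carrier_mat n n" "transpose_mat U \<in> carrier_mat n n" "tact d n n U f = f"
    using assms by (auto simp: hwv_def upper_def)
  have "ip (words d n) f (tact d n n (transpose_mat U * M) f)
      = ip (words d n) f (tact d n n (transpose_mat U) (tact d n n M f))"
    by (simp add: tact_mult[OF U(2) assms(3)])
  also have "\<dots> = ip (words d n) (tact d n n U f) (tact d n n M f)" by (rule ip_tact[OF U(1), symmetric])
  finally have "ip (words d n) f (tact d n n (transpose_mat U * M) f) = ip (words d n) f (tact d n n M f)"
    by (simp add: U(3))
  moreover have "det (transpose_mat U * M) = det M"
    using det_mult[OF U(2) assms(3)] det_upper[OF assms(2)] det_transpose[OF U(1)] by simp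
  ultimately show ?thesis by (simp add: mcoeff_def)
qed

definition polyfun :: "(rat \<Rightarrow> rat) \<Rightarrow> bool" where
  "polyfun F \<longleftrightarrow> (\<exists>p. \<forall>t. F t = poly p t)"

lemma polyfun_const: "polyfun (\<lambda>_. c)"
  unfolding polyfun_def by (intro exI[of _ "[:c:]"]) simp

lemma polyfun_affine: "polyfun (\<lambda>t. a + t * b)"
  unfolding polyfun_def by (intro exI[of _ "[:a, b:]"]) simp

lemma polyfun_add: "polyfun F \<Longrightarrow> polyfun G \<Longrightarrow> polyfun (\<lambda>t. F t + G t)"
  unfolding polyfun_def by (metis poly_add)

lemma polyfun_mult: "polyfun F \<Longrightarrow> polyfun G \<Longrightarrow> polyfun (\<lambda>t. F t * G t)"
  unfolding polyfun_def by (metis poly_mult)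

lemma polyfun_diff: "polyfun F \<Longrightarrow> polyfun G \<Longrightarrow> polyfun (\<lambda>t. F t - G t)"
  unfolding polyfun_def by (metis poly_diff)

lemma polyfun_power: "polyfun F \<Longrightarrow> polyfun (\<lambda>t. F t ^ k)"
  unfolding polyfun_def by (metis poly_power)

lemma polyfun_sum: "(\<And>i. i \<in> A \<Longrightarrow> polyfun (F i)) \<Longrightarrow> polyfun (\<lambda>t. \<Sum>i\<in>A. F i t)"
  by (induction A rule: infinite_finite_induct) (auto intro: polyfun_const polyfun_add)

lemma polyfun_prod: "(\<And>i. i \<in> A \<Longrightarrow> polyfun (F i)) \<Longrightarrow> polyfun (\<lambda>t. \<Prod>i\<in>A. F i t)"
  by (induction A rule: infinite_finite_induct) (auto intro: polyfun_const polyfun_mult)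

lemma polyfun_zero:
  assumes "polyfun F" "\<And>t. t \<noteq> 0 \<Longrightarrow> F t = 0"
  shows "F 0 = 0"
proof -
  obtain p where p: "\<And>t. F t = poly p t" using assms(1) by (auto simp: polyfun_def)
  have "p = 0"
  proof (rule ccontr)
    assume "p \<noteq> 0"
    hence "finite {t. poly p t = 0}" by (rule poly_roots_finite)
    moreover have "- {0} \<subseteq> {t. poly p t = 0}" using assms(2) p by auto
    ultimately have "finite (- {0 :: rat})" by (rule rev_finite_subset)
    hence "finite (UNIV :: rat set)" by (simp add: finite_compl)
    thus False using infinite_UNIV_char_0[where 'a = rat] by blast
  qed
  thus ?thesis using p by simp
qed

lemma polyfun_mcoeff:
  assumes M: "M \<in> carrier_mat n n" "E \<in> carrier_mat n n"
  shows "polyfun (\<lambda>t. mcoeff k d n f (M + t \<cdot>\<^sub>m E))"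
proof -
  have entry: "(M + t \<cdot>\<^sub>m E) $$ (i, j) = M $$ (i, j) + t * E $$ (i, j)" if "i < n" "j < n" for i j t
    using M that by simp
  have "polyfun (\<lambda>t. det (M + t \<cdot>\<^sub>m E))"
  proof -
    have "det (M + t \<cdot>\<^sub>m E) = (\<Sum>p\<in>{p. p permutes {0..<n}}. signof p * (\<Prod>i\<in>{0..<n}. M $$ (i, p i) + t * E $$ (i, p i)))" for t
      unfolding det_def'[of "M + t \<cdot>\<^sub>m E" n, OF add_carrier_mat[OF smult_carrier_mat[OF M(2)]]]
    proof (intro sum.cong refl)
      fix p assume p: "p \<in> {p. p permutes {0..<n}}"
      have "p i < n" if "i < n" for i using p that permutes_in_image[of p "{0..<n}" i] by auto
      hence "(\<Prod>i = 0..<n. (M + t \<cdot>\<^sub>m E) $$ (i, p i)) = (\<Prod>i = 0..<n. M $$ (i, p i) + t * E $$ (i, p i))"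
        by (intro prod.cong) (auto simp: entry simp del: index_add_mat)
      thus "signof p * (\<Prod>i = 0..<n. (M + t \<cdot>\<^sub>m E) $$ (i, p i))
        = signof p * (\<Prod>i = 0..<n. M $$ (i, p i) + t * E $$ (i, p i))" by simp
    qed
    thus ?thesis by (simp only:) (intro polyfun_sum polyfun_mult polyfun_const polyfun_prod polyfun_affine)
  qed
  moreover have "polyfun (\<lambda>t. ip (words d n) f (tact d n n (M + t \<cdot>\<^sub>m E) f))"
  proof -
    have "ip (words d n) f (tact d n n (M + t \<cdot>\<^sub>m E) f) = (\<Sum>w\<in>words d n. f w * (\<Sum>u\<in>words d n.
        (\<Prod>i<d. M $$ (w ! i, u ! i) + t * E $$ (w ! i, u ! i)) * f u))" for t
      unfolding ip_def tact_def kern_def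
      by (intro sum.cong refl) (use nth_words in \<open>auto simp: entry intro!: sum.cong prod.cong simp del: index_add_mat\<close>)
    thus ?thesis
      by (simp only:) (intro polyfun_sum polyfun_mult polyfun_const polyfun_prod polyfun_affine)
  qed
  ultimately show ?thesis unfolding mcoeff_def by (intro polyfun_mult polyfun_power)
qed

text \<open>Multiplication on the right adds multiples of column \<open>p\<close> to the later
  columns; the transpose on the left does the same for rows.\<close>

definition elim_mat :: "nat \<Rightarrow> nat \<Rightarrow> (nat \<Rightarrow> rat) \<Rightarrow> rat mat" where
  "elim_mat n p c = mat n n (\<lambda>(a, i). (if a = i then 1 else 0) + (if a = p \<and> p < i then c i else 0))"

lemma upper_elim_mat: "upper n (elim_mat n p c)"
  by (auto simp: upper_def elim_mat_def)

lemma mult_elim_mat: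
  assumes M: "M \<in> carrier_mat n n" and "p < n" "i < n" "j < n"
  shows "(M * elim_mat n p c) $$ (i, j) = M $$ (i, j) + (if p < j then M $$ (i, p) * c j else 0)"
proof -
  have "(M * elim_mat n p c) $$ (i, j)
    = (\<Sum>a<n. M $$ (i, a) * ((if a = j then 1 else 0) + (if a = p \<and> p < j then c j else 0)))"
    using assms by (simp add: scalar_prod_def atLeast0LessThan elim_mat_def)
  also have "\<dots> = (\<Sum>a<n. (if a = j then M $$ (i, a) else 0) + (if a = p then (if p < j then M $$ (i, a) * c j else 0) else 0))"
    by (rule sum.cong) auto
  also have "\<dots> = M $$ (i, j) + (if p < j then M $$ (i, p) * c j else 0)"
    using assms by (simp add: sum.distrib)
  finally show ?thesis .
qed

lemma transpose_elim_mat_mult: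
  assumes M: "M \<in> carrier_mat n n" and "p < n" "i < n" "j < n"
  shows "(transpose_mat (elim_mat n p c) * M) $$ (i, j) = M $$ (i, j) + (if p < i then c i * M $$ (p, j) else 0)"
proof -
  have c: "elim_mat n p c \<in> carrier_mat n n" by (simp add: elim_mat_def)
  have "transpose_mat (elim_mat n p c) * M = transpose_mat (transpose_mat M * elim_mat n p c)"
    using transpose_mult[of "transpose_mat M" n n "elim_mat n p c" n] M c by simp
  moreover have "(transpose_mat M * elim_mat n p c) \<in> carrier_mat n n" using M c by auto
  ultimately have "(transpose_mat (elim_mat n p c) * M) $$ (i, j) = (transpose_mat M * elim_mat n p c) $$ (j, i)"
    using assms by auto
  also have "\<dots> = M $$ (i, j) + (if p < i then M $$ (p, j) * c i else 0)"
    using mult_elim_mat[of "transpose_mat M" n p j i c] assms by auto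
  finally show ?thesis by (simp add: mult.commute)
qed

text \<open>Gaussian elimination by unitriangular matrices, which do not change \<open>G\<close>. A vanishing pivot is
  perturbed; this is where polynomiality enters.\<close>

lemma vanishes_by_elimination:
  fixes G :: "rat mat \<Rightarrow> rat"
  assumes right: "\<And>M U. M \<in> carrier_mat n n \<Longrightarrow> upper n U \<Longrightarrow> G (M * U) = G M"
    and left: "\<And>M U. M \<in> carrier_mat n n \<Longrightarrow> upper n U \<Longrightarrow> G (transpose_mat U * M) = G M"
    and poly: "\<And>M E. M \<in> carrier_mat n n \<Longrightarrow> E \<in> carrier_mat n n \<Longrightarrow> polyfun (\<lambda>t. G (M + t \<cdot>\<^sub>m E))"
    and diag: "\<And>x. G (diagm n x) = 0"
    and "M \<in> carrier_mat n n"
  shows "G M = 0"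
proof -
  \<comment> \<open>Off the diagonal, the first \<open>q\<close> rows and columns are already
    cleared. The induction runs over the number of rows that remain.\<close>
  define D where "D q M \<longleftrightarrow> M \<in> carrier_mat n n \<and>
    (\<forall>i<n. \<forall>j<n. i \<noteq> j \<longrightarrow> i < q \<or> j < q \<longrightarrow> M $$ (i, j) = 0)" for q and M :: "rat mat"
  have "G M = 0" if "k \<le> n" "D (n - k) M" for k M
    using that
  proof (induction k arbitrary: M)
    case 0
    have "M = diagm n (\<lambda>i. M $$ (i, i))" using 0(2) by (intro eq_matI) (auto simp: D_def diagm_def)
    thus ?case using diag by metis
  next
    case (Suc k)
    define p where "p = n - Suc k"
    have p: "p < n" "n - k = Suc p" using Suc.prems(1) by (auto simp: p_def)
    have pivot: "G N = 0" if N: "D p N" and nz: "N $$ (p, p) \<noteq> 0" for N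
    proof -
      have Nc: "N \<in> carrier_mat n n" using N by (simp add: D_def)
      \<comment> \<open>\<open>V\<close> clears column \<open>p\<close> below the pivot,
        \<open>U\<close> clears row \<open>p\<close> to the right of it; the rows and columns before
        \<open>p\<close> are not disturbed.\<close>
      define V where "V = elim_mat n p (\<lambda>i. - N $$ (i, p) / N $$ (p, p))"
      define U where "U = elim_mat n p (\<lambda>j. - N $$ (p, j) / N $$ (p, p))"
      have up: "upper n V" "upper n U" by (simp_all add: V_def U_def upper_elim_mat)
      define N1 where "N1 = transpose_mat V * N"
      have N1c: "N1 \<in> carrier_mat n n" using up Nc by (auto simp: N1_def upper_def)
      have N1e: "N1 $$ (i, j) = N $$ (i, j) + (if p < i then - N $$ (i, p) / N $$ (p, p) * N $$ (p, j) else 0)"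
        if "i < n" "j < n" for i j
        unfolding N1_def V_def using transpose_elim_mat_mult[OF Nc p(1) that] by simp
      have N2e: "(N1 * U) $$ (i, j) = N1 $$ (i, j) + (if p < j then N1 $$ (i, p) * (- N $$ (p, j) / N $$ (p, p)) else 0)"
        if "i < n" "j < n" for i j
        unfolding U_def by (rule mult_elim_mat[OF N1c p(1) that])
      have off: "N $$ (i, j) = 0" if "i < n" "j < n" "i \<noteq> j" "i < p \<or> j < p" for i j
        using N that by (auto simp: D_def)
      have "(N1 * U) $$ (i, j) = 0" if ij: "i < n" "j < n" "i \<noteq> j" "i < Suc p \<or> j < Suc p" for i j
      proof -
        consider "i < p" | "j < p" "p \<le> i" | "i = p" "p < j" | "j = p" "p < i" using ij by linarith
        thus ?thesis
        proof cases
          case 1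
          thus ?thesis using ij p off[of i j] off[of i p] by (simp add: N2e N1e)
        next
          case 2
          thus ?thesis using ij p off[of i j] off[of p j] by (auto simp: N2e N1e)
        next
          case 3
          thus ?thesis using ij p nz by (simp add: N2e N1e)
        next
          case 4
          thus ?thesis using ij p nz by (simp add: N2e N1e)
        qed
      qed
      moreover have "N1 * U \<in> carrier_mat n n" using N1c up by (auto simp: upper_def)
      ultimately have "D (n - k) (N1 * U)" by (auto simp: D_def p(2))
      hence "G (N1 * U) = 0" using Suc.IH Suc.prems(1) by simp
      thus ?thesis using right[OF N1c up(2)] left[OF Nc up(1)] by (simp add: N1_def)
    qed
    have MD: "D p M" using Suc.prems(2) by (simp add: p_def)
    have Mc: "M \<in> carrier_mat n n" using MD by (simp add: D_def)
    show ?case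
    proof (cases "M $$ (p, p) = 0")
      case False
      thus ?thesis by (rule pivot[OF MD])
    next
      case True
      define E where "E = mat n n (\<lambda>(i, j). if i = p \<and> j = p then 1 else 0 :: rat)"
      have Ec: "E \<in> carrier_mat n n" by (simp add: E_def)
      have "G (M + t \<cdot>\<^sub>m E) = 0" if "t \<noteq> 0" for t
      proof (rule pivot)
        show "D p (M + t \<cdot>\<^sub>m E)" using MD Ec by (auto simp: D_def E_def)
        show "(M + t \<cdot>\<^sub>m E) $$ (p, p) \<noteq> 0" using Mc Ec p(1) True that by (simp add: E_def)
      qed
      from polyfun_zero[OF poly[OF Mc Ec] this] have "G (M + 0 \<cdot>\<^sub>m E) = 0" by simp
      moreover have "M + 0 \<cdot>\<^sub>m E = M" using Mc Ec by (intro eq_matI) auto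
      ultimately show ?thesis by simp
    qed
  qed
  from this[of n M] show ?thesis using assms(5) by (simp add: D_def)
qed

lemma det_diagm: "det (diagm n x) = (\<Prod>i<n. x i)"
proof -
  have "det (diagm n x) = prod_list (diag_mat (diagm n x))"
    by (rule det_upper_triangular[of _ n]) (auto simp: diagm_def upper_triangular_def)
  also have "diag_mat (diagm n x) = map x [0..<n]"
    by (auto simp: diag_mat_def diagm_def)
  finally show ?thesis by (simp add: prod.distinct_set_conv_list[symmetric] atLeast0LessThan)
qed

text \<open>The difference \<open>G\<close> of the two sides satisfies the hypotheses of the
  elimination lemma. On a diagonal matrix each coefficient is the monomial of its weight times a
  norm, and the determinant supplies the shift by \<open>k\<close>; cross-multiplying by the norms
  makes the two sides cancel.\<close>

lemma mcoeff_proportional: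
  assumes f: "hwv d n \<mu> f" and v: "hwv d' n \<nu> v" and k: "\<And>i. i < n \<Longrightarrow> \<mu> i = \<nu> i + k"
    and M: "M \<in> carrier_mat n n"
  shows "mcoeff 0 d n f M * ip (words d' n) v v = mcoeff k d' n v M * ip (words d n) f f"
proof -
  define G where "G M = mcoeff 0 d n f M * ip (words d' n) v v - mcoeff k d' n v M * ip (words d n) f f" for M
  have "G M = 0"
  proof (rule vanishes_by_elimination[OF _ _ _ _ M])
    fix M U :: "rat mat" assume "M \<in> carrier_mat n n" "upper n U"
    thus "G (M * U) = G M" "G (transpose_mat U * M) = G M"
      using mcoeff_upper_right[OF f] mcoeff_upper_right[OF v] mcoeff_upper_left[OF f] mcoeff_upper_left[OF v]
      by (simp_all add: G_def)
  next
    fix M E :: "rat mat" assume "M \<in> carrier_mat n n" "E \<in> carrier_mat n n"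
    thus "polyfun (\<lambda>t. G (M + t \<cdot>\<^sub>m E))"
      unfolding G_def by (intro polyfun_diff polyfun_mult polyfun_const polyfun_mcoeff)
  next
    fix x :: "nat \<Rightarrow> rat"
    have "(\<Prod>i<n. x i ^ \<mu> i) = (\<Prod>i<n. x i) ^ k * (\<Prod>i<n. x i ^ \<nu> i)"
      unfolding prod_power_distrib prod.distrib[symmetric]
      by (rule prod.cong) (auto simp: k power_add mult.commute)
    thus "G (diagm n x) = 0"
      by (simp add: G_def mcoeff_def hwv_diagm[OF f] hwv_diagm[OF v] ip_scale_right det_diagm)
  qed
  thus ?thesis by (simp add: G_def)
qed

text \<open>The Gram matrices of \<open>{M f}\<close> and \<open>{det M ^ k M v}\<close> are proportional, so \<open>f\<close> and \<open>v\<close> generate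
  isomorphic representations.\<close>

lemma hwv_iso:
  assumes f: "hwv d n \<mu> f" and v: "hwv d' n \<nu> v" and k: "\<And>i. i < n \<Longrightarrow> \<mu> i = \<nu> i + k"
    and W: "tens.simple d n W" "f \<in> W" and W': "tens.simple d' n W'" "v \<in> W'"
  obtains \<psi> where "lin_on W \<psi>" "bij_betw \<psi> W W'"
    "\<And>M x. M \<in> carrier_mat n n \<Longrightarrow> x \<in> W \<Longrightarrow>
      \<psi> (tact d n n M x) = fscale (det M ^ k) (tact d' n n M (\<psi> x))"
proof -
  define a where "a M = tact d n n M f" for M
  define b where "b M = fscale (det M ^ k) (tact d' n n M v)" for M
  let ?I = "carrier_mat n n :: rat mat set"
  have ff: "f \<in> funs (words d n)" "f \<noteq> 0" and vf: "v \<in> funs (words d' n)" "v \<noteq> 0"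
    using f v by (auto simp: hwv_def)
  have sW: "stable d n W" and sW': "stable d' n W'" using W W' by (auto simp: tens_simple_iff)
  have aN: "tact d n n N (a M) = a (N * M)" if "N \<in> ?I" "M \<in> ?I" for N M
    using that by (simp add: a_def tact_mult)
  have bN: "fscale (det N ^ k) (tact d' n n N (b M)) = b (N * M)" if "N \<in> ?I" "M \<in> ?I" for N M
    using that by (simp add: b_def tact_mult tact_scale det_mult power_mult_distrib)
  have spanW: "fv.span (a ` ?I) = W"
  proof -
    have "fv.span (a ` ?I) = gen d n n {f}" unfolding gen_def a_def by (rule arg_cong[of _ _ fv.span]) auto
    moreover have "gen d n n {f} \<subseteq> W" using W(2) sW by (intro gen_minimal) (auto dest: stableD)
    moreover have "f \<in> gen d n n {f}" using tact_in_gen[of "1\<^sub>m n" n n f "{f}" d] tact_one[OF ff(1)] by simp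
    ultimately show ?thesis using W(1) stable_gen[of d n n "{f}"] ff(2) unfolding tens_simple_iff
      by (metis singletonD)
  qed
  have spanW': "fv.span (b ` ?I) = W'"
  proof -
    have sub: "fv.span (b ` ?I) \<subseteq> W'"
      using W'(2) sW' by (intro fv.span_minimal) (auto simp: b_def dest: stableD intro!: fv.subspace_scale)
    \<comment> \<open>The factor \<open>det g ^ k\<close> can be divided out for invertible
      \<open>g\<close> only, hence the appeal to \<open>stableI_GL\<close>.\<close>
    have "stable d' n (fv.span (b ` ?I))"
    proof (rule stableI_GL)
      show "fv.span (b ` ?I) \<subseteq> funs (words d' n)" using sub stableD(2)[OF sW'] by blast
      fix g x assume g: "g \<in> carrier (GL n)" and x: "x \<in> fv.span (b ` ?I)"
      have g': "g \<in> ?I" "det g \<noteq> 0" using g by (auto simp: GL_carrier)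
      have "tact d' n n g (b M) \<in> fv.span (b ` ?I)" if M: "M \<in> ?I" for M
      proof -
        have "b (g * M) \<in> fv.span (b ` ?I)" using g' M by (intro fv.span_base) auto
        hence "fscale (1 / det g ^ k) (b (g * M)) \<in> fv.span (b ` ?I)" by (rule fv.span_scale)
        thus ?thesis using bN[OF g'(1) M, symmetric] g'(2) by simp
      qed
      hence "fv.span (b ` ?I) \<subseteq> {x. tact d' n n g x \<in> fv.span (b ` ?I)}"
        by (intro fv.span_minimal subspace_vimage_tact) auto
      thus "tact d' n n g x \<in> fv.span (b ` ?I)" using x by blast
    qed simp
    moreover have "b (1\<^sub>m n) = v" using tact_one[OF vf(1)] by (simp add: b_def)
    hence "v \<in> fv.span (b ` ?I)" by (metis fv.span_base imageI one_carrier_mat)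
    ultimately show ?thesis using W'(1) sub vf(2) unfolding tens_simple_iff by (metis singletonD)
  qed
  let ?ff = "ip (words d n) f f" and ?vv = "ip (words d' n) v v"
  have ne: "?ff \<noteq> 0" "?vv \<noteq> 0" using ip_self_zero[OF finite_words] ff vf by blast+
  \<comment> \<open>The product of \<open>M f\<close> and \<open>N f\<close> is the matrix
    coefficient at M^T N, so proportional coefficients yield proportional Gram matrices.\<close>
  have gram: "ip (words d n) (a M) (a N) * ?vv = ip (words d' n) (b M) (b N) * ?ff"
    if M: "M \<in> ?I" and N: "N \<in> ?I" for M N
  proof -
    have MN: "transpose_mat M * N \<in> ?I" "transpose_mat M \<in> ?I" using M N by auto
    have "ip (words d n) (a M) (a N) = mcoeff 0 d n f (transpose_mat M * N)"
      unfolding a_def mcoeff_def by (simp add: ip_tact[OF M] tact_mult[OF MN(2) N])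
    moreover have "ip (words d' n) (b M) (b N) = mcoeff k d' n v (transpose_mat M * N)"
      unfolding b_def mcoeff_def ip_scale_left ip_scale_right
      by (simp add: ip_tact[OF M] tact_mult[OF MN(2) N] det_mult[OF MN(2) N] det_transpose[OF M] power_mult_distrib)
    ultimately show ?thesis using mcoeff_proportional[OF f v k MN(1)] by simp
  qed
  have gram1: "ip (words d n) (a M) (comb a L) * ?vv = ip (words d' n) (b M) (comb b L) * ?ff"
    if M: "M \<in> ?I" and L: "snd ` set L \<subseteq> ?I" for M L
    using L
  proof (induction L)
    case (Cons q L)
    obtain c N where q: "q = (c, N)" by fastforce
    have "c * (ip (words d n) (a M) (a N) * ?vv) = c * (ip (words d' n) (b M) (b N) * ?ff)"
      using gram[OF M, of N] Cons.prems q by simp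
    then show ?case using Cons q by (simp add: ip_add_right ip_scale_right algebra_simps)
  qed simp
  have gram2: "ip (words d n) (comb a L') (comb a L) * ?vv = ip (words d' n) (comb b L') (comb b L) * ?ff"
    if L: "snd ` set L \<subseteq> ?I" and L': "snd ` set L' \<subseteq> ?I" for L L'
    using L'
  proof (induction L')
    case (Cons q L')
    obtain c N where q: "q = (c, N)" by fastforce
    have "c * (ip (words d n) (a N) (comb a L) * ?vv) = c * (ip (words d' n) (b N) (comb b L) * ?ff)"
      using gram1[of N L, OF _ L] Cons.prems q by simp
    then show ?case using Cons q by (simp add: ip_add_left ip_scale_left algebra_simps)
  qed simp
  \<comment> \<open>The norms of the two combinations are proportional with nonzero factors, so they
    vanish together.\<close>
  have "comb a L = 0 \<longleftrightarrow> comb b L = 0" if L: "snd ` set L \<subseteq> ?I" for L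
  proof -
    have "comb a L \<in> funs (words d n)" "comb b L \<in> funs (words d' n)"
      by (auto intro!: comb_in_subspace subspace_funs fv.subspace_scale[OF subspace_funs] simp: a_def b_def tact_funs)
    thus ?thesis using gram2[OF L L] ne ip_self_zero[OF finite_words] by (metis ip_zero(1) mult_eq_0_iff)
  qed
  from linear_iso_of_combs[of ?I a b, OF this] obtain \<psi> where \<psi>: "lin_on W \<psi>" "bij_betw \<psi> W W'"
    "\<And>M. M \<in> ?I \<Longrightarrow> \<psi> (a M) = b M"
    unfolding spanW spanW' by blast
  have "\<psi> (tact d n n N x) = fscale (det N ^ k) (tact d' n n N (\<psi> x))" if N: "N \<in> ?I" and x: "x \<in> W" for N x
  proof -
    obtain L where L: "x = comb a L" "snd ` set L \<subseteq> ?I"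
      using x unfolding spanW[symmetric] span_eq_comb by blast
    have aW: "a M \<in> W" if "M \<in> ?I" for M using that sW W(2) by (simp add: a_def stableD)
    have "\<psi> (tact d n n N x) = comb (\<lambda>M. \<psi> (tact d n n N (a M))) L"
      unfolding L(1) tact_comb
      using L(2) aW stableD(3)[OF sW N] by (intro lin_on_comb[OF \<psi>(1) stableD(1)[OF sW]]) auto
    also have "\<dots> = comb (\<lambda>M. fscale (det N ^ k) (tact d' n n N (b M))) L"
      using L(2) N by (induction L arbitrary: ) (auto simp: aN bN \<psi>(3))
    also have "\<dots> = fscale (det N ^ k) (tact d' n n N (comb b L))"
      by (rule lin_on_comb[of UNIV "\<lambda>y. fscale (det N ^ k) (tact d' n n N y)" L b, symmetric])
        (auto simp: lin_on_def tact_add tact_scale fv.scale_right_distrib mult.commute)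
    also have "comb b L = \<psi> x"
      unfolding L(1) using L(2) aW \<psi>(3)
      by (subst lin_on_comb[OF \<psi>(1) stableD(1)[OF sW], of L a]) (auto, induction L, auto)
    finally show ?thesis .
  qed
  thus ?thesis using that \<psi>(1,2) by blast
qed

section \<open>Representations modelled on function spaces\<close>

text \<open>Coordinates on a representation whose vectors may be anything, cosets included: \<theta>
  identifies a space of functions with the carrier and \<alpha> is the action seen there. Leaving
  \<alpha> open, instead of fixing \<open>tact\<close>, admits determinant twists.\<close>

locale coord_rep =
  fixes n :: nat and U :: "'v gl_rep" and P :: "('b \<Rightarrow> rat) set"
    and \<theta> :: "('b \<Rightarrow> rat) \<Rightarrow> 'v" and \<alpha> :: "rat mat \<Rightarrow> ('b \<Rightarrow> rat) \<Rightarrow> 'b \<Rightarrow> rat"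
  assumes subspace_P: "fv.subspace P"
    and bij: "bij_betw \<theta> P (carrier U)"
    and \<theta>_add: "x \<in> P \<Longrightarrow> y \<in> P \<Longrightarrow> \<theta> (x + y) = \<theta> x \<oplus>\<^bsub>U\<^esub> \<theta> y"
    and \<theta>_smult: "x \<in> P \<Longrightarrow> \<theta> (fscale c x) = c \<odot>\<^bsub>U\<^esub> \<theta> x"
    and \<theta>_zero: "\<theta> 0 = \<zero>\<^bsub>U\<^esub>"
    and \<alpha>_closed: "g \<in> carrier (GL n) \<Longrightarrow> x \<in> P \<Longrightarrow> \<alpha> g x \<in> P"
    and \<alpha>_act: "g \<in> carrier (GL n) \<Longrightarrow> x \<in> P \<Longrightarrow> act U g (\<theta> x) = \<theta> (\<alpha> g x)"
    and \<alpha>_lin: "g \<in> carrier (GL n) \<Longrightarrow> lin_on P (\<alpha> g)"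
    and \<alpha>_one: "x \<in> P \<Longrightarrow> \<alpha> (1\<^sub>m n) x = x"
    and \<alpha>_mult: "g \<in> carrier (GL n) \<Longrightarrow> h \<in> carrier (GL n) \<Longrightarrow> x \<in> P \<Longrightarrow> \<alpha> (g * h) x = \<alpha> g (\<alpha> h x)"
begin

lemma carrierE:
  assumes "v \<in> carrier U"
  obtains x where "x \<in> P" "v = \<theta> x"
  using assms bij unfolding bij_betw_def by blast

lemma \<theta>_carrier: "x \<in> P \<Longrightarrow> \<theta> x \<in> carrier U"
  using bij by (auto simp: bij_betw_def)

lemma \<theta>_inj: "x \<in> P \<Longrightarrow> y \<in> P \<Longrightarrow> \<theta> x = \<theta> y \<longleftrightarrow> x = y"
  using bij by (auto simp: bij_betw_def inj_on_def)

lemma \<theta>_image_eq_iff: "X \<subseteq> P \<Longrightarrow> Y \<subseteq> P \<Longrightarrow> \<theta> ` X = \<theta> ` Y \<longleftrightarrow> X = Y"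
  using bij by (intro inj_on_image_eq_iff) (auto simp: bij_betw_def)

lemma carrier_eq: "carrier U = \<theta> ` P"
  using bij by (simp add: bij_betw_def)

lemma P_closed: "x \<in> P \<Longrightarrow> y \<in> P \<Longrightarrow> x + y \<in> P" "x \<in> P \<Longrightarrow> fscale c x \<in> P" "0 \<in> P"
  using subspace_P by (auto simp: fv.subspace_add fv.subspace_scale fv.subspace_0)

lemma vectorspace: "vectorspace QQ U"
proof (rule vs_criteria)
  show "field QQ" by (rule class_field)
  show "\<forall>v\<in>carrier U. \<exists>w\<in>carrier U. v \<oplus>\<^bsub>U\<^esub> w = \<zero>\<^bsub>U\<^esub>"
  proof
    fix v assume "v \<in> carrier U"
    then obtain x where x: "x \<in> P" "v = \<theta> x" by (rule carrierE)
    have "\<theta> x \<oplus>\<^bsub>U\<^esub> \<theta> (fscale (-1) x) = \<theta> (x + fscale (-1) x)"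
      by (rule \<theta>_add[symmetric, OF x(1) P_closed(2)[OF x(1)]])
    also have "x + fscale (-1) x = 0" by (simp add: fun_eq_iff fun_app)
    finally have "v \<oplus>\<^bsub>U\<^esub> \<theta> (fscale (-1) x) = \<zero>\<^bsub>U\<^esub>" by (simp only: x(2) \<theta>_zero)
    thus "\<exists>w\<in>carrier U. v \<oplus>\<^bsub>U\<^esub> w = \<zero>\<^bsub>U\<^esub>" using \<theta>_carrier[OF P_closed(2)[OF x(1)]] by blast
  qed
  show "\<forall>v w x. v \<in> carrier U \<and> w \<in> carrier U \<and> x \<in> carrier U \<longrightarrow>
      v \<oplus>\<^bsub>U\<^esub> w \<oplus>\<^bsub>U\<^esub> x = v \<oplus>\<^bsub>U\<^esub> (w \<oplus>\<^bsub>U\<^esub> x)"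
    by (auto elim!: carrierE simp: P_closed add.assoc simp flip: \<theta>_add)
  show "\<forall>v w. v \<in> carrier U \<and> w \<in> carrier U \<longrightarrow> v \<oplus>\<^bsub>U\<^esub> w = w \<oplus>\<^bsub>U\<^esub> v"
    by (auto elim!: carrierE simp: add.commute simp flip: \<theta>_add)
  show "\<forall>v\<in>carrier U. v \<oplus>\<^bsub>U\<^esub> \<zero>\<^bsub>U\<^esub> = v"
    by (auto elim!: carrierE simp: P_closed simp flip: \<theta>_add \<theta>_zero)
  show "\<forall>v w. v \<in> carrier U \<and> w \<in> carrier U \<longrightarrow> v \<oplus>\<^bsub>U\<^esub> w \<in> carrier U"
    by (auto elim!: carrierE simp: P_closed \<theta>_carrier simp flip: \<theta>_add)
  show "\<zero>\<^bsub>U\<^esub> \<in> carrier U" using \<theta>_carrier[OF P_closed(3)] \<theta>_zero by simp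
  show "\<forall>c v. c \<in> carrier QQ \<and> v \<in> carrier U \<longrightarrow> c \<odot>\<^bsub>U\<^esub> v \<in> carrier U"
    by (auto elim!: carrierE simp: P_closed \<theta>_carrier simp flip: \<theta>_smult)
  show "\<forall>a b v. a \<in> carrier QQ \<and> b \<in> carrier QQ \<and> v \<in> carrier U \<longrightarrow>
      a \<otimes>\<^bsub>QQ\<^esub> b \<odot>\<^bsub>U\<^esub> v = a \<odot>\<^bsub>U\<^esub> (b \<odot>\<^bsub>U\<^esub> v)"
    by (auto elim!: carrierE simp: P_closed simp flip: \<theta>_smult)
  show "\<forall>v\<in>carrier U. \<one>\<^bsub>QQ\<^esub> \<odot>\<^bsub>U\<^esub> v = v"
    by (auto elim!: carrierE simp: P_closed simp flip: \<theta>_smult)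
  show "\<forall>a b v. a \<in> carrier QQ \<and> b \<in> carrier QQ \<and> v \<in> carrier U \<longrightarrow>
      (a \<oplus>\<^bsub>QQ\<^esub> b) \<odot>\<^bsub>U\<^esub> v = a \<odot>\<^bsub>U\<^esub> v \<oplus>\<^bsub>U\<^esub> b \<odot>\<^bsub>U\<^esub> v"
    by (auto elim!: carrierE simp: P_closed fv.scale_left_distrib simp flip: \<theta>_smult \<theta>_add)
  show "\<forall>a v w. a \<in> carrier QQ \<and> v \<in> carrier U \<and> w \<in> carrier U \<longrightarrow>
      a \<odot>\<^bsub>U\<^esub> (v \<oplus>\<^bsub>U\<^esub> w) = a \<odot>\<^bsub>U\<^esub> v \<oplus>\<^bsub>U\<^esub> a \<odot>\<^bsub>U\<^esub> w"
    by (auto elim!: carrierE simp: P_closed fv.scale_right_distrib simp flip: \<theta>_smult \<theta>_add)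
qed

lemma module: "Module.module QQ U"
  using vectorspace by (simp add: vectorspace_def)

lemma gl_representation: "gl_representation n U"
proof (intro gl_representation.intro gl_representation_axioms.intro)
  show "vectorspace QQ U" by (rule vectorspace)
next
  fix g assume g: "g \<in> carrier (GL n)"
  have lin: "\<alpha> g (x + y) = \<alpha> g x + \<alpha> g y" "\<alpha> g (fscale c x) = fscale c (\<alpha> g x)"
    if "x \<in> P" "y \<in> P" for x y c
    using \<alpha>_lin[OF g] that by (auto simp: lin_on_def)
  show "act U g \<in> module_hom QQ U U"
    unfolding module_hom_def
  proof (intro CollectI conjI allI impI funcsetI)
    fix v assume "v \<in> carrier U"
    thus "act U g v \<in> carrier U" by (elim carrierE) (simp add: \<alpha>_act \<alpha>_closed \<theta>_carrier g)
  next
    fix v w assume "v \<in> carrier U \<and> w \<in> carrier U"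
    then obtain x y where xy: "x \<in> P" "y \<in> P" "v = \<theta> x" "w = \<theta> y" by (meson carrierE)
    thus "act U g (v \<oplus>\<^bsub>U\<^esub> w) = act U g v \<oplus>\<^bsub>U\<^esub> act U g w"
      using lin(1) by (simp add: \<alpha>_act \<alpha>_closed P_closed g flip: \<theta>_add)
  next
    fix c v assume "c \<in> carrier QQ \<and> v \<in> carrier U"
    then obtain x where x: "x \<in> P" "v = \<theta> x" by (meson carrierE)
    thus "act U g (c \<odot>\<^bsub>U\<^esub> v) = c \<odot>\<^bsub>U\<^esub> act U g v"
      using lin(2) by (simp add: \<alpha>_act \<alpha>_closed P_closed g flip: \<theta>_smult)
  qed
next
  fix v assume "v \<in> carrier U"
  moreover have "1\<^sub>m n \<in> carrier (GL n)" by (simp add: GL_carrier)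
  ultimately show "act U \<one>\<^bsub>GL n\<^esub> v = v" by (elim carrierE) (simp add: GL_one \<alpha>_act \<alpha>_one)
next
  fix g h v assume g: "g \<in> carrier (GL n)" and h: "h \<in> carrier (GL n)" and v: "v \<in> carrier U"
  have gh: "g * h \<in> carrier (GL n)" using g h by (auto simp: GL_carrier det_mult)
  show "act U (g \<otimes>\<^bsub>GL n\<^esub> h) v = act U g (act U h v)"
    using v by (elim carrierE) (simp add: GL_mult \<alpha>_act \<alpha>_mult \<alpha>_closed g h gh)
qed

lemma submodule_image:
  assumes "fv.subspace X" "X \<subseteq> P"
  shows "submodule QQ (\<theta> ` X) U"
proof (rule LinearCombinations.submodule.intro)
  show "Module.module QQ U" by (rule module)
  show "\<theta> ` X \<subseteq> carrier U" using assms(2) \<theta>_carrier by auto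
  fix v w assume "v \<in> \<theta> ` X" "w \<in> \<theta> ` X"
  then obtain x y where "x \<in> X" "y \<in> X" "v = \<theta> x" "w = \<theta> y" by blast
  thus "v \<oplus>\<^bsub>U\<^esub> w \<in> \<theta> ` X"
    using assms by (auto simp flip: \<theta>_add simp: fv.subspace_add subset_iff)
next
  show "\<zero>\<^bsub>U\<^esub> \<in> \<theta> ` X" using fv.subspace_0[OF assms(1)] \<theta>_zero by (metis imageI)
next
  fix c v assume "v \<in> \<theta> ` X"
  then obtain x where "x \<in> X" "v = \<theta> x" by blast
  thus "c \<odot>\<^bsub>U\<^esub> v \<in> \<theta> ` X"
    using assms by (auto simp flip: \<theta>_smult simp: fv.subspace_scale subset_iff)
qed

lemma subspace_image: "fv.subspace X \<Longrightarrow> X \<subseteq> P \<Longrightarrow> subspace QQ (\<theta> ` X) U"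
  using submodule_image vectorspace by (simp add: subspace_def)

lemma submodule_preimage:
  assumes "submodule QQ W U"
  shows "fv.subspace {x \<in> P. \<theta> x \<in> W}"
  unfolding fv.subspace_def
proof (intro conjI ballI allI)
  show "0 \<in> {x \<in> P. \<theta> x \<in> W}" using submodule.zero_closed[OF assms] P_closed \<theta>_zero by simp
  fix x y assume "x \<in> {x \<in> P. \<theta> x \<in> W}" "y \<in> {x \<in> P. \<theta> x \<in> W}"
  thus "x + y \<in> {x \<in> P. \<theta> x \<in> W}" using submodule.m_closed[OF assms] by (simp add: P_closed \<theta>_add)
next
  fix c x assume "x \<in> {x \<in> P. \<theta> x \<in> W}"
  thus "fscale c x \<in> {x \<in> P. \<theta> x \<in> W}"
    using submodule.smult_closed[OF assms, of c] by (simp add: P_closed \<theta>_smult)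
qed

lemma subspace_preimage:
  assumes "subspace QQ W U"
  obtains X where "fv.subspace X" "X \<subseteq> P" "W = \<theta> ` X"
proof
  have sub: "submodule QQ W U" using assms by (simp add: subspace_def)
  show "fv.subspace {x \<in> P. \<theta> x \<in> W}" by (rule submodule_preimage[OF sub])
  show "{x \<in> P. \<theta> x \<in> W} \<subseteq> P" by auto
  show "W = \<theta> ` {x \<in> P. \<theta> x \<in> W}"
    using submodule.subset[OF sub] unfolding carrier_eq by blast
qed

definition stab :: "('b \<Rightarrow> rat) set \<Rightarrow> bool" where
  "stab X \<longleftrightarrow> fv.subspace X \<and> X \<subseteq> P \<and> (\<forall>g\<in>carrier (GL n). \<forall>x\<in>X. \<alpha> g x \<in> X)"

lemma subrep_image: "stab X \<Longrightarrow> subrep n U (\<theta> ` X)"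
  unfolding subrep_def stab_def using subspace_image \<alpha>_act by (auto simp: subset_iff)

lemma subrep_preimage:
  assumes "subrep n U W"
  obtains X where "stab X" "W = \<theta> ` X"
proof -
  obtain X where X: "fv.subspace X" "X \<subseteq> P" "W = \<theta> ` X"
    using assms subspace_preimage unfolding subrep_def by blast
  have "\<alpha> g x \<in> X" if g: "g \<in> carrier (GL n)" and x: "x \<in> X" for g x
  proof -
    have "\<theta> (\<alpha> g x) \<in> \<theta> ` X" using assms g x X by (auto simp: subrep_def \<alpha>_act[symmetric] subset_iff)
    then obtain y where "y \<in> X" "\<theta> (\<alpha> g x) = \<theta> y" by blast
    thus ?thesis using \<theta>_inj[of "\<alpha> g x" y] \<alpha>_closed[OF g, of x] x X by auto
  qed
  hence "stab X" using X by (simp add: stab_def)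
  thus ?thesis using that X(3) by blast
qed

lemma restrict: "stab X \<Longrightarrow> coord_rep n (U\<lparr>carrier := \<theta> ` X\<rparr>) X \<theta> \<alpha>"
proof unfold_locales
  assume X: "stab X"
  hence XP: "x \<in> P" if "x \<in> X" for x using that by (auto simp: stab_def)
  show "bij_betw \<theta> X (carrier (U\<lparr>carrier := \<theta> ` X\<rparr>))"
    using bij X unfolding bij_betw_def stab_def by (auto intro: inj_on_subset)
  show "lin_on X (\<alpha> g)" if "g \<in> carrier (GL n)" for g
    using \<alpha>_lin[OF that] X by (auto simp: stab_def intro: lin_on_mono)
qed (auto simp: stab_def \<theta>_add \<theta>_smult \<theta>_zero \<alpha>_act \<alpha>_one \<alpha>_mult subset_iff)

lemma irreducible_rep_iff:
  "irreducible_rep n U \<longleftrightarrow> P \<noteq> {0} \<and> (\<forall>X. stab X \<longrightarrow> X = {0} \<or> X = P)"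
proof -
  have eq: "\<theta> ` X = {\<zero>\<^bsub>U\<^esub>} \<longleftrightarrow> X = {0}" "\<theta> ` X = carrier U \<longleftrightarrow> X = P" if "X \<subseteq> P" for X
    using \<theta>_image_eq_iff[OF that, of "{0}"] \<theta>_image_eq_iff[OF that, of P] P_closed(3)
    by (simp_all add: \<theta>_zero carrier_eq)
  have "(\<forall>W. subrep n U W \<longrightarrow> W = {\<zero>\<^bsub>U\<^esub>} \<or> W = carrier U) \<longleftrightarrow> (\<forall>X. stab X \<longrightarrow> X = {0} \<or> X = P)"
    (is "?A \<longleftrightarrow> ?B")
  proof
    assume ?A
    show ?B
    proof (intro allI impI)
      fix X assume "stab X"
      thus "X = {0} \<or> X = P" using \<open>?A\<close> subrep_image[of X] eq[of X] by (auto simp: stab_def)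
    qed
  next
    assume ?B
    show ?A
    proof (intro allI impI)
      fix W assume "subrep n U W"
      then obtain X where X: "stab X" "W = \<theta> ` X" by (rule subrep_preimage)
      thus "W = {\<zero>\<^bsub>U\<^esub>} \<or> W = carrier U" using \<open>?B\<close> eq[of X] by (auto simp: stab_def)
    qed
  qed
  moreover have "carrier U \<noteq> {\<zero>\<^bsub>U\<^esub>} \<longleftrightarrow> P \<noteq> {0}" using eq(1)[of P] by (simp add: carrier_eq)
  ultimately show ?thesis unfolding irreducible_rep_def using gl_representation by blast
qed

lemma span_image:
  assumes "S \<subseteq> P"
  shows "LinearCombinations.module.span QQ U (\<theta> ` S) = \<theta> ` fv.span S"
proof
  have sub: "fv.span S \<subseteq> P" using assms subspace_P by (rule fv.span_minimal)
  have SU: "\<theta> ` S \<subseteq> carrier U" using assms \<theta>_carrier by auto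
  show "LinearCombinations.module.span QQ U (\<theta> ` S) \<subseteq> \<theta> ` fv.span S"
    by (rule module.span_is_subset[OF module]) (auto intro: submodule_image[OF fv.subspace_span sub] fv.span_base)
  have "submodule QQ (LinearCombinations.module.span QQ U (\<theta> ` S)) U"
    by (rule module.span_is_submodule[OF module SU])
  from submodule_preimage[OF this]
  have "fv.span S \<subseteq> {x \<in> P. \<theta> x \<in> LinearCombinations.module.span QQ U (\<theta> ` S)}"
    using assms module.in_own_span[OF module SU] by (intro fv.span_minimal) auto
  thus "\<theta> ` fv.span S \<subseteq> LinearCombinations.module.span QQ U (\<theta> ` S)" by blast
qed

lemma orbit_span_image:
  assumes "S \<subseteq> P"
  shows "orbit_span n U (\<theta> ` S) = \<theta> ` fv.span {\<alpha> g x | g x. g \<in> carrier (GL n) \<and> x \<in> S}"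
proof -
  let ?T = "{\<alpha> g x | g x. g \<in> carrier (GL n) \<and> x \<in> S}"
  have eq: "{act U g v | g v. g \<in> carrier (GL n) \<and> v \<in> \<theta> ` S} = \<theta> ` ?T" (is "?L = _")
  proof
    show "?L \<subseteq> \<theta> ` ?T"
    proof
      fix z assume "z \<in> ?L"
      then obtain g x where "g \<in> carrier (GL n)" "x \<in> S" "z = act U g (\<theta> x)" by blast
      thus "z \<in> \<theta> ` ?T" using assms \<alpha>_act[of g x] by blast
    qed
    show "\<theta> ` ?T \<subseteq> ?L"
    proof
      fix z assume "z \<in> \<theta> ` ?T"
      then obtain g x where gx: "g \<in> carrier (GL n)" "x \<in> S" "z = \<theta> (\<alpha> g x)" by blast
      hence "z = act U g (\<theta> x)" using assms \<alpha>_act[of g x] by auto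
      thus "z \<in> ?L" using gx by blast
    qed
  qed
  have "?T \<subseteq> P" using assms \<alpha>_closed by blast
  thus ?thesis unfolding orbit_span_def eq by (rule span_image)
qed

lemma finsum_image:
  assumes "finite S" "\<And>i. i \<in> S \<Longrightarrow> x i \<in> P"
  shows "finsum U (\<lambda>i. \<theta> (x i)) S = \<theta> (\<Sum>i\<in>S. x i)"
proof -
  interpret vectorspace QQ U by (rule vectorspace)
  show ?thesis
    using assms
  proof (induction S)
    case (insert i S)
    have "(\<Sum>i\<in>S. x i) \<in> P" using insert.prems by (intro fv.subspace_sum[OF subspace_P]) auto
    thus ?case
      using insert by (subst finsum_insert) (auto simp: \<theta>_carrier \<theta>_add)
  qed (simp add: \<theta>_zero)
qed

text \<open>The inner product of a vanishing sum with one of its summands is the norm of that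
  summand, by orthogonality of the others.\<close>

lemma internal_direct_sum_image:
  assumes fin: "finite \<Omega>" "P \<subseteq> funs \<Omega>"
    and sub: "\<And>X. X \<in> \<X> \<Longrightarrow> fv.subspace X" and span: "fv.span (\<Union>\<X>) = P"
    and orth: "\<And>X Y x y. X \<in> \<X> \<Longrightarrow> Y \<in> \<X> \<Longrightarrow> X \<noteq> Y \<Longrightarrow> x \<in> X \<Longrightarrow> y \<in> Y \<Longrightarrow> ip \<Omega> x y = 0"
  shows "internal_direct_sum U ((`) \<theta> ` \<X>)"
  unfolding internal_direct_sum_def
proof (intro conjI ballI allI impI)
  have XP: "X \<subseteq> P" if X: "X \<in> \<X>" for X
  proof
    fix x assume "x \<in> X"
    hence "x \<in> \<Union>\<X>" using X by blast
    thus "x \<in> P" unfolding span[symmetric] by (rule fv.span_base)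
  qed
  {
    fix W assume "W \<in> (`) \<theta> ` \<X>"
    thus "subspace QQ W U" using sub XP subspace_image by auto
  }
  show "LinearCombinations.module.span QQ U (\<Union>((`) \<theta> ` \<X>)) = carrier U"
  proof -
    have "\<Union>((`) \<theta> ` \<X>) = \<theta> ` \<Union>\<X>" by blast
    moreover have "\<Union>\<X> \<subseteq> P" using XP by blast
    ultimately show ?thesis using span_image[of "\<Union>\<X>"] span carrier_eq by simp
  qed
  fix \<S> f W
  assume S: "finite \<S> \<and> \<S> \<subseteq> (`) \<theta> ` \<X> \<and> (\<forall>W\<in>\<S>. f W \<in> W) \<and> finsum U f \<S> = \<zero>\<^bsub>U\<^esub>" and W: "W \<in> \<S>"
  \<comment> \<open>The definition of a direct sum indexes by subspaces of the carrier;
    \<open>pre\<close> takes them and the chosen vectors back to coordinates, where the inner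
    product lives.\<close>
  define pre where "pre = inv_into P \<theta>"
  have mem: "pre (f V) \<in> pre ` V \<and> pre ` V \<in> \<X> \<and> \<theta> (pre (f V)) = f V \<and> \<theta> ` pre ` V = V" if V: "V \<in> \<S>" for V
  proof -
    obtain X where X: "X \<in> \<X>" "V = \<theta> ` X" using S V by blast
    have "pre ` V = X"
      unfolding pre_def X(2) using bij XP[OF X(1)] by (simp add: bij_betw_def inv_into_image_cancel)
    moreover have "f V \<in> V" using S V by blast
    moreover have "\<theta> (pre (f V)) = f V"
    proof -
      have "f V \<in> \<theta> ` P" using \<open>f V \<in> V\<close> X(2) XP[OF X(1)] by blast
      thus ?thesis unfolding pre_def by (rule f_inv_into_f)
    qed
    moreover have "pre (f V) \<in> pre ` V" using \<open>f V \<in> V\<close> by (rule imageI)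
    ultimately show ?thesis using X by auto
  qed
  have invP: "pre (f V) \<in> P" if "V \<in> \<S>" for V using mem[OF that] XP by blast
  have inj: "pre ` V \<noteq> pre ` V'" if "V \<in> \<S>" "V' \<in> \<S>" "V \<noteq> V'" for V V'
  proof
    assume "pre ` V = pre ` V'"
    hence "\<theta> ` pre ` V = \<theta> ` pre ` V'" by simp
    thus False using mem[OF that(1)] mem[OF that(2)] that(3) by simp
  qed
  have "finsum U f \<S> = finsum U (\<lambda>V. \<theta> (pre (f V))) \<S>"
  proof -
    interpret vectorspace QQ U by (rule vectorspace)
    show ?thesis by (rule finsum_cong') (use mem invP \<theta>_carrier in auto)
  qed
  also have "\<dots> = \<theta> (\<Sum>V\<in>\<S>. pre (f V))" using S invP by (intro finsum_image) auto
  finally have "\<theta> (\<Sum>V\<in>\<S>. pre (f V)) = \<theta> 0" using S \<theta>_zero by simp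
  moreover have "(\<Sum>V\<in>\<S>. pre (f V)) \<in> P" using invP by (intro fv.subspace_sum[OF subspace_P])
  ultimately have z: "(\<Sum>V\<in>\<S>. pre (f V)) = 0" using \<theta>_inj P_closed(3) by blast
  have "ip \<Omega> (\<Sum>V\<in>\<S>'. pre (f V)) (pre (f W)) = (\<Sum>V\<in>\<S>'. ip \<Omega> (pre (f V)) (pre (f W)))"
    if "finite \<S>'" for \<S>'
    using that by (induction \<S>') (simp_all add: ip_add_left)
  hence "0 = (\<Sum>V\<in>\<S>. ip \<Omega> (pre (f V)) (pre (f W)))" using z S by (metis ip_zero(1))
  also have "\<dots> = (\<Sum>V\<in>\<S>. if V = W then ip \<Omega> (pre (f W)) (pre (f W)) else 0)"
  proof (intro sum.cong refl)
    fix V assume V: "V \<in> \<S>"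
    show "ip \<Omega> (pre (f V)) (pre (f W)) = (if V = W then ip \<Omega> (pre (f W)) (pre (f W)) else 0)"
    proof (cases "V = W")
      case False
      thus ?thesis using orth[OF _ _ inj[OF V W False]] mem[OF V] mem[OF W] by auto
    qed simp
  qed
  also have "\<dots> = ip \<Omega> (pre (f W)) (pre (f W))" using S W by simp
  finally have "pre (f W) = 0" using ip_self_zero[OF fin(1)] invP[OF W] fin(2) by (metis subsetD)
  thus "f W = \<zero>\<^bsub>U\<^esub>" using mem[OF W] \<theta>_zero by metis
qed

end

section \<open>Isomorphisms and tensor models in coordinates\<close>

lemma coord_rep_iso:
  assumes A: "coord_rep n U P \<theta> \<alpha>" and B: "coord_rep n U' P' \<theta>' \<alpha>'"
  shows "rep_iso n U U' \<longleftrightarrow> (\<exists>\<psi>. lin_on P \<psi> \<and> bij_betw \<psi> P P' \<and>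
    (\<forall>g\<in>carrier (GL n). \<forall>x\<in>P. \<psi> (\<alpha> g x) = \<alpha>' g (\<psi> x)))"
proof
  interpret A: coord_rep n U P \<theta> \<alpha> by (rule A)
  interpret B: coord_rep n U' P' \<theta>' \<alpha>' by (rule B)
  define \<iota> where "\<iota> = inv_into P' \<theta>'"
  have \<iota>: "\<iota> v \<in> P'" "\<theta>' (\<iota> v) = v" if "v \<in> carrier U'" for v
    using that B.bij inv_into_into[of v \<theta>' P'] f_inv_into_f[of v \<theta>' P'] unfolding \<iota>_def bij_betw_def by auto
  have \<iota>\<theta>: "\<iota> (\<theta>' x) = x" if "x \<in> P'" for x
    using that B.bij unfolding \<iota>_def bij_betw_def by simp
  have \<iota>bij: "bij_betw \<iota> (carrier U') P'" unfolding \<iota>_def by (rule bij_betw_inv_into[OF B.bij])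
  assume "rep_iso n U U'"
  then obtain f where f: "f \<in> module_hom QQ U U'" "bij_betw f (carrier U) (carrier U')"
    "\<And>g u. g \<in> carrier (GL n) \<Longrightarrow> u \<in> carrier U \<Longrightarrow> f (act U g u) = act U' g (f u)"
    by (auto simp: rep_iso_def)
  have fc: "f (\<theta> x) \<in> carrier U'" if "x \<in> P" for x
    using f(2) A.\<theta>_carrier[OF that] by (auto simp: bij_betw_def)
  define \<psi> where "\<psi> = (\<lambda>x. \<iota> (f (\<theta> x)))"
  have \<theta>\<psi>: "\<theta>' (\<psi> x) = f (\<theta> x)" "\<psi> x \<in> P'" if "x \<in> P" for x
    using \<iota> fc[OF that] by (auto simp: \<psi>_def)
  have "lin_on P \<psi>"
    unfolding lin_on_def
  proof (intro conjI ballI allI)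
    fix x y assume xy: "x \<in> P" "y \<in> P"
    have "\<theta>' (\<psi> (x + y)) = \<theta>' (\<psi> x + \<psi> y)"
      using xy module_hom_add[OF f(1)] by (simp add: \<theta>\<psi> A.P_closed A.\<theta>_add A.\<theta>_carrier B.\<theta>_add)
    thus "\<psi> (x + y) = \<psi> x + \<psi> y" using B.\<theta>_inj xy \<theta>\<psi>(2) A.P_closed B.P_closed by metis
  next
    fix c x assume x: "x \<in> P"
    have "\<theta>' (\<psi> (fscale c x)) = \<theta>' (fscale c (\<psi> x))"
      using x module_hom_smult[OF f(1), of c] by (simp add: \<theta>\<psi> A.P_closed A.\<theta>_smult A.\<theta>_carrier B.\<theta>_smult)
    thus "\<psi> (fscale c x) = fscale c (\<psi> x)" using B.\<theta>_inj x \<theta>\<psi>(2) A.P_closed B.P_closed by metis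
  qed
  moreover have "bij_betw \<psi> P P'"
    unfolding \<psi>_def using bij_betw_trans[OF bij_betw_trans[OF A.bij f(2)] \<iota>bij] by (simp add: o_def)
  moreover have "\<psi> (\<alpha> g x) = \<alpha>' g (\<psi> x)" if g: "g \<in> carrier (GL n)" and x: "x \<in> P" for g x
  proof -
    have "\<theta>' (\<psi> (\<alpha> g x)) = \<theta>' (\<alpha>' g (\<psi> x))"
      using f(3)[OF g A.\<theta>_carrier[OF x]] A.\<alpha>_act[OF g x] B.\<alpha>_act[OF g \<theta>\<psi>(2)[OF x]] \<theta>\<psi> x A.\<alpha>_closed[OF g x]
      by simp
    thus ?thesis using B.\<theta>_inj \<theta>\<psi>(2) A.\<alpha>_closed[OF g x] B.\<alpha>_closed[OF g] x by metis
  qed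
  ultimately show "\<exists>\<psi>. lin_on P \<psi> \<and> bij_betw \<psi> P P' \<and>
    (\<forall>g\<in>carrier (GL n). \<forall>x\<in>P. \<psi> (\<alpha> g x) = \<alpha>' g (\<psi> x))" by blast
next
  interpret A: coord_rep n U P \<theta> \<alpha> by (rule A)
  interpret B: coord_rep n U' P' \<theta>' \<alpha>' by (rule B)
  define \<iota> where "\<iota> = inv_into P \<theta>"
  have \<iota>\<theta>: "\<iota> (\<theta> x) = x" if "x \<in> P" for x
    using that A.bij unfolding \<iota>_def bij_betw_def by simp
  assume "\<exists>\<psi>. lin_on P \<psi> \<and> bij_betw \<psi> P P' \<and>
    (\<forall>g\<in>carrier (GL n). \<forall>x\<in>P. \<psi> (\<alpha> g x) = \<alpha>' g (\<psi> x))"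
  then obtain \<psi> where \<psi>: "lin_on P \<psi>" "bij_betw \<psi> P P'"
    "\<And>g x. g \<in> carrier (GL n) \<Longrightarrow> x \<in> P \<Longrightarrow> \<psi> (\<alpha> g x) = \<alpha>' g (\<psi> x)" by blast
  have \<psi>P: "\<psi> x \<in> P'" if "x \<in> P" for x using \<psi>(2) that by (auto simp: bij_betw_def)
  define f where "f = (\<lambda>v. \<theta>' (\<psi> (\<iota> v)))"
  have f: "f (\<theta> x) = \<theta>' (\<psi> x)" if "x \<in> P" for x using \<iota>\<theta>[OF that] by (simp add: f_def)
  have "f \<in> module_hom QQ U U'"
    unfolding module_hom_def
  proof (intro CollectI conjI allI impI funcsetI)
    fix v assume "v \<in> carrier U"
    thus "f v \<in> carrier U'" by (elim A.carrierE) (simp add: f B.\<theta>_carrier \<psi>P)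
  next
    fix v w assume "v \<in> carrier U \<and> w \<in> carrier U"
    then obtain x y where xy: "x \<in> P" "y \<in> P" "v = \<theta> x" "w = \<theta> y" by (meson A.carrierE)
    thus "f (v \<oplus>\<^bsub>U\<^esub> w) = f v \<oplus>\<^bsub>U'\<^esub> f w"
      by (simp add: f \<psi>P A.P_closed lin_on_add[OF \<psi>(1)] flip: A.\<theta>_add B.\<theta>_add)
  next
    fix c v assume "c \<in> carrier QQ \<and> v \<in> carrier U"
    then obtain x where x: "x \<in> P" "v = \<theta> x" by (meson A.carrierE)
    thus "f (c \<odot>\<^bsub>U\<^esub> v) = c \<odot>\<^bsub>U'\<^esub> f v"
      by (simp add: f \<psi>P A.P_closed lin_on_scale[OF \<psi>(1)] flip: A.\<theta>_smult B.\<theta>_smult)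
  qed
  moreover have "bij_betw f (carrier U) (carrier U')"
    unfolding f_def \<iota>_def
    using bij_betw_trans[OF bij_betw_trans[OF bij_betw_inv_into[OF A.bij] \<psi>(2)] B.bij] by (simp add: o_def)
  moreover have "f (act U g v) = act U' g (f v)" if g: "g \<in> carrier (GL n)" and v: "v \<in> carrier U" for g v
    using v by (elim A.carrierE) (simp add: f A.\<alpha>_act B.\<alpha>_act A.\<alpha>_closed \<psi>P \<psi>(3) g)
  ultimately show "rep_iso n U U'" by (auto simp: rep_iso_def)
qed

lemma coord_rep_tensor:
  assumes "stable d n X"
  shows "coord_rep n ((tensor_power d n)\<lparr>carrier := X\<rparr>) X (\<lambda>x. x) (tact d n n)"
proof
  show "tact d n n (1\<^sub>m n) x = x" if "x \<in> X" for x using that stableD(2)[OF assms] by (auto intro: tact_one)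
  show "tact d n n (g * h) x = tact d n n g (tact d n n h x)"
    if "g \<in> carrier (GL n)" "h \<in> carrier (GL n)" for g h x
    using that by (simp add: tact_mult GL_mat)
  show "act ((tensor_power d n)\<lparr>carrier := X\<rparr>) g x = tact d n n g x" for g x
    by (simp add: act_tensor_power)
qed (use stableD[OF assms] in \<open>auto simp: GL_mat lin_on_tact plus_fun_def fscale_def zero_fun_def tensor_power_def bij_betw_def inj_on_def\<close>)

lemma schur_eq: "schur l n = (tensor_power (sum_list l) n)\<lparr>carrier := schur_set l n\<rparr>"
  using carrier_schur[of l n] by (simp add: schur_def Let_def tensor_power_def)

lemma coord_rep_schur: "coord_rep n (schur l n) (schur_set l n) (\<lambda>x. x) (tact (sum_list l) n n)"
  unfolding schur_eq by (rule coord_rep_tensor[OF stable_schur_set])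

lemma coord_rep_det_twist:
  assumes "coord_rep n U P \<theta> \<alpha>"
  shows "coord_rep n (det_twist k U) P \<theta> (\<lambda>g x. fscale (det g powi k) (\<alpha> g x))"
proof -
  interpret coord_rep n U P \<theta> \<alpha> by (rule assms)
  show ?thesis
  proof
    fix g assume g: "g \<in> carrier (GL n)"
    show "lin_on P (\<lambda>x. fscale (det g powi k) (\<alpha> g x))"
      using \<alpha>_lin[OF g] by (auto simp: lin_on_def fv.scale_right_distrib mult.commute)
    fix h x assume h: "h \<in> carrier (GL n)" and x: "x \<in> P"
    have "det (g * h) powi k = det g powi k * det h powi k"
      using det_mult[OF GL_mat[OF g] GL_mat[OF h]] by (simp add: power_int_mult_distrib)
    thus "fscale (det (g * h) powi k) (\<alpha> (g * h) x)
        = fscale (det g powi k) (\<alpha> g (fscale (det h powi k) (\<alpha> h x)))"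
      using \<alpha>_mult[OF g h x] lin_on_scale[OF \<alpha>_lin[OF g] \<alpha>_closed[OF h x]] by simp
  qed (auto simp: det_twist_def subspace_P bij \<theta>_add \<theta>_smult \<theta>_zero \<alpha>_closed \<alpha>_act \<alpha>_one P_closed)
qed

section \<open>The free Lie algebra as a quotient of the tensor algebra\<close>

lemma lookup_scale [simp]: "Poly_Mapping.lookup (scale c p) t = c * Poly_Mapping.lookup p t"
  by (simp add: scale_def Poly_Mapping.map.rep_eq when_def)

lemma scale_add: "scale c (p + q) = scale c p + scale c q"
  by (rule poly_mapping_eqI) (simp add: lookup_add algebra_simps)

lemma scale_scale: "scale c (scale d p) = scale (c * d) p"
  by (rule poly_mapping_eqI) (simp add: mult.assoc)

lemma scale_add_left: "scale (c + d) p = scale c p + scale d p"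
  by (rule poly_mapping_eqI) (simp add: lookup_add algebra_simps)

lemma scale_zero [simp]: "scale c 0 = 0" "scale 0 p = 0" "scale 1 p = p"
  by (rule poly_mapping_eqI; simp)+

lemma scale_minus_one: "scale (-1) p = - p"
  by (rule poly_mapping_eqI) simp

lemma scale_sum: "scale c (\<Sum>i\<in>A. p i) = (\<Sum>i\<in>A. scale c (p i))"
  by (induction A rule: infinite_finite_induct) (auto simp: scale_add)

lemma scale_single: "scale c (Poly_Mapping.single t x) = Poly_Mapping.single t (c * x)"
  by (rule poly_mapping_eqI) (simp add: lookup_single when_def)

lemma single_sum: "Poly_Mapping.single t (\<Sum>i\<in>A. x i) = (\<Sum>i\<in>A. Poly_Mapping.single t (x i :: rat))"
  by (induction A rule: infinite_finite_induct) (auto simp: single_add)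

text \<open>A tree splits in at most one way, so a coefficient of a product is a single product of
  coefficients. Bilinearity can then be checked coefficientwise.\<close>

lemma lookup_magma_mult:
  "Poly_Mapping.lookup (magma_mult p q) u =
    (case u of Gen _ \<Rightarrow> 0 | Op s t \<Rightarrow> Poly_Mapping.lookup p s * Poly_Mapping.lookup q t)"
proof (cases u)
  case (Gen x)
  then show ?thesis by (simp add: magma_mult_def lookup_sum lookup_single)
next
  case (Op s t)
  have "Poly_Mapping.lookup (magma_mult p q) u = (\<Sum>s'\<in>Poly_Mapping.keys p. \<Sum>t'\<in>Poly_Mapping.keys q.
      (if t' = t then (if s' = s then Poly_Mapping.lookup p s' * Poly_Mapping.lookup q t' else 0) else 0))"
    unfolding magma_mult_def lookup_sum
    by (intro sum.cong refl) (auto simp: Op lookup_single when_def)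
  also have "\<dots> = (\<Sum>s'\<in>Poly_Mapping.keys p.
      (if s' = s then (if t \<in> Poly_Mapping.keys q then Poly_Mapping.lookup p s' * Poly_Mapping.lookup q t else 0) else 0))"
    by (intro sum.cong refl) (auto simp: sum.delta)
  also have "\<dots> = Poly_Mapping.lookup p s * Poly_Mapping.lookup q t"
    by (auto simp: sum.delta in_keys_iff)
  finally show ?thesis by (simp add: Op)
qed

lemma magma_mult_add_left: "magma_mult (p + p') q = magma_mult p q + magma_mult p' q"
  and magma_mult_add_right: "magma_mult p (q + q') = magma_mult p q + magma_mult p q'"
  and magma_mult_scale_left: "magma_mult (scale c p) q = scale c (magma_mult p q)"
  and magma_mult_scale_right: "magma_mult p (scale c q) = scale c (magma_mult p q)"
  and magma_mult_zero [simp]: "magma_mult 0 q = 0" "magma_mult p 0 = 0"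
  by (rule poly_mapping_eqI; simp add: lookup_magma_mult lookup_add algebra_simps split: magma.split)+

lemma magma_mult_diff_right: "magma_mult p (q - q') = magma_mult p q - magma_mult p q'"
  by (rule poly_mapping_eqI; simp add: lookup_magma_mult lookup_minus algebra_simps split: magma.split)+

lemma magma_mult_sum_left: "magma_mult (\<Sum>i\<in>A. p i) q = (\<Sum>i\<in>A. magma_mult (p i) q)"
  by (induction A rule: infinite_finite_induct) (auto simp: magma_mult_add_left)

lemma magma_mult_sum_right: "magma_mult p (\<Sum>i\<in>A. q i) = (\<Sum>i\<in>A. magma_mult p (q i))"
  by (induction A rule: infinite_finite_induct) (auto simp: magma_mult_add_right)

lemma magma_mult_single:
  "magma_mult (Poly_Mapping.single s x) (Poly_Mapping.single t y) = Poly_Mapping.single (Op s t) (x * y)"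
  by (rule poly_mapping_eqI) (auto simp: lookup_magma_mult lookup_single when_def split: magma.split)

abbreviation ncarrier :: "nat \<Rightarrow> (nat magma \<Rightarrow>\<^sub>0 rat) set" where
  "ncarrier n \<equiv> carrier (magma_algebra n)"

lemma in_ncarrier: "p \<in> ncarrier n \<longleftrightarrow> (\<forall>t. Poly_Mapping.lookup p t \<noteq> 0 \<longrightarrow> set_magma t \<subseteq> {..<n})"
  by (auto simp: magma_algebra_def in_keys_iff simp del: subset_iff)

lemma ncarrier_closed:
  "0 \<in> ncarrier n"
  "p \<in> ncarrier n \<Longrightarrow> q \<in> ncarrier n \<Longrightarrow> p + q \<in> ncarrier n"
  "p \<in> ncarrier n \<Longrightarrow> scale c p \<in> ncarrier n"
  "set_magma t \<subseteq> {..<n} \<Longrightarrow> Poly_Mapping.single t x \<in> ncarrier n"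
  unfolding in_ncarrier by (simp_all add: lookup_add lookup_single when_def) (metis add_0)

lemma ncarrier_mult: "p \<in> ncarrier n \<Longrightarrow> q \<in> ncarrier n \<Longrightarrow> magma_mult p q \<in> ncarrier n"
  unfolding in_ncarrier by (auto simp: lookup_magma_mult split: magma.splits)

lemma ncarrier_sum: "(\<And>i. i \<in> A \<Longrightarrow> p i \<in> ncarrier n) \<Longrightarrow> (\<Sum>i\<in>A. p i) \<in> ncarrier n"
  by (induction A rule: infinite_finite_induct) (auto simp: ncarrier_closed)

lemma magma_map_superset:
  assumes "finite A" "Poly_Mapping.keys p \<subseteq> A"
  shows "magma_map k g p = (\<Sum>t\<in>A. scale (Poly_Mapping.lookup p t) (magma_subst k g t))"
  unfolding magma_map_def using assms
  by (intro sum.mono_neutral_left) (auto simp: in_keys_iff)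

lemma magma_map_add: "magma_map k g (p + q) = magma_map k g p + magma_map k g q"
proof -
  let ?A = "Poly_Mapping.keys p \<union> Poly_Mapping.keys q"
  have "Poly_Mapping.keys (p + q) \<subseteq> ?A" by (rule keys_add)
  thus ?thesis
    by (simp add: magma_map_superset[of ?A] lookup_add scale_add_left sum.distrib)
qed

lemma magma_map_scale: "magma_map k g (scale c p) = scale c (magma_map k g p)"
proof -
  have "Poly_Mapping.keys (scale c p) \<subseteq> Poly_Mapping.keys p" by (auto simp: in_keys_iff)
  thus ?thesis
    by (simp add: magma_map_superset[of "Poly_Mapping.keys p"] scale_sum scale_scale)
qed

lemma magma_map_zero [simp]: "magma_map k g 0 = 0"
  by (simp add: magma_map_def)

lemma magma_map_sum: "magma_map k g (\<Sum>i\<in>A. p i) = (\<Sum>i\<in>A. magma_map k g (p i))"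
  by (induction A rule: infinite_finite_induct) (auto simp: magma_map_add)

lemma magma_map_single: "magma_map k g (Poly_Mapping.single t x) = scale x (magma_subst k g t)"
  using magma_map_superset[of "{t}" "Poly_Mapping.single t x"] by simp

lemma magma_map_mult: "magma_map k g (magma_mult p q) = magma_mult (magma_map k g p) (magma_map k g q)"
proof -
  have "magma_map k g (magma_mult p q) = (\<Sum>s\<in>Poly_Mapping.keys p. \<Sum>t\<in>Poly_Mapping.keys q.
      scale (Poly_Mapping.lookup p s * Poly_Mapping.lookup q t) (magma_mult (magma_subst k g s) (magma_subst k g t)))"
    unfolding magma_mult_def[of p q] by (simp add: magma_map_sum magma_map_single)
  also have "\<dots> = magma_mult (magma_map k g p) (magma_map k g q)"
    unfolding magma_map_def
    by (simp only: magma_mult_sum_left)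
      (simp only: magma_mult_sum_right magma_mult_scale_left magma_mult_scale_right scale_scale mult.commute)
  finally show ?thesis .
qed

lemma magma_subst_ncarrier: "magma_subst k g t \<in> ncarrier k"
  by (induction t) (auto intro!: ncarrier_sum ncarrier_closed ncarrier_mult)

lemma magma_map_ncarrier: "magma_map k g p \<in> ncarrier k"
  unfolding magma_map_def by (intro ncarrier_sum ncarrier_closed magma_subst_ncarrier)

section \<open>The Lie ideal and its cosets\<close>

lemma magma_map_lie_ideal: "x \<in> lie_ideal n \<Longrightarrow> magma_map k g x \<in> lie_ideal k"
proof (induction rule: lie_ideal.induct)
  case (jacobi a b c)
  show ?case
    unfolding magma_map_add magma_map_mult by (intro lie_ideal.jacobi magma_map_ncarrier)
qed (auto simp: magma_map_add magma_map_scale magma_map_mult intro: lie_ideal.intros magma_map_ncarrier)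

lemma lie_ideal_diff: "x \<in> lie_ideal n \<Longrightarrow> y \<in> lie_ideal n \<Longrightarrow> x - y \<in> lie_ideal n"
  using lie_ideal.add[OF _ lie_ideal.scale, of x n y "-1"] by (simp add: scale_minus_one)

lemma lie_class_eq: "lie_class n p = {h + p | h. h \<in> lie_ideal n}"
  by (auto simp: a_r_coset_def' magma_algebra_def)

lemma lie_class_eq_iff: "lie_class n p = lie_class n q \<longleftrightarrow> p - q \<in> lie_ideal n"
proof
  assume "lie_class n p = lie_class n q"
  moreover have "p \<in> lie_class n p" unfolding lie_class_eq using lie_ideal.zero by force
  ultimately obtain h where "p = h + q" "h \<in> lie_ideal n" unfolding lie_class_eq by blast
  thus "p - q \<in> lie_ideal n" by simp
next
  assume pq: "p - q \<in> lie_ideal n"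
  show "lie_class n p = lie_class n q"
    unfolding lie_class_eq
  proof (intro equalityI subsetI; clarify)
    fix h assume h: "h \<in> lie_ideal n"
    have "h + p = (h + (p - q)) + q" "h + q = (h - (p - q)) + p" by simp_all
    thus "\<exists>h'. h + p = h' + q \<and> h' \<in> lie_ideal n" "\<exists>h'. h + q = h' + p \<and> h' \<in> lie_ideal n"
      using lie_ideal.add[OF h pq] lie_ideal_diff[OF h pq] by blast+
  qed
qed

lemma lie_class_zero: "lie_class n 0 = lie_ideal n"
  unfolding lie_class_eq by simp

lemma lie_class_add: "set_add (magma_algebra n) (lie_class n p) (lie_class n q) = lie_class n (p + q)"
proof -
  have "set_add (magma_algebra n) (lie_class n p) (lie_class n q)
      = {h + p + (h' + q) | h h'. h \<in> lie_ideal n \<and> h' \<in> lie_ideal n}"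
    unfolding set_add_def' lie_class_eq by (force simp: magma_algebra_def)
  also have "\<dots> = {h + (p + q) | h. h \<in> lie_ideal n}"
  proof (intro equalityI subsetI; clarify)
    fix h h' assume "h \<in> lie_ideal n" "h' \<in> lie_ideal n"
    thus "\<exists>k. h + p + (h' + q) = k + (p + q) \<and> k \<in> lie_ideal n"
      by (intro exI[of _ "h + h'"]) (auto intro: lie_ideal.add)
  next
    fix h assume "h \<in> lie_ideal n"
    thus "\<exists>k h'. h + (p + q) = k + p + (h' + q) \<and> k \<in> lie_ideal n \<and> h' \<in> lie_ideal n"
      by (intro exI[of _ h] exI[of _ 0]) (auto intro: lie_ideal.zero)
  qed
  finally show ?thesis by (simp add: lie_class_eq)
qed

text \<open>Scalar multiplication and induced maps on cosets are unions over all representatives. If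
  \<open>F\<close> is constant modulo the ideal, the union has only one distinct member.\<close>

lemma lie_class_union_map:
  assumes "\<And>h. h \<in> lie_ideal n \<Longrightarrow> F (h + p) - F p \<in> lie_ideal k"
  shows "(\<Union>x\<in>lie_class n p. lie_class k (F x)) = lie_class k (F p)"
proof -
  have "lie_class k (F x) = lie_class k (F p)" if "x \<in> lie_class n p" for x
    using that assms unfolding lie_class_eq_iff by (auto simp: lie_class_eq)
  moreover have "p \<in> lie_class n p" unfolding lie_class_eq using lie_ideal.zero by force
  ultimately show ?thesis by blast
qed

lemma lie_class_scale: "(\<Union>x\<in>lie_class n p. lie_class n (scale c x)) = lie_class n (scale c p)"
  by (rule lie_class_union_map) (simp add: scale_add lie_ideal.scale)

lemma free_lie_map_class: "free_lie_map k g (lie_class n p) = lie_class k (magma_map k g p)"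
  unfolding free_lie_map_def
  by (rule lie_class_union_map) (simp add: magma_map_add magma_map_lie_ideal)

text \<open>The value at the empty word is irrelevant.\<close>

fun bracket_word :: "nat list \<Rightarrow> nat magma" where
  "bracket_word [] = Gen 0"
| "bracket_word (x # w) = (if w = [] then Gen x else Op (Gen x) (bracket_word w))"

definition bracket_map :: "nat \<Rightarrow> nat \<Rightarrow> (nat list \<Rightarrow> rat) \<Rightarrow> nat magma \<Rightarrow>\<^sub>0 rat" where
  "bracket_map m n f = (\<Sum>w\<in>words m n. Poly_Mapping.single (bracket_word w) (f w))"

lemma bracket_map_add: "bracket_map m n (f + g) = bracket_map m n f + bracket_map m n g"
  by (simp add: bracket_map_def fun_app single_add sum.distrib)

lemma bracket_map_scale: "bracket_map m n (fscale c f) = scale c (bracket_map m n f)"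
  by (simp add: bracket_map_def fun_app scale_sum scale_single)

lemma bracket_map_diff: "bracket_map m n (f - g) = bracket_map m n f - bracket_map m n g"
proof -
  have "f - g = f + fscale (-1) g" by (simp add: fun_eq_iff fun_app)
  thus ?thesis by (simp only: bracket_map_add bracket_map_scale scale_minus_one) simp
qed

lemma bracket_map_zero [simp]: "bracket_map m n 0 = 0"
  by (simp add: bracket_map_def fun_app)

lemma bracket_word_letters: "w \<noteq> [] \<Longrightarrow> set_magma (bracket_word w) = set w"
  by (induction w) auto

lemma bracket_word_length: "w \<noteq> [] \<Longrightarrow> magma_length (bracket_word w) = length w"
  by (induction w) auto

lemma words_nonempty: "1 \<le> m \<Longrightarrow> w \<in> words m n \<Longrightarrow> w \<noteq> []"
  by (auto simp: words_def)

lemma bracket_map_ncarrier: "1 \<le> m \<Longrightarrow> bracket_map m n f \<in> ncarrier n"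
  unfolding bracket_map_def
  by (intro ncarrier_sum ncarrier_closed) (auto simp: bracket_word_letters words_nonempty words_def)

lemma bracket_map_homogeneous:
  assumes "1 \<le> m" "t \<in> Poly_Mapping.keys (bracket_map m n f)"
  shows "magma_length t = m"
proof -
  have "t \<in> (\<Union>w\<in>words m n. Poly_Mapping.keys (Poly_Mapping.single (bracket_word w) (f w)))"
    using assms(2) unfolding bracket_map_def by (rule subsetD[OF keys_sum, rotated])
  then obtain w where w: "w \<in> words m n" "t = bracket_word w" by (auto split: if_splits)
  thus ?thesis using bracket_word_length[OF words_nonempty[OF assms(1) w(1)]] length_words[OF w(1)] by simp
qed

text \<open>Substitution expands the right-normed bracket letter by letter. Lengths start at 1,
  because the dummy bracket of the empty word is not compatible with substitution.\<close>

lemma magma_subst_bracket_word: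
  assumes "w \<in> words (Suc d) n"
  shows "magma_subst k M (bracket_word w) =
    (\<Sum>v\<in>words (Suc d) k. Poly_Mapping.single (bracket_word v) (kern (Suc d) M v w))"
  using assms
proof (induction d arbitrary: w)
  case 0
  then obtain x where w: "w = [x]" by (auto elim!: wordsE_Suc)
  show ?case by (simp add: w sum_words_Suc)
next
  case (Suc d)
  obtain x u where w: "w = x # u" "x < n" "u \<in> words (Suc d) n" using wordsE_Suc[OF Suc.prems] .
  have ne: "v \<noteq> []" if "v \<in> words (Suc d) k" for v using that by (auto simp: words_def)
  have "u \<noteq> []" using w(3) by (auto simp: words_def)
  hence "magma_subst k M (bracket_word w) = magma_mult (\<Sum>i<k. Poly_Mapping.single (Gen i) (M $$ (i, x)))
      (\<Sum>v\<in>words (Suc d) k. Poly_Mapping.single (bracket_word v) (kern (Suc d) M v u))"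
    by (simp add: w(1) Suc.IH[OF w(3)])
  also have "\<dots> = (\<Sum>i<k. \<Sum>v\<in>words (Suc d) k. Poly_Mapping.single (Op (Gen i) (bracket_word v)) (M $$ (i, x) * kern (Suc d) M v u))"
    by (simp only: magma_mult_sum_left) (simp only: magma_mult_sum_right magma_mult_single)
  also have "\<dots> = (\<Sum>i<k. \<Sum>v\<in>words (Suc d) k.
      Poly_Mapping.single (bracket_word (i # v)) (kern (Suc (Suc d)) M (i # v) w))"
    unfolding w(1) kern_Cons using ne by (intro sum.cong refl) simp
  also have "\<dots> = (\<Sum>v\<in>words (Suc (Suc d)) k. Poly_Mapping.single (bracket_word v) (kern (Suc (Suc d)) M v w))"
    by (rule sum_words_Suc[symmetric])
  finally show ?case .
qed

lemma magma_map_bracket_map: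
  assumes "1 \<le> m"
  shows "magma_map k M (bracket_map m n f) = bracket_map m k (tact m k n M f)"
proof -
  obtain d where m: "m = Suc d" using assms by (cases m) auto
  have "magma_map k M (bracket_map m n f)
      = (\<Sum>w\<in>words m n. \<Sum>v\<in>words m k. Poly_Mapping.single (bracket_word v) (kern m M v w * f w))"
    unfolding bracket_map_def magma_map_sum magma_map_single m
    by (intro sum.cong refl) (simp add: magma_subst_bracket_word scale_sum scale_single mult.commute)
  also have "\<dots> = (\<Sum>v\<in>words m k. Poly_Mapping.single (bracket_word v) (tact m k n M f v))"
    by (subst sum.swap) (simp add: tact_def single_sum)
  finally show ?thesis by (simp add: bracket_map_def)
qed

section \<open>Right-normed brackets span each degree\<close>

definition bracketed :: "nat \<Rightarrow> nat \<Rightarrow> (nat magma \<Rightarrow>\<^sub>0 rat) set" where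
  "bracketed m n = {p. \<exists>f\<in>funs (words m n). p - bracket_map m n f \<in> lie_ideal n}"

lemma bracketed_add:
  assumes "p \<in> bracketed m n" "q \<in> bracketed m n"
  shows "p + q \<in> bracketed m n"
proof -
  obtain f g where f: "f \<in> funs (words m n)" "p - bracket_map m n f \<in> lie_ideal n"
    and g: "g \<in> funs (words m n)" "q - bracket_map m n g \<in> lie_ideal n"
    using assms by (auto simp: bracketed_def)
  have eq: "p + q - bracket_map m n (f + g) = (p - bracket_map m n f) + (q - bracket_map m n g)"
    by (simp add: bracket_map_add)
  have "p + q - bracket_map m n (f + g) \<in> lie_ideal n"
    unfolding eq by (rule lie_ideal.add[OF f(2) g(2)])
  thus ?thesis
    using fv.subspace_add[OF subspace_funs f(1) g(1)] unfolding bracketed_def by blast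
qed

lemma bracketed_scale:
  assumes "p \<in> bracketed m n"
  shows "scale c p \<in> bracketed m n"
proof -
  obtain f where f: "f \<in> funs (words m n)" "p - bracket_map m n f \<in> lie_ideal n"
    using assms by (auto simp: bracketed_def)
  have "scale c p - bracket_map m n (fscale c f) = scale c (p - bracket_map m n f)"
    by (rule poly_mapping_eqI) (simp add: bracket_map_scale lookup_minus algebra_simps)
  hence "scale c p - bracket_map m n (fscale c f) \<in> lie_ideal n"
    using lie_ideal.scale[OF f(2), of c] by (simp only:)
  thus ?thesis
    using fv.subspace_scale[OF subspace_funs f(1), of c] unfolding bracketed_def by blast
qed

lemma bracketed_congruent:
  assumes "p \<in> bracketed m n" "q - p \<in> lie_ideal n"
  shows "q \<in> bracketed m n"
proof -
  obtain f where f: "f \<in> funs (words m n)" "p - bracket_map m n f \<in> lie_ideal n"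
    using assms by (auto simp: bracketed_def)
  have "q - bracket_map m n f = (q - p) + (p - bracket_map m n f)" by simp
  hence "q - bracket_map m n f \<in> lie_ideal n" using lie_ideal.add[OF assms(2) f(2)] by (simp only:)
  thus ?thesis using f(1) unfolding bracketed_def by blast
qed

lemma bracketed_sum: "(\<And>i. i \<in> A \<Longrightarrow> p i \<in> bracketed m n) \<Longrightarrow> (\<Sum>i\<in>A. p i) \<in> bracketed m n"
proof (induction A rule: infinite_finite_induct)
  case empty
  show ?case
    using fv.subspace_0[OF subspace_funs] lie_ideal.zero by (auto simp: bracketed_def intro!: bexI[of _ 0])
next
  case (infinite A)
  show ?case
    using fv.subspace_0[OF subspace_funs] lie_ideal.zero infinite by (auto simp: bracketed_def intro!: bexI[of _ 0])
qed (auto intro: bracketed_add)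

lemma bracketed_Gen_mult:
  assumes "1 \<le> m" "x < n" "p \<in> bracketed m n"
  shows "magma_mult (Poly_Mapping.single (Gen x) 1) p \<in> bracketed (Suc m) n"
proof -
  obtain f where f: "f \<in> funs (words m n)" "p - bracket_map m n f \<in> lie_ideal n"
    using assms(3) by (auto simp: bracketed_def)
  \<comment> \<open>Left multiplication by a generator prefixes its letter to every word, so
    \<open>f\<close> is placed on the words that begin with \<open>x\<close>.\<close>
  define g where "g = (\<lambda>w. if w \<in> words (Suc m) n \<and> hd w = x then f (tl w) else 0)"
  have "bracket_map (Suc m) n g = (\<Sum>i<n. \<Sum>w\<in>words m n. Poly_Mapping.single (bracket_word (i # w)) (g (i # w)))"
    unfolding bracket_map_def by (rule sum_words_Suc)
  also have "\<dots> = (\<Sum>i<n. if i = x then (\<Sum>w\<in>words m n. Poly_Mapping.single (Op (Gen x) (bracket_word w)) (f w)) else 0)"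
  proof (intro sum.cong refl)
    fix i assume i: "i \<in> {..<n}"
    show "(\<Sum>w\<in>words m n. Poly_Mapping.single (bracket_word (i # w)) (g (i # w)))
      = (if i = x then (\<Sum>w\<in>words m n. Poly_Mapping.single (Op (Gen x) (bracket_word w)) (f w)) else 0)"
      using i words_nonempty[OF assms(1)] by (auto simp: g_def intro!: sum.cong sum.neutral)
  qed
  also have "\<dots> = (\<Sum>w\<in>words m n. Poly_Mapping.single (Op (Gen x) (bracket_word w)) (f w))"
    using assms(2) by simp
  also have "\<dots> = magma_mult (Poly_Mapping.single (Gen x) 1) (bracket_map m n f)"
    by (simp add: bracket_map_def magma_mult_sum_right magma_mult_single)
  finally have "magma_mult (Poly_Mapping.single (Gen x) 1) p - bracket_map (Suc m) n g
      = magma_mult (Poly_Mapping.single (Gen x) 1) (p - bracket_map m n f)"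
    by (simp add: magma_mult_diff_right)
  also have "\<dots> \<in> lie_ideal n"
    using assms(2) by (intro lie_ideal.mult_left f(2) ncarrier_closed) auto
  finally have "magma_mult (Poly_Mapping.single (Gen x) 1) p - bracket_map (Suc m) n g \<in> lie_ideal n" .
  moreover have "g \<in> funs (words (Suc m) n)" by (simp add: g_def funs_def)
  ultimately show ?thesis unfolding bracketed_def by blast
qed

lemma magma_mult_anticommute:
  assumes "a \<in> ncarrier n" "b \<in> ncarrier n"
  shows "magma_mult a b + magma_mult b a \<in> lie_ideal n"
proof -
  have "magma_mult (a + b) (a + b) - magma_mult a a - magma_mult b b \<in> lie_ideal n"
    using assms by (intro lie_ideal_diff lie_ideal.alternating ncarrier_closed)
  thus ?thesis by (simp add: magma_mult_add_left magma_mult_add_right add.commute)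
qed

text \<open>Modulo the ideal [[s, t], p] = [s, [t, p]] - [t, [s, p]]. Induction on the left factor
  moves all nesting to the right until only generators multiply from the left.\<close>

lemma bracketed_mult:
  assumes "set_magma t \<subseteq> {..<n}" "1 \<le> d" "p \<in> bracketed d n" "p \<in> ncarrier n"
  shows "magma_mult (Poly_Mapping.single t 1) p \<in> bracketed (magma_length t + d) n"
  using assms
proof (induction t arbitrary: d p)
  case (Gen x)
  then show ?case using bracketed_Gen_mult by simp
next
  case (Op s t)
  let ?a = "Poly_Mapping.single s (1 :: rat)" and ?b = "Poly_Mapping.single t (1 :: rat)"
  have c: "?a \<in> ncarrier n" "?b \<in> ncarrier n" "p \<in> ncarrier n"
    using Op.prems by (auto intro: ncarrier_closed)
  have "magma_mult ?a (magma_mult ?b p) \<in> bracketed (magma_length s + (magma_length t + d)) n"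
    using Op.prems c by (intro Op.IH ncarrier_mult) auto
  moreover have "magma_mult ?b (magma_mult ?a p) \<in> bracketed (magma_length t + (magma_length s + d)) n"
    using Op.prems c by (intro Op.IH ncarrier_mult) auto
  hence "scale (-1) (magma_mult ?b (magma_mult ?a p)) \<in> bracketed (magma_length s + (magma_length t + d)) n"
    using bracketed_scale by (simp add: ac_simps)
  ultimately have "magma_mult ?a (magma_mult ?b p) + scale (-1) (magma_mult ?b (magma_mult ?a p))
      \<in> bracketed (magma_length s + (magma_length t + d)) n"
    by (rule bracketed_add)
  moreover have "magma_mult (magma_mult ?a ?b) p
      - (magma_mult ?a (magma_mult ?b p) + scale (-1) (magma_mult ?b (magma_mult ?a p))) \<in> lie_ideal n"
  proof -
    have 1: "magma_mult (magma_mult ?a ?b) p + magma_mult p (magma_mult ?a ?b) \<in> lie_ideal n"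
      by (intro magma_mult_anticommute ncarrier_mult c)
    have 2: "magma_mult ?b (magma_mult ?a p + magma_mult p ?a) \<in> lie_ideal n"
      by (intro lie_ideal.mult_left magma_mult_anticommute c)
    \<comment> \<open>Before passing to the quotient, the Jacobi rule in this form takes two
      anticommutators, one of them inside a product with \<open>?b\<close>, and one Jacobi
      expression.\<close>
    have eq: "magma_mult (magma_mult ?a ?b) p
        - (magma_mult ?a (magma_mult ?b p) + scale (-1) (magma_mult ?b (magma_mult ?a p)))
      = (magma_mult (magma_mult ?a ?b) p + magma_mult p (magma_mult ?a ?b))
        + magma_mult ?b (magma_mult ?a p + magma_mult p ?a)
        - (magma_mult ?a (magma_mult ?b p) + magma_mult ?b (magma_mult p ?a) + magma_mult p (magma_mult ?a ?b))"
      by (simp add: scale_minus_one magma_mult_add_right)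
    show ?thesis unfolding eq by (rule lie_ideal_diff[OF lie_ideal.add[OF 1 2] lie_ideal.jacobi[OF c]])
  qed
  ultimately have "magma_mult (magma_mult ?a ?b) p \<in> bracketed (magma_length s + (magma_length t + d)) n"
    by (rule bracketed_congruent)
  thus ?case by (simp add: magma_mult_single ac_simps)
qed

lemma magma_length_pos: "1 \<le> magma_length t"
  by (induction t) auto

lemma single_bracketed:
  "set_magma t \<subseteq> {..<n} \<Longrightarrow> Poly_Mapping.single t 1 \<in> bracketed (magma_length t) n"
proof (induction t)
  case (Gen x)
  define f where "f = (\<lambda>w. if w = [x] then 1 else 0 :: rat)"
  have "bracket_map 1 n f = (\<Sum>i<n. if i = x then Poly_Mapping.single (Gen x) 1 else 0)"
    unfolding bracket_map_def One_nat_def sum_words_Suc by (intro sum.cong refl) (simp add: f_def)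
  also have "\<dots> = Poly_Mapping.single (Gen x) 1" using Gen by simp
  finally have "Poly_Mapping.single (Gen x) 1 - bracket_map 1 n f \<in> lie_ideal n" by (simp add: lie_ideal.zero)
  moreover have "f \<in> funs (words 1 n)" using Gen by (auto simp: f_def funs_def words_def)
  ultimately show ?case unfolding bracketed_def by auto
next
  case (Op s t)
  have "magma_mult (Poly_Mapping.single s 1) (Poly_Mapping.single t 1)
      \<in> bracketed (magma_length s + magma_length t) n"
    using Op by (intro bracketed_mult magma_length_pos ncarrier_closed) auto
  thus ?case by (simp add: magma_mult_single)
qed

lemma homogeneous_bracketed:
  assumes "p \<in> ncarrier n" "\<forall>t\<in>Poly_Mapping.keys p. magma_length t = m"
  shows "p \<in> bracketed m n"
proof -
  have p: "p = (\<Sum>t\<in>Poly_Mapping.keys p. scale (Poly_Mapping.lookup p t) (Poly_Mapping.single t 1))"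
  proof (rule poly_mapping_eqI)
    fix u
    have "Poly_Mapping.lookup (\<Sum>t\<in>Poly_Mapping.keys p. scale (Poly_Mapping.lookup p t) (Poly_Mapping.single t 1)) u
      = (\<Sum>t\<in>Poly_Mapping.keys p. if t = u then Poly_Mapping.lookup p u else 0)"
      unfolding lookup_sum by (intro sum.cong refl) (simp add: lookup_single when_def)
    also have "\<dots> = Poly_Mapping.lookup p u" by (simp add: in_keys_iff)
    finally show "Poly_Mapping.lookup p u = Poly_Mapping.lookup
      (\<Sum>t\<in>Poly_Mapping.keys p. scale (Poly_Mapping.lookup p t) (Poly_Mapping.single t 1)) u" ..
  qed
  have "scale (Poly_Mapping.lookup p t) (Poly_Mapping.single t 1) \<in> bracketed m n"
    if t: "t \<in> Poly_Mapping.keys p" for t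
  proof -
    have "set_magma t \<subseteq> {..<n}" using assms(1) t by (simp add: in_ncarrier in_keys_iff)
    from bracketed_scale[OF single_bracketed[OF this]] show ?thesis using assms(2) t by simp
  qed
  thus ?thesis by (subst p) (rule bracketed_sum)
qed

section \<open>A tensor model of the graded component\<close>

definition lie_kernel :: "nat \<Rightarrow> nat \<Rightarrow> (nat list \<Rightarrow> rat) set" where
  "lie_kernel m n = {f \<in> funs (words m n). bracket_map m n f \<in> lie_ideal n}"

text \<open>The orthogonal complement of the kernel is a functorial model of \<open>\<L>\<^sub>m\<close>.\<close>

definition lie_model :: "nat \<Rightarrow> nat \<Rightarrow> (nat list \<Rightarrow> rat) set" where
  "lie_model m n = orth_in (words m n) (funs (words m n)) (lie_kernel m n)"

definition lie_rep_map :: "nat \<Rightarrow> nat \<Rightarrow> (nat list \<Rightarrow> rat) \<Rightarrow> (nat magma \<Rightarrow>\<^sub>0 rat) set" where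
  "lie_rep_map m n f = lie_class n (bracket_map m n f)"

lemma subspace_lie_kernel: "fv.subspace (lie_kernel m n)"
  unfolding fv.subspace_def lie_kernel_def
  using fv.subspace_0[OF subspace_funs] fv.subspace_add[OF subspace_funs] fv.subspace_scale[OF subspace_funs]
  by (auto simp: bracket_map_add bracket_map_scale intro: lie_ideal.intros)

lemma subspace_lie_model: "fv.subspace (lie_model m n)"
  unfolding lie_model_def by (rule subspace_orth_in[OF subspace_funs])

lemma lie_model_funs: "lie_model m n \<subseteq> funs (words m n)"
  by (auto simp: lie_model_def orth_in_def)

lemma tact_lie_model:
  assumes m: "1 \<le> m" and M: "M \<in> carrier_mat k n" and f: "f \<in> lie_model m n"
  shows "tact m k n M f \<in> lie_model m k"
proof -
  have "ip (words m k) (tact m k n M f) g = 0" if "g \<in> lie_kernel m k" for g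
  proof -
    have "tact m n k (transpose_mat M) g \<in> lie_kernel m n"
      using that magma_map_lie_ideal[of "bracket_map m k g" k n "transpose_mat M"]
      by (auto simp: lie_kernel_def tact_funs magma_map_bracket_map[OF m])
    thus ?thesis using f unfolding ip_tact[OF M] lie_model_def orth_in_def by blast
  qed
  thus ?thesis by (auto simp: lie_model_def orth_in_def tact_funs)
qed

text \<open>Injectivity: a difference lying both in the kernel and in its orthogonal complement has
  norm zero. Surjectivity: right-normed brackets represent every class, and subtracting the kernel
  component of the tensor does not change the class.\<close>

lemma bij_lie_rep_map:
  assumes m: "1 \<le> m"
  shows "bij_betw (lie_rep_map m n) (lie_model m n) (lie_component m n)"
proof (rule bij_betwI')
  fix f g assume f: "f \<in> lie_model m n" and g: "g \<in> lie_model m n"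
  have fg: "f - g \<in> lie_model m n" using f g fv.subspace_diff[OF subspace_lie_model] by blast
  show "lie_rep_map m n f = lie_rep_map m n g \<longleftrightarrow> f = g"
  proof
    assume "lie_rep_map m n f = lie_rep_map m n g"
    hence "f - g \<in> lie_kernel m n"
      using fg lie_model_funs by (auto simp: lie_rep_map_def lie_class_eq_iff lie_kernel_def bracket_map_diff)
    hence "ip (words m n) (f - g) (f - g) = 0" using fg by (simp add: lie_model_def orth_in_def)
    hence "f - g = 0" using ip_self_zero[OF finite_words] fg lie_model_funs by blast
    thus "f = g" by simp
  qed simp
next
  fix f assume "f \<in> lie_model m n"
  show "lie_rep_map m n f \<in> lie_component m n"
    unfolding lie_rep_map_def lie_component_def
    using bracket_map_ncarrier[OF m] bracket_map_homogeneous[OF m] by blast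
next
  fix X assume "X \<in> lie_component m n"
  then obtain p where p: "p \<in> ncarrier n" "\<forall>t\<in>Poly_Mapping.keys p. magma_length t = m" "X = lie_class n p"
    by (auto simp: lie_component_def)
  obtain f where f: "f \<in> funs (words m n)" "p - bracket_map m n f \<in> lie_ideal n"
    using homogeneous_bracketed[OF p(1,2)] by (auto simp: bracketed_def)
  have "lie_kernel m n \<subseteq> funs (words m n)" by (auto simp: lie_kernel_def)
  from orth_projection[OF finite_words subspace_lie_kernel this, of f]
  obtain y where y: "y \<in> lie_kernel m n" "\<forall>k\<in>lie_kernel m n. ip (words m n) (f - y) k = 0" by blast
  have "f - y \<in> lie_model m n"
    using f(1) y fv.subspace_diff[OF subspace_funs] by (auto simp: lie_model_def orth_in_def lie_kernel_def)
  moreover have "X = lie_rep_map m n (f - y)"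
    unfolding p(3) lie_rep_map_def lie_class_eq_iff bracket_map_diff
    using lie_ideal.add[OF f(2), of "bracket_map m n y"] y(1) by (simp add: lie_kernel_def algebra_simps)
  ultimately show "\<exists>x\<in>lie_model m n. X = lie_rep_map m n x" by blast
qed

lemma coord_rep_free_lie:
  assumes m: "1 \<le> m"
  shows "coord_rep n (free_lie_rep m n) (lie_model m n) (lie_rep_map m n) (tact m n n)"
proof
  show "fv.subspace (lie_model m n)" by (rule subspace_lie_model)
  show "bij_betw (lie_rep_map m n) (lie_model m n) (carrier (free_lie_rep m n))"
    using bij_lie_rep_map[OF m] by (simp add: free_lie_rep_def)
  show "lie_rep_map m n 0 = \<zero>\<^bsub>free_lie_rep m n\<^esub>"
    by (simp add: lie_rep_map_def free_lie_rep_def free_lie_def lie_class_zero)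
next
  fix x y c
  show "lie_rep_map m n (x + y) = lie_rep_map m n x \<oplus>\<^bsub>free_lie_rep m n\<^esub> lie_rep_map m n y"
    by (simp add: lie_rep_map_def free_lie_rep_def free_lie_def lie_class_add bracket_map_add)
  show "lie_rep_map m n (fscale c x) = c \<odot>\<^bsub>free_lie_rep m n\<^esub> lie_rep_map m n x"
    by (simp add: lie_rep_map_def free_lie_rep_def free_lie_def lie_class_scale bracket_map_scale)
next
  fix g x assume g: "g \<in> carrier (GL n)" and x: "x \<in> lie_model m n"
  show "tact m n n g x \<in> lie_model m n" by (rule tact_lie_model[OF m GL_mat[OF g] x])
  show "act (free_lie_rep m n) g (lie_rep_map m n x) = lie_rep_map m n (tact m n n g x)"
    by (simp add: lie_rep_map_def free_lie_rep_def free_lie_map_class magma_map_bracket_map[OF m])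
  fix h assume "h \<in> carrier (GL n)"
  thus "tact m n n (g * h) x = tact m n n g (tact m n n h x)" using g by (simp add: tact_mult GL_mat)
next
  show "tact m n n (1\<^sub>m n) x = x" if "x \<in> lie_model m n" for x
    using that lie_model_funs by (intro tact_one) blast
qed (rule lin_on_tact)

lemma free_lie_incl_map:
  assumes m: "1 \<le> m"
  shows "free_lie_incl n (lie_rep_map m n x) = lie_rep_map m (Suc n) (tact m (Suc n) n (emb (Suc n) n) x)"
  by (simp add: free_lie_incl_def lie_rep_map_def free_lie_map_class magma_map_bracket_map[OF m] inclusion_mat_eq)

section \<open>Subfunctors of the tensor power are simply representation stable\<close>

lemma stab_tact_iff:
  assumes "coord_rep n U X \<theta> (tact d n n)" "stable d n X"
  shows "coord_rep.stab n X (tact d n n) Y \<longleftrightarrow> stable d n Y \<and> Y \<subseteq> X"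
  unfolding coord_rep.stab_def[OF assms(1)]
  using stableI_GL[of Y d n] stableD[of d n Y] stableD(2)[OF assms(2)] by (auto simp: GL_mat)

lemma irreducible_tact_iff:
  assumes "coord_rep n U X \<theta> (tact d n n)" "stable d n X"
  shows "irreducible_rep n U \<longleftrightarrow> tens.simple d n X"
  unfolding coord_rep.irreducible_rep_iff[OF assms(1)] stab_tact_iff[OF assms] tens_simple_iff
  using assms(2) by blast

lemma rep_iso_tact_iff:
  assumes "coord_rep n U X \<theta> (tact d n n)" "coord_rep n U' Y \<theta>' (tact d n n)" "stable d n X"
  shows "rep_iso n U U' \<longleftrightarrow> tiso d n X Y"
  unfolding coord_rep_iso[OF assms(1,2)] tiso_def
proof (intro iffI; elim exE conjE)
  fix \<psi> assume "lin_on X \<psi>" "bij_betw \<psi> X Y"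
    "\<forall>g\<in>carrier (GL n). \<forall>x\<in>X. \<psi> (tact d n n g x) = tact d n n g (\<psi> x)"
  thus "\<exists>\<psi>. lin_on X \<psi> \<and> bij_betw \<psi> X Y \<and>
      (\<forall>M\<in>carrier_mat n n. \<forall>x\<in>X. \<psi> (tact d n n M x) = tact d n n M (\<psi> x))"
    using equivariant_of_GL[OF assms(3)] by blast
next
  fix \<psi> assume "lin_on X \<psi>" "bij_betw \<psi> X Y"
    "\<forall>M\<in>carrier_mat n n. \<forall>x\<in>X. \<psi> (tact d n n M x) = tact d n n M (\<psi> x)"
  thus "\<exists>\<psi>. lin_on X \<psi> \<and> bij_betw \<psi> X Y \<and>
      (\<forall>g\<in>carrier (GL n). \<forall>x\<in>X. \<psi> (tact d n n g x) = tact d n n g (\<psi> x))"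
    using GL_mat by blast
qed

lemma num_rows_le_sum_list: "num_rows l \<le> sum_list l"
  unfolding num_rows_def by (induction l) auto

lemma tact_homothety: "f \<in> funs (words d n) \<Longrightarrow> tact d n n (diagm n (\<lambda>_. c)) f = fscale (c ^ d) f"
  by (auto simp: tact_diagm fscale_def)

text \<open>The scalar matrix \<open>2\<close> acts by \<open>2 ^ m\<close> on one side and by \<open>2 ^ sum_list l\<close> on the other.\<close>

lemma iso_schur_degree:
  assumes X: "coord_rep n U X \<theta> (tact m n n)" "X \<subseteq> funs (words m n)"
    and l: "is_partition l" "num_rows l \<le> n" and iso: "rep_iso n U (schur l n)"
  shows "sum_list l = m"
proof -
  obtain \<psi> where \<psi>: "lin_on X \<psi>" "bij_betw \<psi> X (schur_set l n)"
    "\<And>g x. g \<in> carrier (GL n) \<Longrightarrow> x \<in> X \<Longrightarrow> \<psi> (tact m n n g x) = tact (sum_list l) n n g (\<psi> x)"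
    using iso unfolding coord_rep_iso[OF X(1) coord_rep_schur] by blast
  have "hw_vector l \<in> \<psi> ` X" using hw_vector_in_schur_set[OF l] \<psi>(2) by (simp add: bij_betw_def)
  then obtain x where x: "x \<in> X" "\<psi> x = hw_vector l" by force
  have g: "diagm n (\<lambda>_. 2) \<in> carrier (GL n)" by (simp add: GL_carrier det_diagm)
  have "fscale (2 ^ m) (hw_vector l) = fscale (2 ^ sum_list l) (hw_vector l)"
    using \<psi>(3)[OF g x(1)] x X(2) hw_vector_funs[OF l] lin_on_scale[OF \<psi>(1) x(1)]
    by (simp add: tact_homothety subset_iff)
  hence "(2 :: rat) ^ m * hw_vector l (row_word l) = 2 ^ sum_list l * hw_vector l (row_word l)"
    by (metis fscale_apply)
  thus ?thesis using hw_vector_row_word_nonzero by simp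
qed

text \<open>The matrix \<open>diag (1, \<dots>, 1, 2)\<close> has eigenvalues at least \<open>1\<close> on tensors, but \<open>2 powi last l < 1\<close> on the
  highest weight vector of \<open>V_rep l n\<close>, which does not involve the last letter.\<close>

lemma det_twist_no_polynomial_iso:
  assumes X: "coord_rep n U X \<theta> (tact m n n)" "X \<subseteq> funs (words m n)"
    and l: "is_pseudo_partition l" "last l < 0" "length l \<le> n"
  shows "\<not> rep_iso n U (V_rep l n)"
proof
  assume iso: "rep_iso n U (V_rep l n)"
  define \<nu> where "\<nu> = map (\<lambda>a. nat (a - last l)) l"
  have ne: "l \<noteq> []" and srt: "sorted_wrt (\<ge>) l" using l(1) by (auto simp: is_pseudo_partition_def)
  have n: "1 \<le> n" using ne l(3) by (cases l) auto
  have part: "is_partition \<nu>"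
    unfolding is_partition_def \<nu>_def sorted_wrt_map using srt by (rule sorted_wrt_mono_rel[rotated]) auto
  \<comment> \<open>The last part of \<nu> is 0, so the highest weight vector makes do with the
    letters below \<open>n - 1\<close>.\<close>
  have "num_rows \<nu> \<le> n - 1"
  proof -
    have "\<nu> = map (\<lambda>a. nat (a - last l)) (butlast l @ [last l])" using ne by (simp add: \<nu>_def)
    hence "\<nu> = map (\<lambda>a. nat (a - last l)) (butlast l) @ [0]" by simp
    hence "num_rows \<nu> \<le> length (butlast l)"
      unfolding num_rows_def using length_filter_le[of "\<lambda>a. a \<noteq> 0" "map (\<lambda>a. nat (a - last l)) (butlast l)"] by simp
    thus ?thesis using l(3) by simp
  qed
  hence vf: "hw_vector \<nu> \<in> funs (words (sum_list \<nu>) (n - 1))" and nr: "num_rows \<nu> \<le> n"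
    using hw_vector_funs[OF part] by auto
  have V: "V_rep l n = det_twist (last l) (schur \<nu> n)" by (simp add: V_rep_def \<nu>_def)
  obtain \<psi> where \<psi>: "lin_on X \<psi>" "bij_betw \<psi> X (schur_set \<nu> n)"
    "\<And>g x. g \<in> carrier (GL n) \<Longrightarrow> x \<in> X \<Longrightarrow>
      \<psi> (tact m n n g x) = fscale (det g powi last l) (tact (sum_list \<nu>) n n g (\<psi> x))"
    using iso unfolding V coord_rep_iso[OF X(1) coord_rep_det_twist[OF coord_rep_schur]] by blast
  have "hw_vector \<nu> \<in> \<psi> ` X" using hw_vector_in_schur_set[OF part nr] \<psi>(2) by (simp add: bij_betw_def)
  then obtain x where x: "x \<in> X" "\<psi> x = hw_vector \<nu>" by force
  define e where "e = (\<lambda>i. if i = n - 1 then 2 else 1 :: rat)"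
  define g where "g = diagm n e"
  have "(\<Prod>i<n. e i) = 2" using n by (simp add: e_def prod.delta)
  hence g: "g \<in> carrier (GL n)" "det g = 2" by (simp_all add: g_def GL_carrier det_diagm)
  have "tact (sum_list \<nu>) n n g (hw_vector \<nu>) = hw_vector \<nu>"
  proof
    fix w
    have "(\<Prod>k<sum_list \<nu>. e (w ! k)) = 1" if "w \<in> words (sum_list \<nu>) (n - 1)"
    proof (intro prod.neutral ballI)
      fix k assume "k \<in> {..<sum_list \<nu>}"
      thus "e (w ! k) = 1" using nth_words[OF that, of k] by (simp add: e_def)
    qed
    thus "tact (sum_list \<nu>) n n g (hw_vector \<nu>) w = hw_vector \<nu> w"
      using vf hw_vector_funs[OF part nr] by (auto simp: g_def tact_diagm funs_def)
  qed
  hence "\<psi> (tact m n n g x) = \<psi> (fscale (2 powi last l) x)"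
    using \<psi>(3)[OF g(1) x(1)] x(2) lin_on_scale[OF \<psi>(1) x(1)] by (simp add: g(2))
  moreover have "tact m n n g x \<in> X" "fscale (2 powi last l) x \<in> X"
    using x(1) coord_rep.\<alpha>_closed[OF X(1) g(1)] coord_rep.P_closed(2)[OF X(1)] by auto
  ultimately have eq: "tact m n n g x = fscale (2 powi last l) x"
    using \<psi>(2) by (auto simp: bij_betw_def inj_on_def)
  have "x \<noteq> 0"
    using x(2) lin_on_zero[OF \<psi>(1) coord_rep.subspace_P[OF X(1)]] hw_vector_nonzero by auto
  then obtain w where w: "x w \<noteq> 0" by (auto simp: fun_eq_iff zero_fun_apply)
  have "(\<Prod>k<m. e (w ! k)) * x w = 2 powi last l * x w"
    using fun_cong[OF eq, of w] x(1) X(2) by (simp add: g_def tact_diagm subset_iff fun_app)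
  hence "(\<Prod>k<m. e (w ! k)) = 2 powi last l" using w by simp
  moreover have "(\<Prod>k<m. e (w ! k)) \<ge> 1" by (intro prod_ge_1) (simp add: e_def)
  moreover have "(2 :: rat) powi last l < 1"
    using power_int_strict_increasing[of "last l" 0 "2 :: rat"] l(2) by simp
  ultimately show False by simp
qed

text \<open>A matrix to \<open>N\<close> letters, precomposed with the projection
  \<open>emb n N\<close>, becomes square without changing its effect on \<open>X\<close>; square
  matrices act as combinations of invertible ones. This turns orbit spans into values of
  \<open>gen\<close>.\<close>

lemma span_GL_orbit:
  assumes "X \<subseteq> funs (words d n)" "n \<le> N"
  shows "fv.span {tact d N N g x | g x. g \<in> carrier (GL N) \<and> x \<in> X} = gen d n N X"
proof
  have fixed: "tact d N n (emb N n) x = x" "tact d n N (emb n N) x = x" if "x \<in> X" for x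
    using that assms funs_words_mono[OF assms(2), of d] by (auto intro!: tact_emb_fixed)
  show "fv.span {tact d N N g x | g x. g \<in> carrier (GL N) \<and> x \<in> X} \<subseteq> gen d n N X"
  proof (rule fv.span_minimal[OF _ subspace_gen], safe)
    fix g x assume g: "g \<in> carrier (GL N)" and x: "x \<in> X"
    have "tact d N N g x = tact d N n (g * emb N n) x"
      using tact_mult[OF GL_mat[OF g] emb_carrier, of d n x] fixed(1)[OF x] by simp
    thus "tact d N N g x \<in> gen d n N X"
      using tact_in_gen[of "g * emb N n" N n x X d] GL_mat[OF g] x by (simp add: mult_carrier_mat[OF _ emb_carrier])
  qed
  show "gen d n N X \<subseteq> fv.span {tact d N N g x | g x. g \<in> carrier (GL N) \<and> x \<in> X}"
  proof (rule gen_minimal[OF fv.subspace_span])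
    fix M :: "rat mat" and x assume M: "M \<in> carrier_mat N n" and x: "x \<in> X"
    have "M * emb n N \<in> carrier_mat N N" using M by (simp add: mult_carrier_mat[OF _ emb_carrier])
    from kern_in_GL_span[OF this] obtain L where L: "snd ` set L \<subseteq> carrier (GL N)"
      "\<And>f. tact d N N (M * emb n N) f = comb (\<lambda>g. tact d N N g f) L" by metis
    have "tact d N n M x = tact d N N (M * emb n N) x"
      using tact_mult[OF M emb_carrier, of d N x] fixed(2)[OF x] by simp
    also have "\<dots> \<in> fv.span {tact d N N g x | g x. g \<in> carrier (GL N) \<and> x \<in> X}"
      unfolding L(2) using L(1) x
      by (intro comb_in_subspace[OF fv.subspace_span] fv.span_base) blast
    finally show "tact d N n M x \<in> fv.span {tact d N N g x | g x. g \<in> carrier (GL N) \<and> x \<in> X}" .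
  qed
qed

lemma emb_GL_stab:
  assumes "g \<in> carrier (GL n)"
  shows "GL_stab n g \<in> carrier (GL (Suc n))" "emb (Suc n) n * g = GL_stab n g * emb (Suc n) n"
proof -
  have g: "g \<in> carrier_mat n n" "det g \<noteq> 0" using assms by (auto simp: GL_carrier)
  have c: "GL_stab n g \<in> carrier_mat (Suc n) (Suc n)"
    using four_block_carrier_mat[OF g(1), of "1\<^sub>m 1" 1 1] by (simp add: GL_stab_def)
  have "det (GL_stab n g) = det g * det (1\<^sub>m 1 :: rat mat)"
    unfolding GL_stab_def by (rule det_four_block_mat_upper_right_zero[OF g(1)]) auto
  thus "GL_stab n g \<in> carrier (GL (Suc n))" using c g(2) by (simp add: GL_carrier)
  show "emb (Suc n) n * g = GL_stab n g * emb (Suc n) n"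
  proof (rule eq_matI)
    fix i j assume "i < dim_row (GL_stab n g * emb (Suc n) n)" "j < dim_col (GL_stab n g * emb (Suc n) n)"
    hence ij: "i < Suc n" "j < n" using c by (auto simp: emb_def)
    have "(emb (Suc n) n * g) $$ (i, j) = (\<Sum>a<n. (if a = i then g $$ (a, j) else 0))"
    proof -
      have "(emb (Suc n) n * g) $$ (i, j) = (\<Sum>a<n. emb (Suc n) n $$ (i, a) * g $$ (a, j))"
        using ij g(1) by (simp add: scalar_prod_def emb_def atLeast0LessThan)
      also have "\<dots> = (\<Sum>a<n. (if a = i then g $$ (a, j) else 0))"
        by (rule sum.cong) (use ij in \<open>auto simp: emb_def\<close>)
      finally show ?thesis .
    qed
    also have "\<dots> = GL_stab n g $$ (i, j)" using ij g(1) by (auto simp: GL_stab_def)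
    also have "\<dots> = (\<Sum>a<Suc n. (if a = j then GL_stab n g $$ (i, a) else 0))" using ij by simp
    also have "\<dots> = (GL_stab n g * emb (Suc n) n) $$ (i, j)"
    proof -
      have "(GL_stab n g * emb (Suc n) n) $$ (i, j) = (\<Sum>a<Suc n. GL_stab n g $$ (i, a) * emb (Suc n) n $$ (a, j))"
        using ij c by (simp add: scalar_prod_def emb_def atLeast0LessThan del: sum.lessThan_Suc sum.op_ivl_Suc)
      also have "\<dots> = (\<Sum>a<Suc n. (if a = j then GL_stab n g $$ (i, a) else 0))"
        by (rule sum.cong) (use ij in \<open>auto simp: emb_def\<close>)
      finally show ?thesis ..
    qed
    finally show "(emb (Suc n) n * g) $$ (i, j) = (GL_stab n g * emb (Suc n) n) $$ (i, j)" .
  qed (use c g(1) in \<open>auto simp: emb_def\<close>)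
qed

section \<open>Decomposition of a subfunctor of the tensor power\<close>

locale tensor_subfunctor =
  fixes m :: nat and P :: "nat \<Rightarrow> (nat list \<Rightarrow> rat) set"
  assumes P_funs: "P n \<subseteq> funs (words m n)"
    and P_subspace: "fv.subspace (P n)"
    and P_tact: "M \<in> carrier_mat k n \<Longrightarrow> x \<in> P n \<Longrightarrow> tact m k n M x \<in> P k"
begin

lemma stable_P: "stable m n (P n)"
  by (auto simp: stable_def P_subspace P_funs[THEN subsetD] intro: P_tact)

lemma gen_P_subset: "X \<subseteq> P n \<Longrightarrow> gen m n k X \<subseteq> P k"
  using P_subspace P_tact by (intro gen_minimal) auto

lemma P_mono: "n \<le> k \<Longrightarrow> P n \<subseteq> P k"
proof
  fix x assume "n \<le> k" "x \<in> P n"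
  hence "tact m k n (emb k n) x = x"
    using P_funs funs_words_mono by (intro tact_emb_fixed) blast+
  thus "x \<in> P k" using P_tact[OF emb_carrier \<open>x \<in> P n\<close>, of k] by simp
qed

text \<open>Let y - z be the part of an element of \<open>P N\<close> orthogonal to the left side.
  For a map \<open>M\<close> to \<open>n\<close> letters the norm of M (y - z) is the product of y -
  z with M^T M (y - z), an element of the left side, hence 0. As \<open>n\<close> is at least
  \<open>m\<close>, \<open>detect_by_letters\<close> gives y = z.\<close>

lemma gen_P:
  assumes "m \<le> n"
  shows "gen m n N (P n) = P N"
proof
  show "gen m n N (P n) \<subseteq> P N" by (rule gen_P_subset) simp
  show "P N \<subseteq> gen m n N (P n)"
  proof
    fix y assume y: "y \<in> P N"
    obtain z where z: "z \<in> gen m n N (P n)" "\<forall>k\<in>gen m n N (P n). ip (words m N) (y - z) k = 0"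
      using orth_projection[OF finite_words subspace_gen gen_funs] by blast
    have yz: "y - z \<in> P N"
      using y z(1) gen_P_subset[of "P n" n N] fv.subspace_diff[OF P_subspace] by blast
    have "tact m n N M (y - z) = 0" if M: "M \<in> carrier_mat n N" for M
    proof -
      have u: "tact m n N M (y - z) \<in> P n" by (rule P_tact[OF M yz])
      have "ip (words m n) (tact m n N M (y - z)) (tact m n N M (y - z))
        = ip (words m N) (y - z) (tact m N n (transpose_mat M) (tact m n N M (y - z)))"
        by (rule ip_tact[OF M])
      also have "\<dots> = 0" using z(2) M u by (intro bspec[OF z(2)] tact_in_gen) auto
      finally show ?thesis using ip_self_zero[OF finite_words] tact_funs by blast
    qed
    moreover have "y - z \<in> funs (words m N)" using yz P_funs by blast
    ultimately have "y - z = 0" using detect_by_letters[OF _ assms] by blast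
    thus "y \<in> gen m n N (P n)" using z(1) by simp
  qed
qed

text \<open>Summands with value zero on \<open>n\<close> letters are removed. The others keep
  distinct values, since a common nonzero value would be orthogonal to itself.\<close>

lemma orth_decomposition_gen:
  fixes n :: nat
  assumes D: "tens.orth_decomposition m m (P m) \<W>"
  defines "\<X> \<equiv> {W \<in> \<W>. gen m m n W \<noteq> {0}}"
  shows "tens.orth_decomposition m n (P n) (gen m m n ` \<X>)" "inj_on (gen m m n) \<X>"
proof -
  have W: "finite \<W>" "\<And>W. W \<in> \<W> \<Longrightarrow> tens.simple m m W" "fv.span (\<Union>\<W>) = P m"
    "\<And>W W' x y. W \<in> \<W> \<Longrightarrow> W' \<in> \<W> \<Longrightarrow> W \<noteq> W' \<Longrightarrow> x \<in> W \<Longrightarrow> y \<in> W' \<Longrightarrow> ip (words m m) x y = 0"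
    using D unfolding tens.orth_decomposition_def by blast+
  have orth: "ip (words m n) x y = 0"
    if "W \<in> \<W>" "W' \<in> \<W>" "W \<noteq> W'" "x \<in> gen m m n W" "y \<in> gen m m n W'" for W W' x y
    using gen_orth[OF _ W(4)[OF that(1-3)] that(4,5)] W(2)[OF that(1)] by (auto simp: tens_simple_iff)
  show "inj_on (gen m m n) \<X>"
  proof (rule inj_onI, rule ccontr)
    fix W W' assume A: "W \<in> \<X>" "W' \<in> \<X>" "gen m m n W = gen m m n W'" "W \<noteq> W'"
    obtain x where x: "x \<in> gen m m n W" "x \<noteq> 0"
      using A(1) fv.subspace_0[OF subspace_gen] unfolding \<X>_def by blast
    have "ip (words m n) x x = 0" using orth[of W W' x x] A x by (simp add: \<X>_def)
    thus False using x ip_self_zero[OF finite_words] gen_funs by blast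
  qed
  have "P n \<subseteq> fv.span (\<Union>(gen m m n ` \<X>))"
    unfolding gen_P[OF order_refl, of n, symmetric]
  proof (rule gen_minimal[OF fv.subspace_span])
    fix M :: "rat mat" and f assume M: "M \<in> carrier_mat n m" and f: "f \<in> P m"
    let ?S = "fv.span (\<Union>(gen m m n ` \<X>))"
    have "tact m n m M x \<in> ?S" if x: "x \<in> W" "W \<in> \<W>" for x W
    proof (cases "W \<in> \<X>")
      case True
      then show ?thesis using tact_in_gen[OF M x(1)] by (intro fv.span_base) blast
    next
      case False
      hence "tact m n m M x = 0" using tact_in_gen[OF M x(1), of m] x(2) by (auto simp: \<X>_def)
      then show ?thesis by (simp add: fv.span_zero)
    qed
    hence "fv.span (\<Union>\<W>) \<subseteq> {x. tact m n m M x \<in> ?S}"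
      by (intro fv.span_minimal subspace_vimage_tact fv.subspace_span) blast
    thus "tact m n m M f \<in> ?S" using f W(3) by blast
  qed
  moreover have "fv.span (\<Union>(gen m m n ` \<X>)) \<subseteq> P n"
  proof (rule fv.span_minimal[OF _ P_subspace])
    have "W \<subseteq> P m" if "W \<in> \<W>" for W
      unfolding W(3)[symmetric] using that by (auto intro: fv.span_base)
    hence "gen m m n W \<subseteq> P n" if "W \<in> \<X>" for W
      using that by (intro gen_P_subset) (auto simp: \<X>_def)
    thus "\<Union>(gen m m n ` \<X>) \<subseteq> P n" by blast
  qed
  ultimately show "tens.orth_decomposition m n (P n) (gen m m n ` \<X>)"
    unfolding tens.orth_decomposition_def
  proof (intro conjI ballI impI)
    show "finite (gen m m n ` \<X>)" using W(1) by (simp add: \<X>_def)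
    fix Y assume "Y \<in> gen m m n ` \<X>"
    then obtain W where Y: "W \<in> \<W>" "gen m m n W \<noteq> {0}" "Y = gen m m n W" by (auto simp: \<X>_def)
    thus "tens.simple m n Y" using simple_gen[OF W(2)] by simp
    fix Y' x y assume "Y' \<in> gen m m n ` \<X>" and ne: "Y \<noteq> Y'" and xy: "x \<in> Y" "y \<in> Y'"
    then obtain W' where Y': "W' \<in> \<W>" "Y' = gen m m n W'" by (auto simp: \<X>_def)
    have "W \<noteq> W'" using ne Y(3) Y'(2) by blast
    thus "ip (words m n) x y = 0" using orth[OF Y(1) Y'(1)] xy unfolding Y(3) Y'(2) by blast
  qed auto
qed

end

section \<open>Consistency and the stability conditions\<close>

locale tensor_subfunctor_model = tensor_subfunctor +
  fixes U :: "nat \<Rightarrow> 'v gl_rep" and \<phi> :: "nat \<Rightarrow> 'v \<Rightarrow> 'v" and \<Theta> :: "nat \<Rightarrow> (nat list \<Rightarrow> rat) \<Rightarrow> 'v"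
  assumes coord: "coord_rep n (U n) (P n) (\<Theta> n) (tact m n n)"
    and incl: "x \<in> P n \<Longrightarrow> \<phi> n (\<Theta> n x) = \<Theta> (Suc n) (tact m (Suc n) n (emb (Suc n) n) x)"
begin

lemma incl_fixed: "x \<in> P n \<Longrightarrow> tact m (Suc n) n (emb (Suc n) n) x = x"
  using P_funs[of n] funs_words_mono[of n "Suc n" m] by (intro tact_emb_fixed) auto

lemma incl_eq: "x \<in> P n \<Longrightarrow> \<phi> n (\<Theta> n x) = \<Theta> (Suc n) x"
  by (simp add: incl incl_fixed)

lemma carrier_U: "carrier (U n) = \<Theta> n ` P n"
  by (rule coord_rep.carrier_eq[OF coord])

lemma stab_iff: "coord_rep.stab n (P n) (tact m n n) X \<longleftrightarrow> stable m n X \<and> X \<subseteq> P n"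
  by (rule stab_tact_iff[OF coord stable_P])

lemma coord_sub: "stable m n X \<Longrightarrow> X \<subseteq> P n \<Longrightarrow>
    coord_rep n ((U n)\<lparr>carrier := \<Theta> n ` X\<rparr>) X (\<Theta> n) (tact m n n)"
  using coord_rep.restrict[OF coord] stab_iff by blast

lemma subrepE:
  assumes "subrep n (U n) W"
  obtains X where "stable m n X" "X \<subseteq> P n" "W = \<Theta> n ` X"
proof (rule coord_rep.subrep_preimage[OF coord assms])
  fix X assume "coord_rep.stab n (P n) (tact m n n) X" "W = \<Theta> n ` X"
  thus thesis using that[of X] stab_iff[of n X] by blast
qed

lemma orbit_span_incl:
  assumes "X \<subseteq> P n"
  shows "orbit_span (Suc n) (U (Suc n)) (\<phi> n ` \<Theta> n ` X) = \<Theta> (Suc n) ` gen m n (Suc n) X"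
proof -
  have "\<phi> n ` \<Theta> n ` X = \<Theta> (Suc n) ` X"
    unfolding image_image using assms incl_eq by (intro image_cong) auto
  moreover have "X \<subseteq> P (Suc n)" using assms P_mono[of n "Suc n"] by auto
  ultimately show ?thesis
    using coord_rep.orbit_span_image[OF coord[of "Suc n"], of X] span_GL_orbit[of X m n "Suc n"] assms P_funs[of n]
    by simp
qed

lemma iso_schur:
  assumes X: "stable m n X" "X \<subseteq> P n" and l: "is_partition l" "num_rows l \<le> n"
  shows "rep_iso n ((U n)\<lparr>carrier := \<Theta> n ` X\<rparr>) (schur l n) \<longleftrightarrow> sum_list l = m \<and> tiso m n X (schur_set l n)"
proof (cases "sum_list l = m")
  case True
  have "coord_rep n (schur l n) (schur_set l n) (\<lambda>x. x) (tact m n n)"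
    using coord_rep_schur[of n l] by (simp only: True)
  from rep_iso_tact_iff[OF coord_sub[OF X] this X(1)] show ?thesis using True by blast
next
  case False
  then show ?thesis using iso_schur_degree[OF coord_sub[OF X] stableD(2)[OF X(1)] l] by blast
qed

lemma decomposition:
  assumes D: "tens.orth_decomposition m n (P n) \<X>"
  shows "internal_direct_sum (U n) ((`) (\<Theta> n) ` \<X>)"
    and "W \<in> \<X> \<Longrightarrow> stable m n W" "W \<in> \<X> \<Longrightarrow> W \<subseteq> P n" "W \<in> \<X> \<Longrightarrow> tens.simple m n W"
    and "W \<in> \<X> \<Longrightarrow> subrep n (U n) (\<Theta> n ` W)"
    and "W \<in> \<X> \<Longrightarrow> irreducible_rep n ((U n)\<lparr>carrier := \<Theta> n ` W\<rparr>)"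
proof -
  have X: "fv.span (\<Union>\<X>) = P n" "\<And>W. W \<in> \<X> \<Longrightarrow> tens.simple m n W"
    "\<And>W W' x y. W \<in> \<X> \<Longrightarrow> W' \<in> \<X> \<Longrightarrow> W \<noteq> W' \<Longrightarrow> x \<in> W \<Longrightarrow> y \<in> W' \<Longrightarrow> ip (words m n) x y = 0"
    using D unfolding tens.orth_decomposition_def by blast+
  have st: "stable m n W" if "W \<in> \<X>" for W using X(2)[OF that] by (simp add: tens_simple_iff)
  show "internal_direct_sum (U n) ((`) (\<Theta> n) ` \<X>)"
    by (rule coord_rep.internal_direct_sum_image[OF coord finite_words P_funs])
      (use X(1,3) stableD(1)[OF st] in blast)+
  have sub: "W \<subseteq> P n" if "W \<in> \<X>" for W
    unfolding X(1)[symmetric] using that by (auto intro: fv.span_base)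
  assume W: "W \<in> \<X>"
  show "stable m n W" "W \<subseteq> P n" "tens.simple m n W" using W st sub X(2) by auto
  show "subrep n (U n) (\<Theta> n ` W)"
    using coord_rep.subrep_image[OF coord] stab_iff st[OF W] sub[OF W] by blast
  show "irreducible_rep n ((U n)\<lparr>carrier := \<Theta> n ` W\<rparr>)"
    using irreducible_tact_iff[OF coord_sub[OF st[OF W] sub[OF W]] st[OF W]] X(2)[OF W] by simp
qed

lemma has_multiplicityI:
  assumes D: "tens.orth_decomposition m n (P n) \<X>"
  shows "has_multiplicity n (U n) V (enat (card {W \<in> \<X>. rep_iso n ((U n)\<lparr>carrier := \<Theta> n ` W\<rparr>) V}))"
proof -
  let ?\<V> = "{W \<in> (`) (\<Theta> n) ` \<X>. rep_iso n ((U n)\<lparr>carrier := W\<rparr>) V}"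
  let ?\<V>' = "{W \<in> \<X>. rep_iso n ((U n)\<lparr>carrier := \<Theta> n ` W\<rparr>) V}"
  have fin: "finite \<X>" using D by (simp add: tens.orth_decomposition_def)
  have "inj_on ((`) (\<Theta> n)) \<X>"
    using coord_rep.\<theta>_image_eq_iff[OF coord] decomposition(3)[OF D] by (auto simp: inj_on_def)
  hence "inj_on ((`) (\<Theta> n)) ?\<V>'" by (rule inj_on_subset) auto
  moreover have "?\<V> = (`) (\<Theta> n) ` ?\<V>'" by auto
  ultimately have "card ?\<V> = card ?\<V>'" by (simp add: card_image)
  moreover have "finite ?\<V>" using fin by simp
  ultimately show ?thesis
    unfolding has_multiplicity_def Let_def using decomposition[OF D]
    by (intro exI[of _ "(`) (\<Theta> n) ` \<X>"]) auto
qed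

text \<open>A highest weight has exactly \<open>n\<close> parts, zeros included. Its last part
  \<open>k\<close> is the power of the determinant, and subtracting it from all parts gives the
  shape used by \<open>V_rep\<close>; this is the shift in \<open>hwv_iso\<close>.\<close>

lemma simple_iso_V_rep:
  assumes n: "1 \<le> n" and W: "tens.simple m n W" "W \<subseteq> P n"
  shows "\<exists>l. is_pseudo_partition l \<and> length l \<le> n \<and>
    rep_iso n ((U n)\<lparr>carrier := \<Theta> n ` W\<rparr>) (V_rep l n)"
proof -
  have st: "stable m n W" "W \<noteq> {0}" using W(1) by (simp_all add: tens_simple_iff)
  obtain f \<mu> where f: "f \<in> W" "hwv m n (nth \<mu>) f" "is_partition \<mu>" "length \<mu> = n"
    using hwv_exists[OF st] by metis
  have ne: "\<mu> \<noteq> []" using f(4) n by auto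
  define k where "k = last \<mu>"
  define \<nu> where "\<nu> = map (\<lambda>a. a - k) \<mu>"
  have k: "k \<le> \<mu> ! i" if "i < n" for i
    using is_partition_nth_mono[OF f(3), of i "n - 1"] that f(4) ne by (simp add: k_def last_conv_nth)
  have part: "is_partition \<nu>"
    unfolding is_partition_def \<nu>_def sorted_wrt_map using f(3)[unfolded is_partition_def]
    by (rule sorted_wrt_mono_rel[rotated]) auto
  have len: "length \<nu> = n" by (simp add: \<nu>_def f(4))
  have nr: "num_rows \<nu> \<le> n" unfolding num_rows_def using len by (metis length_filter_le)
  have shift: "\<mu> ! i = \<nu> ! i + k" if "i < n" for i using k[OF that] that f(4) by (simp add: \<nu>_def)
  define l where "l = map int \<mu>"
  have "last l = int k" using ne by (simp add: l_def k_def last_map)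
  hence V: "V_rep l n = det_twist (int k) (schur \<nu> n)"
    by (simp add: V_rep_def l_def \<nu>_def o_def nat_diff_distrib')
  obtain \<psi> where \<psi>: "lin_on W \<psi>" "bij_betw \<psi> W (schur_set \<nu> n)"
    "\<And>M x. M \<in> carrier_mat n n \<Longrightarrow> x \<in> W \<Longrightarrow>
      \<psi> (tact m n n M x) = fscale (det M ^ k) (tact (sum_list \<nu>) n n M (\<psi> x))"
    using hwv_iso[OF f(2) hwv_hw_vector[OF part len] shift W(1) f(1) simple_schur_set[OF part nr]
        hw_vector_in_schur_set[OF part nr]] by metis
  have "rep_iso n ((U n)\<lparr>carrier := \<Theta> n ` W\<rparr>) (V_rep l n)"
    unfolding V coord_rep_iso[OF coord_sub[OF st(1) W(2)] coord_rep_det_twist[OF coord_rep_schur]]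
    using \<psi> by (intro exI[of _ \<psi>]) (auto simp: GL_mat)
  moreover have "is_pseudo_partition l"
    unfolding is_pseudo_partition_def l_def sorted_wrt_map
    using ne f(3) by (auto simp: is_partition_def elim: sorted_wrt_mono_rel[rotated])
  ultimately show ?thesis using f(4) by (intro exI[of _ l]) (auto simp: l_def)
qed

lemma consistent: "consistent_sequence U \<phi>"
  unfolding consistent_sequence_def
proof (intro allI impI conjI ballI)
  fix n :: nat assume n: "1 \<le> n"
  show "gl_representation n (U n)" by (rule coord_rep.gl_representation[OF coord])
  obtain \<X> where D: "tens.orth_decomposition m n (P n) \<X>"
    using tens.orth_decomposition_exists[OF stable_P] by blast
  show "\<exists>\<W>. internal_direct_sum (U n) \<W> \<and> (\<forall>W\<in>\<W>. subrep n (U n) W \<and>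
      (\<exists>l. is_pseudo_partition l \<and> length l \<le> n \<and> rep_iso n ((U n)\<lparr>carrier := W\<rparr>) (V_rep l n)))"
    using decomposition[OF D] simple_iso_V_rep[OF n] by (intro exI[of _ "(`) (\<Theta> n) ` \<X>"]) auto
next
  fix n :: nat assume n: "1 \<le> n"
  interpret A: coord_rep n "U n" "P n" "\<Theta> n" "tact m n n" by (rule coord)
  interpret B: coord_rep "Suc n" "U (Suc n)" "P (Suc n)" "\<Theta> (Suc n)" "tact m (Suc n) (Suc n)" by (rule coord)
  have PS: "x \<in> P (Suc n)" if "x \<in> P n" for x using that P_mono[of n "Suc n"] by auto
  show "\<phi> n \<in> module_hom QQ (U n) (U (Suc n))"
    unfolding module_hom_def
  proof (intro CollectI conjI allI impI funcsetI)
    fix v assume "v \<in> carrier (U n)"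
    thus "\<phi> n v \<in> carrier (U (Suc n))" by (elim A.carrierE) (simp add: incl_eq B.\<theta>_carrier PS)
  next
    fix v w assume "v \<in> carrier (U n) \<and> w \<in> carrier (U n)"
    then obtain x y where xy: "x \<in> P n" "y \<in> P n" "v = \<Theta> n x" "w = \<Theta> n y" by (meson A.carrierE)
    thus "\<phi> n (v \<oplus>\<^bsub>U n\<^esub> w) = \<phi> n v \<oplus>\<^bsub>U (Suc n)\<^esub> \<phi> n w"
      by (simp add: incl_eq PS A.P_closed flip: A.\<theta>_add B.\<theta>_add)
  next
    fix c v assume "c \<in> carrier QQ \<and> v \<in> carrier (U n)"
    then obtain x where x: "x \<in> P n" "v = \<Theta> n x" by (meson A.carrierE)
    thus "\<phi> n (c \<odot>\<^bsub>U n\<^esub> v) = c \<odot>\<^bsub>U (Suc n)\<^esub> \<phi> n v"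
      by (simp add: incl_eq PS A.P_closed flip: A.\<theta>_smult B.\<theta>_smult)
  qed
  show "\<phi> n (act (U n) g u) = act (U (Suc n)) (GL_stab n g) (\<phi> n u)"
    if g: "g \<in> carrier (GL n)" and u: "u \<in> carrier (U n)" for g u
  proof -
    obtain x where x: "x \<in> P n" "u = \<Theta> n x" using u by (rule A.carrierE)
    note s = emb_GL_stab[OF g]
    have "tact m n n g x = tact m (Suc n) n (emb (Suc n) n) (tact m n n g x)"
      using A.\<alpha>_closed[OF g x(1)] by (simp add: incl_fixed)
    also have "\<dots> = tact m (Suc n) (Suc n) (GL_stab n g) (tact m (Suc n) n (emb (Suc n) n) x)"
      by (simp add: tact_mult[OF emb_carrier GL_mat[OF g]] tact_mult[OF GL_mat[OF s(1)] emb_carrier] s(2))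
    also have "\<dots> = tact m (Suc n) (Suc n) (GL_stab n g) x" by (simp add: incl_fixed[OF x(1)])
    finally show ?thesis
      using x A.\<alpha>_act[OF g x(1)] B.\<alpha>_act[OF s(1) PS[OF x(1)]] A.\<alpha>_closed[OF g x(1)] incl_eq by simp
  qed
qed

lemma injective: "stable_I U \<phi>"
  unfolding stable_I_def carrier_U
proof (intro allI impI inj_onI)
  fix n v w assume "v \<in> \<Theta> n ` P n" "w \<in> \<Theta> n ` P n" "\<phi> n v = \<phi> n w"
  then obtain x y where xy: "x \<in> P n" "y \<in> P n" "v = \<Theta> n x" "w = \<Theta> n y" "\<Theta> (Suc n) x = \<Theta> (Suc n) y"
    by (auto simp: incl_eq)
  have "P n \<subseteq> P (Suc n)" by (rule P_mono) simp
  thus "v = w" using coord_rep.\<theta>_inj[OF coord[of "Suc n"], of x y] xy by auto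
qed

lemma orbit_spans: "m \<le> n \<Longrightarrow> stable_II_at U \<phi> n"
  unfolding stable_II_at_def carrier_U orbit_span_incl[OF order_refl] by (simp add: gen_P)

text \<open>Since \<open>l\<close> has at most \<open>n\<close> rows, the highest weight vector
  avoids the last letter. The corresponding vector of \<open>W\<close> then comes from
  \<open>P n\<close>, and a simple \<open>W\<close> lies in the orbit span as soon as one of its
  nonzero vectors does.\<close>

lemma orbit_spans_rows: "stable_II_rows_at U \<phi> n"
  unfolding stable_II_rows_at_def
proof (intro allI impI, elim conjE)
  fix l W
  assume l: "is_partition l" "num_rows l \<le> n" and W: "subrep (Suc n) (U (Suc n)) W"
    and iso: "rep_iso (Suc n) ((U (Suc n))\<lparr>carrier := W\<rparr>) (schur l (Suc n))"
  obtain X where X: "stable m (Suc n) X" "X \<subseteq> P (Suc n)" "W = \<Theta> (Suc n) ` X" using subrepE[OF W] .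
  have l': "num_rows l \<le> Suc n" using l(2) by simp
  have d: "sum_list l = m" and ti: "tiso m (Suc n) X (schur_set l (Suc n))"
    using iso unfolding X(3) iso_schur[OF X(1,2) l(1) l'] by auto
  have simpleX: "tens.simple m (Suc n) X"
    using simple_tiso[OF X(1) ti] simple_schur_set[OF l(1) l'] d by simp
  obtain \<psi> where \<psi>: "lin_on X \<psi>" "bij_betw \<psi> X (schur_set l (Suc n))"
    "\<And>M x. M \<in> carrier_mat (Suc n) (Suc n) \<Longrightarrow> x \<in> X \<Longrightarrow>
      \<psi> (tact m (Suc n) (Suc n) M x) = tact m (Suc n) (Suc n) M (\<psi> x)"
    using ti unfolding tiso_def by blast
  have "hw_vector l \<in> \<psi> ` X" using hw_vector_in_schur_set[OF l(1) l'] \<psi>(2) by (simp add: bij_betw_def)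
  then obtain x where x: "x \<in> X" "\<psi> x = hw_vector l" by force
  have x0: "x \<noteq> 0" using x(2) lin_on_zero[OF \<psi>(1) stableD(1)[OF X(1)]] hw_vector_nonzero by auto
  \<comment> \<open>\<open>E\<close> erases the last letter; being a square matrix, it commutes with
    \<psi>.\<close>
  define E where "E = emb (Suc n) n * emb n (Suc n)"
  have E: "E \<in> carrier_mat (Suc n) (Suc n)" unfolding E_def by (rule mult_carrier_mat[OF emb_carrier emb_carrier])
  have Ef: "tact m (Suc n) (Suc n) E f = tact m (Suc n) n (emb (Suc n) n) (tact m n (Suc n) (emb n (Suc n)) f)" for f
    unfolding E_def by (rule tact_mult[OF emb_carrier emb_carrier, symmetric])
  have "tact m (Suc n) (Suc n) E (hw_vector l) = hw_vector l"
    unfolding Ef using hw_vector_funs[OF l] hw_vector_funs[OF l(1) l'] d by (simp add: tact_emb_fixed)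
  hence "\<psi> (tact m (Suc n) (Suc n) E x) = \<psi> x" using \<psi>(3)[OF E x(1)] x(2) by simp
  hence "tact m (Suc n) (Suc n) E x = x"
    using \<psi>(2) x(1) stableD(3)[OF X(1) E x(1)] by (auto simp: bij_betw_def inj_on_def)
  moreover have "tact m n (Suc n) (emb n (Suc n)) x \<in> P n" using P_tact[OF emb_carrier] x(1) X(2) by blast
  ultimately have xg: "x \<in> gen m n (Suc n) (P n)" unfolding Ef using tact_in_gen[OF emb_carrier] by metis
  have "stable m (Suc n) (X \<inter> gen m n (Suc n) (P n))"
    unfolding stable_def
    using stableD[OF X(1)] stableD[OF stable_gen[of m "Suc n" n "P n"]] by (auto simp: fv.subspace_inter)
  moreover have "X \<inter> gen m n (Suc n) (P n) \<noteq> {0}" using x(1) xg x0 by blast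
  ultimately have "X \<inter> gen m n (Suc n) (P n) = X" using simpleX unfolding tens_simple_iff by blast
  hence "X \<subseteq> gen m n (Suc n) (P n)" by blast
  thus "W \<subseteq> orbit_span (Suc n) (U (Suc n)) (\<phi> n ` carrier (U n))"
    unfolding carrier_U orbit_span_incl[OF order_refl] X(3) by (rule image_mono)
qed

text \<open>The constant counts the summands on \<open>m\<close> letters that are isomorphic to the
  Schur functor; it is 0 unless \<open>l\<close> has \<open>m\<close> boxes. Passing to
  \<open>n\<close> letters and back by \<open>gen\<close> shows that it is also the count on
  \<open>n\<close> letters. For a negative last part nothing is isomorphic.\<close>

lemma multiplicities: "stable_III U"
  unfolding stable_III_def
proof (intro conjI allI impI)
  fix l assume l: "is_partition l"
  obtain \<W> where D: "tens.orth_decomposition m m (P m) \<W>"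
    using tens.orth_decomposition_exists[OF stable_P] by blast
  define \<V> where "\<V> = {W \<in> \<W>. sum_list l = m \<and> tiso m m W (schur_set l m)}"
  show "\<exists>c. \<forall>n\<ge>1. num_rows l \<le> n \<longrightarrow> has_multiplicity n (U n) (schur l n) c"
  proof (intro exI[of _ "enat (card \<V>)"] allI impI)
    fix n :: nat assume "1 \<le> n" and nr: "num_rows l \<le> n"
    define \<X> where "\<X> = {W \<in> \<W>. gen m m n W \<noteq> {0}}"
    note Dn = orth_decomposition_gen[OF D, of n, folded \<X>_def]
    have W: "stable m m W" "tens.simple m m W" if "W \<in> \<W>" for W
      using decomposition(2,4)[OF D that] by auto
    have iff: "rep_iso n ((U n)\<lparr>carrier := \<Theta> n ` gen m m n W\<rparr>) (schur l n) \<longleftrightarrow> W \<in> \<V>" if "W \<in> \<X>" for W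
    proof -
      have WX: "W \<in> \<W>" "gen m m n W \<noteq> {0}" using that by (auto simp: \<X>_def)
      have sub: "gen m m n W \<subseteq> P n" using decomposition(3)[OF Dn(1)] that by blast
      \<comment> \<open>No information is lost on \<open>n\<close> letters, so an isomorphism there
        can be brought back to \<open>m\<close> letters. There the Schur functor is nonzero too, a
        partition of \<open>m\<close> having at most \<open>m\<close> rows.\<close>
      have backW: "gen m n m (gen m m n W) = W"
        by (rule gen_reflect[OF W(2)[OF WX(1)] stable_gen order_refl WX(2)])
      have "tiso m n (gen m m n W) (schur_set l n) \<longleftrightarrow> tiso m m W (schur_set l m)" if d: "sum_list l = m"
      proof -
        have nm: "num_rows l \<le> m" using num_rows_le_sum_list[of l] d by simp
        have st: "stable m k (schur_set l k)" for k using stable_schur_set[of l k] d by simp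
        have "tiso m m W (schur_set l m)" if "tiso m n (gen m m n W) (schur_set l n)"
          using tiso_gen[OF stable_gen st that, of m] gen_schur_set[OF l nr nm] backW d by simp
        moreover have "tiso m n (gen m m n W) (schur_set l n)" if "tiso m m W (schur_set l m)"
          using tiso_gen[OF W(1)[OF WX(1)] st that, of n] gen_schur_set[OF l nm nr] d by simp
        ultimately show ?thesis by blast
      qed
      thus ?thesis unfolding iso_schur[OF stable_gen sub l nr] \<V>_def using WX(1) by auto
    qed
    \<comment> \<open>The counted summands are not among those removed: on \<open>n\<close> letters
      they are isomorphic to a Schur functor with at most \<open>n\<close> rows, which is simple and
      thus nonzero.\<close>
    have "\<V> \<subseteq> \<X>"
    proof
      fix W assume "W \<in> \<V>"
      hence WV: "W \<in> \<W>" "sum_list l = m" "tiso m m W (schur_set l m)" by (auto simp: \<V>_def)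
      have nm: "num_rows l \<le> m" using num_rows_le_sum_list[of l] WV(2) by simp
      have st: "stable m m (schur_set l m)" using stable_schur_set[of l m] WV(2) by simp
      have "tiso m n (gen m m n W) (schur_set l n)"
        using tiso_gen[OF W(1)[OF WV(1)] st WV(3), of n] gen_schur_set[OF l nm nr] WV(2) by simp
      hence "tens.simple m n (gen m m n W)"
        using simple_tiso[OF stable_gen] simple_schur_set[OF l nr] WV(2) by metis
      thus "W \<in> \<X>" using WV(1) by (auto simp: \<X>_def tens_simple_iff)
    qed
    hence "{Y \<in> gen m m n ` \<X>. rep_iso n ((U n)\<lparr>carrier := \<Theta> n ` Y\<rparr>) (schur l n)} = gen m m n ` \<V>"
      using iff by blast
    moreover have "card (gen m m n ` \<V>) = card \<V>"
      by (rule card_image[OF inj_on_subset[OF Dn(2) \<open>\<V> \<subseteq> \<X>\<close>]])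
    ultimately show "has_multiplicity n (U n) (schur l n) (enat (card \<V>))"
      using has_multiplicityI[OF Dn(1), of "schur l n"] by simp
  qed
next
  fix l :: "int list" and n
  assume l: "is_pseudo_partition l \<and> last l < 0" and n: "1 \<le> n" "length l \<le> n"
  obtain \<X> where D: "tens.orth_decomposition m n (P n) \<X>"
    using tens.orth_decomposition_exists[OF stable_P] by blast
  have "{W \<in> \<X>. rep_iso n ((U n)\<lparr>carrier := \<Theta> n ` W\<rparr>) (V_rep l n)} = {}"
    using det_twist_no_polynomial_iso[OF coord_sub stableD(2)] decomposition(2,3)[OF D] l n(2) by blast
  hence "has_multiplicity n (U n) (V_rep l n) (enat (card ({} :: (nat list \<Rightarrow> rat) set set)))"
    using has_multiplicityI[OF D, of "V_rep l n"] by metis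
  thus "has_multiplicity n (U n) (V_rep l n) 0" by (simp add: zero_enat_def)
qed

lemma orbit_spans_iso: "stable_IV U \<phi>"
  unfolding stable_IV_def
proof (intro allI impI, elim conjE)
  fix n :: nat and l W
  assume l: "is_partition l" "num_rows l \<le> n" and W: "subrep n (U n) W"
    and iso: "rep_iso n ((U n)\<lparr>carrier := W\<rparr>) (schur l n)"
  obtain X where X: "stable m n X" "X \<subseteq> P n" "W = \<Theta> n ` X" using subrepE[OF W] .
  have l': "num_rows l \<le> Suc n" using l(2) by simp
  have d: "sum_list l = m" and ti: "tiso m n X (schur_set l n)"
    using iso unfolding X(3) iso_schur[OF X(1,2) l] by auto
  have "stable m n (schur_set l n)" using stable_schur_set[of l n] d by simp
  hence "tiso m (Suc n) (gen m n (Suc n) X) (schur_set l (Suc n))"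
    using tiso_gen[OF X(1) _ ti, of "Suc n"] gen_schur_set[OF l l'] d by simp
  thus "rep_iso (Suc n) ((U (Suc n))\<lparr>carrier := orbit_span (Suc n) (U (Suc n)) (\<phi> n ` W)\<rparr>) (schur l (Suc n))"
    unfolding X(3) orbit_span_incl[OF X(2)] iso_schur[OF stable_gen gen_P_subset[OF X(2)] l(1) l'] using d by blast
qed

theorem simply_stable: "simply_representation_stable_from m U \<phi>"
  unfolding simply_representation_stable_from_def
  using consistent injective orbit_spans orbit_spans_rows multiplicities orbit_spans_iso by blast

end

theorem corollary5p7:
  fixes m :: nat
  assumes "1 \<le> m"
  shows "simply_representation_stable_from m (free_lie_rep m) free_lie_incl"
proof -
  interpret tensor_subfunctor_model m "lie_model m" "free_lie_rep m" free_lie_incl "lie_rep_map m"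
  proof (intro tensor_subfunctor_model.intro tensor_subfunctor.intro tensor_subfunctor_model_axioms.intro)
    show "lie_model m n \<subseteq> funs (words m n)" for n by (rule lie_model_funs)
    show "fv.subspace (lie_model m n)" for n by (rule subspace_lie_model)
    show "tact m k n M x \<in> lie_model m k" if "M \<in> carrier_mat k n" "x \<in> lie_model m n" for M k n x
      by (rule tact_lie_model[OF assms that])
    show "coord_rep n (free_lie_rep m n) (lie_model m n) (lie_rep_map m n) (tact m n n)" for n
      by (rule coord_rep_free_lie[OF assms])
    show "free_lie_incl n (lie_rep_map m n x) = lie_rep_map m (Suc n) (tact m (Suc n) n (emb (Suc n) n) x)" for n x
      by (rule free_lie_incl_map[OF assms])
  qed
  show ?thesis by (rule simply_stable)
qed

end
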